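(* Let $R=\bigoplus_{\alpha\in\Gamma}R_\alpha$ be a graded integral domain. Then $\operatorname{Zar}_h(R)$ (with its Zariski topology) is homeomorphic to $\operatorname{Spec}(\operatorname{Kr_h}(R,b))$. In particular $\operatorname{Zar}_h(R)$ is a spectral space.
   Context: $\Gamma$ is a nonzero torsionless commutative cancellative monoid (written additively) with quotient group $\langle\Gamma\rangle$; $R=\bigoplus_{\alpha\in\Gamma}R_\alpha$ is an integral domain graded by $\Gamma$, with quotient field $K$; $H$ is the set of nonzero homogeneous elements of $R$, and $R_H$ is the $\langle\Gamma\rangle$-graded localization with $(R_H)_\alpha=\{a/b\mid a\in R_\beta,\ 0\neq b\in R_\gamma,\ \beta-\gamma=\alpha\}$. A homogeneous overring of $R$ is a ring $A$ with $R\subseteq A\subseteq R_H$ and $A=\bigoplus_{\alpha\in\langle\Gamma\rangle}(A\cap(R_H)_\alpha)$. A gr-valuation overring of $R$ is a homogeneous overring $V$ such that for every nonzero homogeneous $x\in R_H$, $x\in V$ or $x^{-1}\in V$. $\operatorname{Zar}_h(R)$ is the set of all gr-valuation overrings of $R$; its Zariski topology has as subbasic open sets the sets $\operatorname{Zar}_h(R[u])=\{V\in\operatorname{Zar}_h(R)\mid u\in V\}$, $u$ ranging over homogeneous elements of $R_H$. The $b$-operation is the semistar operation on $R$ given by $E^b=\bigcap\{EV\mid V\text{ a valuation overring of }R\}$ for each nonzero $R$-submodule $E$ of $K$. For $a\in R$, $C(a)$ is the ideal of $R$ generated by the homogeneous components of $a$; for $f=f_0+f_1X+\cdots+f_nX^n\in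 R[X]$, put $\mathcal A_f:=\sum_{i=0}^nC(f_i)$. The homogeneous Kronecker function ring of $R$ with respect to $b$ is $$\operatorname{Kr_h}(R,b):=\left\{\tfrac fg\ \middle|\ f,g\in R[X],\ g\ne0,\text{ and there is }0\ne h\in R[X]\text{ with }\mathcal A_f\mathcal A_h\subseteq(\mathcal A_g\mathcal A_h)^b\right\},$$ an integral domain with quotient field $K(X)$. $\operatorname{Spec}$ carries the Zariski topology. A topological space is spectral if it is quasi-compact and $T_0$, its quasi-compact open subsets are closed under finite intersections and form a basis, and every nonempty irreducible closed subset has a generic point. *)

theory Defs
  imports
    "HOL-Analysis.Analysis"
    "HOL-Algebra.Algebraic_Closure_Type"
    "HOL-Algebra.Ideal_Product"
    "HOL-Algebra.Subrings"
    "HOL-Computational_Algebra.Polynomial_Factorial"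
begin

text \<open>
  The monoid \<open>\<Gamma>\<close> is a type \<open>'g\<close> of sort \<open>{comm_monoid_add, cancel_semigroup_add}\<close>. (The class
  \<open>cancel_comm_monoid_add\<close> would be too special, since it also requires a total subtraction with
  \<open>a - b - c = a - (b + c)\<close>.) The domain \<open>R\<close> is a type \<open>'a::idom\<close>, its quotient field \<open>K\<close> is
  \<open>'a fract\<close>, with \<open>R\<close> embedded by \<^const>\<open>to_fract\<close>, and \<open>K(X)\<close> is \<open>'a poly fract\<close>, the quotient
  field of \<open>R[X]\<close>. HOL-Algebra notions are applied to these types via
  \<^const>\<open>ring_of_type_algebra\<close>.
\<close>


section \<open>The quotient group of a cancellative commutative monoid\<close>

definition diff_rel :: "'g::{comm_monoid_add, cancel_semigroup_add} \<times> 'g \<Rightarrow> 'g \<times> 'g \<Rightarrow> bool"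
  where "diff_rel p q \<longleftrightarrow> fst p + snd q = fst q + snd p"

lemma equivp_diff_rel:
  "equivp (diff_rel :: 'g::{comm_monoid_add, cancel_semigroup_add} \<times> 'g \<Rightarrow> _)"
proof (rule equivpI)
  show "reflp (diff_rel :: 'g \<times> 'g \<Rightarrow> _)" and "symp (diff_rel :: 'g \<times> 'g \<Rightarrow> _)"
    by (auto simp: reflp_def symp_def diff_rel_def)
  show "transp (diff_rel :: 'g \<times> 'g \<Rightarrow> _)"
  proof (rule transpI)
    fix p q r :: "'g \<times> 'g"
    assume pq: "diff_rel p q" and qr: "diff_rel q r"
    have "(fst p + snd r) + snd q = (fst p + snd q) + snd r"
      by (simp add: ac_simps)
    also have "\<dots> = (fst q + snd r) + snd p"
      using pq by (simp add: diff_rel_def ac_simps)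
    also have "\<dots> = (fst r + snd p) + snd q"
      using qr by (simp add: diff_rel_def ac_simps)
    finally have "fst p + snd r = fst r + snd p"
      by (rule add_right_imp_eq)
    then show "diff_rel p r"
      by (simp add: diff_rel_def)
  qed
qed

quotient_type (overloaded) 'g quotient_group =
  "'g::{comm_monoid_add, cancel_semigroup_add} \<times> 'g" / diff_rel
  by (rule equivp_diff_rel)

instantiation quotient_group :: ("{comm_monoid_add, cancel_semigroup_add}") ab_group_add
begin

lift_definition zero_quotient_group :: "'a quotient_group" is "(0, 0)" .

lift_definition plus_quotient_group ::
    "'a quotient_group \<Rightarrow> 'a quotient_group \<Rightarrow> 'a quotient_group"
  is "\<lambda>p q. (fst p + fst q, snd p + snd q)"
proof -
  fix p p' q q' :: "'a \<times> 'a"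
  assume p: "diff_rel p p'" and q: "diff_rel q q'"
  have "(fst p + fst q) + (snd p' + snd q') = (fst p + snd p') + (fst q + snd q')"
    by (simp add: ac_simps)
  also have "\<dots> = (fst p' + snd p) + (fst q' + snd q)"
    using p q by (simp add: diff_rel_def)
  also have "\<dots> = (fst p' + fst q') + (snd p + snd q)"
    by (simp add: ac_simps)
  finally show "diff_rel (fst p + fst q, snd p + snd q) (fst p' + fst q', snd p' + snd q')"
    by (simp add: diff_rel_def)
qed

lift_definition uminus_quotient_group :: "'a quotient_group \<Rightarrow> 'a quotient_group"
  is "\<lambda>p. (snd p, fst p)"
  by (simp add: diff_rel_def add.commute)

definition minus_quotient_group ::
    "'a quotient_group \<Rightarrow> 'a quotient_group \<Rightarrow> 'a quotient_group"
  where "minus_quotient_group x y = x + - y"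

instance
proof
  fix x y z :: "'a quotient_group"
  show "x + y + z = x + (y + z)"
    by transfer (simp add: diff_rel_def ac_simps)
  show "x + y = y + x"
    by transfer (simp add: diff_rel_def ac_simps)
  show "0 + x = x"
    by transfer (simp add: diff_rel_def)
  show "- x + x = 0"
    by transfer (simp add: diff_rel_def ac_simps)
  show "x - y = x + - y"
    by (rule minus_quotient_group_def)
qed

end

lift_definition of_monoid ::
    "'g::{comm_monoid_add, cancel_semigroup_add} \<Rightarrow> 'g quotient_group"
  is "\<lambda>a. (a, 0)" .


section \<open>Graded integral domains\<close>

definition finsupp_families :: "('i \<Rightarrow> 'b::comm_monoid_add set) \<Rightarrow> ('i \<Rightarrow> 'b) set"
  where "finsupp_families M = {c. (\<forall>i. c i \<in> M i) \<and> finite {i. c i \<noteq> 0}}"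

definition family_sum :: "('i \<Rightarrow> 'b::comm_monoid_add) \<Rightarrow> 'b"
  where "family_sum c = (\<Sum>i | c i \<noteq> 0. c i)"

definition is_direct_sum :: "('i \<Rightarrow> 'b::comm_monoid_add set) \<Rightarrow> 'b set \<Rightarrow> bool"
  where "is_direct_sum M A \<longleftrightarrow> bij_betw family_sum (finsupp_families M) A"

locale graded_domain =
  fixes R :: "'g::{comm_monoid_add, cancel_semigroup_add} \<Rightarrow> 'a::idom set"
  assumes component_subgroup: "\<And>\<alpha>. additive_subgroup (R \<alpha>) ring_of_type_algebra"
    and direct_sum: "is_direct_sum R UNIV"
    and component_mult: "\<And>\<alpha> \<beta> a b. a \<in> R \<alpha> \<Longrightarrow> b \<in> R \<beta> \<Longrightarrow> a * b \<in> R (\<alpha> + \<beta>)"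

definition homogeneous_component ::
    "('g::{comm_monoid_add, cancel_semigroup_add} \<Rightarrow> 'a::idom set) \<Rightarrow> 'a \<Rightarrow> 'g \<Rightarrow> 'a"
  where "homogeneous_component R a = the_inv_into (finsupp_families R) family_sum a"

definition nonzero_homogeneous ::
    "('g::{comm_monoid_add, cancel_semigroup_add} \<Rightarrow> 'a::idom set) \<Rightarrow> 'a set"
  where "nonzero_homogeneous R = (\<Union>\<alpha>. R \<alpha>) - {0}"

definition homogeneous_localization ::
    "('g::{comm_monoid_add, cancel_semigroup_add} \<Rightarrow> 'a::idom set) \<Rightarrow> 'a fract set"
  where "homogeneous_localization R = {Fract a b | a b. b \<in> nonzero_homogeneous R}"

text \<open>
  Zero is inserted because the components \<open>R \<gamma>\<close> may vanish: if \<open>\<Gamma>\<close> is the monoid of natural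
  numbers and \<open>R\<close> is concentrated in degree 0, there are no fractions of degree \<open>- 1\<close> at all, but the
  component of that degree has to be the zero group. If all \<open>R \<gamma>\<close> are nonzero, it changes nothing.
\<close>

definition localization_component ::
    "('g::{comm_monoid_add, cancel_semigroup_add} \<Rightarrow> 'a::idom set)
      \<Rightarrow> 'g quotient_group \<Rightarrow> 'a fract set"
  where "localization_component R \<alpha> = insert 0
    {Fract a b | a b. \<exists>\<beta> \<gamma>. a \<in> R \<beta> \<and> b \<in> R \<gamma> \<and> b \<noteq> 0 \<and> of_monoid \<beta> - of_monoid \<gamma> = \<alpha>}"

definition homogeneous_fractions ::
    "('g::{comm_monoid_add, cancel_semigroup_add} \<Rightarrow> 'a::idom set) \<Rightarrow> 'a fract set"
  where "homogeneous_fractions R = (\<Union>\<alpha>. localization_component R \<alpha>)"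


section \<open>Homogeneous overrings and the space of graded valuation overrings\<close>

definition homogeneous_overring ::
    "('g::{comm_monoid_add, cancel_semigroup_add} \<Rightarrow> 'a::idom set) \<Rightarrow> 'a fract set \<Rightarrow> bool"
  where "homogeneous_overring R A \<longleftrightarrow>
    subring A ring_of_type_algebra \<and> range to_fract \<subseteq> A \<and> A \<subseteq> homogeneous_localization R \<and>
    is_direct_sum (\<lambda>\<alpha>. A \<inter> localization_component R \<alpha>) A"

definition Zar_h ::
    "('g::{comm_monoid_add, cancel_semigroup_add} \<Rightarrow> 'a::idom set) \<Rightarrow> 'a fract set set"
  where "Zar_h R = {V. homogeneous_overring R V \<and>
    (\<forall>x \<in> homogeneous_fractions R. x \<noteq> 0 \<longrightarrow> x \<in> V \<or> inverse x \<in> V)}"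

definition Zar_h_topology ::
    "('g::{comm_monoid_add, cancel_semigroup_add} \<Rightarrow> 'a::idom set) \<Rightarrow> 'a fract set topology"
  where "Zar_h_topology R =
    topology_generated_by ((\<lambda>u. {V \<in> Zar_h R. u \<in> V}) ` homogeneous_fractions R)"


section \<open>The homogeneous Kronecker function ring\<close>

definition valuation_overring :: "'a::idom fract set \<Rightarrow> bool"
  where "valuation_overring V \<longleftrightarrow>
    subring V ring_of_type_algebra \<and> range to_fract \<subseteq> V \<and>
    (\<forall>x. x \<noteq> 0 \<longrightarrow> x \<in> V \<or> inverse x \<in> V)"

text \<open>
  \<^const>\<open>ideal_prod\<close> is the set of finite sums of products, so it also yields the product \<open>E V\<close>
  of submodules of \<open>K\<close>.
\<close>

definition b_operation :: "'a::idom fract set \<Rightarrow> 'a fract set"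
  where "b_operation E = (\<Inter>V \<in> {V. valuation_overring V}. ideal_prod ring_of_type_algebra E V)"

definition content_ideal ::
    "('g::{comm_monoid_add, cancel_semigroup_add} \<Rightarrow> 'a::idom set) \<Rightarrow> 'a \<Rightarrow> 'a set"
  where "content_ideal R a = genideal ring_of_type_algebra (range (homogeneous_component R a))"

text \<open>The sum below is the sum of subsets from \<open>HOL-Library.Set_Algebras\<close>.\<close>

definition poly_content ::
    "('g::{comm_monoid_add, cancel_semigroup_add} \<Rightarrow> 'a::idom set) \<Rightarrow> 'a poly \<Rightarrow> 'a set"
  where "poly_content R f = (\<Sum>i\<le>Polynomial.degree f. content_ideal R (Polynomial.coeff f i))"

definition Kr_h ::
    "('g::{comm_monoid_add, cancel_semigroup_add} \<Rightarrow> 'a::idom set)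
      \<Rightarrow> ('a fract set \<Rightarrow> 'a fract set) \<Rightarrow> 'a poly fract set"
  where "Kr_h R star = {Fract f g | f g. g \<noteq> 0 \<and>
    (\<exists>h. h \<noteq> 0 \<and>
      to_fract ` ideal_prod ring_of_type_algebra (poly_content R f) (poly_content R h)
        \<subseteq> star (to_fract ` ideal_prod ring_of_type_algebra (poly_content R g) (poly_content R h)))}"


section \<open>The prime spectrum and spectral spaces\<close>

definition Spec :: "('a, 'b) ring_scheme \<Rightarrow> 'a set set"
  where "Spec Q = {P. primeideal P Q}"

definition Spec_topology :: "('a, 'b) ring_scheme \<Rightarrow> 'a set topology"
  where "Spec_topology Q =
    topology (\<lambda>U. \<exists>S \<subseteq> carrier Q. U = Spec Q - {P \<in> Spec Q. S \<subseteq> P})"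

lemma istopology_Spec:
  "istopology (\<lambda>U. \<exists>S \<subseteq> carrier Q. U = Spec Q - {P \<in> Spec Q. S \<subseteq> P})"
  unfolding istopology_def
proof (intro conjI allI impI)
  fix U W
  assume "\<exists>S \<subseteq> carrier Q. U = Spec Q - {P \<in> Spec Q. S \<subseteq> P}"
    and "\<exists>S \<subseteq> carrier Q. W = Spec Q - {P \<in> Spec Q. S \<subseteq> P}"
  then obtain S T where S: "S \<subseteq> carrier Q" "U = Spec Q - {P \<in> Spec Q. S \<subseteq> P}"
    and T: "T \<subseteq> carrier Q" "W = Spec Q - {P \<in> Spec Q. T \<subseteq> P}"
    by blast
  define ST where "ST = {s \<otimes>\<^bsub>Q\<^esub> t | s t. s \<in> S \<and> t \<in> T} \<inter> carrier Q"
  have "ST \<subseteq> P \<longleftrightarrow> S \<subseteq> P \<or> T \<subseteq> P" if "P \<in> Spec Q" for P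
  proof -
    interpret primeideal P Q
      using that by (simp add: Spec_def)
    show ?thesis
    proof
      assume ST: "ST \<subseteq> P"
      show "S \<subseteq> P \<or> T \<subseteq> P"
      proof (rule ccontr)
        assume "\<not> (S \<subseteq> P \<or> T \<subseteq> P)"
        then obtain s t where "s \<in> S" "s \<notin> P" "t \<in> T" "t \<notin> P"
          by blast
        moreover from this have "s \<otimes>\<^bsub>Q\<^esub> t \<in> ST"
          using S(1) T(1) unfolding ST_def by blast
        ultimately show False
          using ST I_prime[of s t] S(1) T(1) by blast
      qed
    next
      assume "S \<subseteq> P \<or> T \<subseteq> P"
      then show "ST \<subseteq> P"
        unfolding ST_def using S(1) T(1) I_l_closed I_r_closed by blast
    qed
  qed
  then have "U \<inter> W = Spec Q - {P \<in> Spec Q. ST \<subseteq> P}"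
    unfolding S(2) T(2) by blast
  moreover have "ST \<subseteq> carrier Q"
    by (simp add: ST_def)
  ultimately show "\<exists>S \<subseteq> carrier Q. U \<inter> W = Spec Q - {P \<in> Spec Q. S \<subseteq> P}"
    by blast
next
  fix \<K>
  assume "\<forall>U\<in>\<K>. \<exists>S \<subseteq> carrier Q. U = Spec Q - {P \<in> Spec Q. S \<subseteq> P}"
  then obtain F where F: "\<And>U. U \<in> \<K> \<Longrightarrow> F U \<subseteq> carrier Q"
    "\<And>U. U \<in> \<K> \<Longrightarrow> U = Spec Q - {P \<in> Spec Q. F U \<subseteq> P}"
    by metis
  have "\<Union>\<K> = (\<Union>U\<in>\<K>. Spec Q - {P \<in> Spec Q. F U \<subseteq> P})"
    using F(2) by blast
  also have "\<dots> = Spec Q - {P \<in> Spec Q. (\<Union>U\<in>\<K>. F U) \<subseteq> P}"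
    by blast
  finally have "\<Union>\<K> = Spec Q - {P \<in> Spec Q. (\<Union>U\<in>\<K>. F U) \<subseteq> P}" .
  moreover have "(\<Union>U\<in>\<K>. F U) \<subseteq> carrier Q"
    using F(1) by blast
  ultimately show "\<exists>S \<subseteq> carrier Q. \<Union>\<K> = Spec Q - {P \<in> Spec Q. S \<subseteq> P}"
    by blast
qed

lemma openin_Spec_topology:
  "openin (Spec_topology Q) U \<longleftrightarrow> (\<exists>S \<subseteq> carrier Q. U = Spec Q - {P \<in> Spec Q. S \<subseteq> P})"
  by (simp add: Spec_topology_def topology_inverse'[OF istopology_Spec])

definition irreducible_in :: "'x topology \<Rightarrow> 'x set \<Rightarrow> bool"
  where "irreducible_in T C \<longleftrightarrow> C \<subseteq> topspace T \<and>
    (\<forall>A B. closedin T A \<and> closedin T B \<and> C \<subseteq> A \<union> B \<longrightarrow> C \<subseteq> A \<or> C \<subseteq> B)"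

definition spectral_space :: "'x topology \<Rightarrow> bool"
  where "spectral_space T \<longleftrightarrow>
    compact_space T \<and> t0_space T \<and>
    (\<forall>U V. openin T U \<and> compactin T U \<and> openin T V \<and> compactin T V
      \<longrightarrow> compactin T (U \<inter> V)) \<and>
    openin T = arbitrary union_of (\<lambda>U. openin T U \<and> compactin T U) \<and>
    (\<forall>C. closedin T C \<and> irreducible_in T C \<and> C \<noteq> {}
      \<longrightarrow> (\<exists>x \<in> C. T closure_of {x} = C))"

end

theory Submission
  imports Defs
begin

text \<open>
  Over a valuation overring \<open>W\<close> of \<open>R\<close> all the ideals \<open>A\<^sub>f W\<close> are principal, so the factor \<open>A\<^sub>h\<close> in the
  definition of the Kronecker function ring cancels, and \<open>f / g\<close> lies in that ring iff \<open>A\<^sub>f W \<subseteq> A\<^sub>g W\<close>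
  for all \<open>W\<close>. This inclusion depends only on the homogeneous elements of \<open>W\<close>. As the quotient
  group is torsion-free, hence orderable, Gauss's lemma shows that for a fixed \<open>W\<close> the inclusion
  defines a valuation ring of \<open>K(X)\<close>, and the Kronecker function ring is the intersection of these.

  By Chevalley's theorem, applied to the ideal generated by the homogeneous nonunits, every graded
  valuation overring has the same homogeneous elements as some valuation overring \<open>W\<close>; it is sent
  to the center of the extension of \<open>W\<close> to \<open>K(X)\<close>. The fraction \<open>a / b\<close> of homogeneous elements lies
  in the graded valuation overring iff \<open>b / (a + b X)\<close> is not in that center. Conversely the
  localization of the Kronecker function ring at a prime is a valuation ring in which \<open>f\<close> is associated
  to any of its homogeneous components of least value, and so it is the extension of its trace on \<open>K\<close>.

  For spectrality it suffices that the patch topology is compact. A family of conditions \<open>u \<in> W\<close> and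
  \<open>t \<notin> W\<close> that is finitely satisfiable is satisfiable: apply Chevalley's theorem to the ring of those
  \<open>x\<close> that finitely many of the conditions force into \<open>W\<close>, and to its ideal of those \<open>x\<close> that
  finitely many of the conditions force into the maximal ideal of \<open>W\<close>.
\<close>


section \<open>Valuation rings\<close>

text \<open>A graded valuation overring V need not be a valuation ring of K, whereas the b-operation
  refers to the valuation overrings of K. Values are therefore compared in a valuation overring W of
  K with the same homogeneous elements as V, and results return to V through quotients of
  homogeneous components, on which V and W agree. The fraction b / (a + b X) has the value v(b) -
  min(v(a), v(b)), because X keeps a and b apart as two components of the denominator, even when
  their degrees agree. This value is never negative, so the fraction lies in the Kronecker function
  ring, and it is zero exactly if v(b) is at most v(a), that is, if a / b lies in V. Value groups
  are not constructed; the divisibility preorder of W takes their place. Chevalley's theorem is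
  stated for an arbitrary proper ideal, so that no primality has to be checked for the two ideals to
  which it is applied.\<close>

locale valuation_ring =
  fixes W :: "'k::field set"
  assumes one_mem: "1 \<in> W"
    and add_mem: "x \<in> W \<Longrightarrow> y \<in> W \<Longrightarrow> x + y \<in> W"
    and mult_mem: "x \<in> W \<Longrightarrow> y \<in> W \<Longrightarrow> x * y \<in> W"
    and uminus_mem: "x \<in> W \<Longrightarrow> - x \<in> W"
    and total: "x \<in> W \<or> inverse x \<in> W"
begin

text \<open>\<open>vle x y\<close> says that the value of \<open>x\<close> is at most the value of \<open>y\<close>.\<close>

definition vle :: "'k \<Rightarrow> 'k \<Rightarrow> bool"
  where "vle x y \<longleftrightarrow> (\<exists>z\<in>W. y = z * x)"

text \<open>As \<open>inverse 0 = 0\<close>, totality at 0 already gives membership of 0.\<close>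

lemma zero_mem: "0 \<in> W"
  using total[of 0] by simp

lemma diff_mem: "x \<in> W \<Longrightarrow> y \<in> W \<Longrightarrow> x - y \<in> W"
  using add_mem[of x "- y"] uminus_mem[of y] by simp

lemma vle_refl [simp]: "vle x x"
  unfolding vle_def using one_mem by force

lemma vle_trans [trans]: "vle x y \<Longrightarrow> vle y z \<Longrightarrow> vle x z"
  unfolding vle_def using mult_mem by (metis mult.assoc)

lemma vle_0_right [simp]: "vle x 0"
  unfolding vle_def using zero_mem by force

lemma vle_0_left [simp]: "vle 0 x \<longleftrightarrow> x = 0"
  unfolding vle_def using zero_mem by force

lemma vle_1_left: "vle 1 x \<longleftrightarrow> x \<in> W"
  unfolding vle_def by simp

lemma vle_iff_divide: "x \<noteq> 0 \<Longrightarrow> vle x y \<longleftrightarrow> y / x \<in> W"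
  unfolding vle_def by (metis nonzero_eq_divide_eq)

lemma vle_1_right: "x \<noteq> 0 \<Longrightarrow> vle x 1 \<longleftrightarrow> inverse x \<in> W"
  by (simp add: vle_iff_divide inverse_eq_divide)

lemma vle_total: "vle x y \<or> vle y x"
proof (cases "x = 0 \<or> y = 0")
  case False
  then show ?thesis
    using total[of "x / y"] by (auto simp: vle_iff_divide)
qed auto

lemma vle_mult: "vle x y \<Longrightarrow> vle x' y' \<Longrightarrow> vle (x * x') (y * y')"
  unfolding vle_def using mult_mem by (metis mult.assoc mult.left_commute)

lemma vle_mult_mem: "a \<in> W \<Longrightarrow> vle x y \<Longrightarrow> vle x (a * y)"
  using vle_mult[of 1 a x y] by (simp add: vle_1_left)

lemma vle_mult_cancel: "c \<noteq> 0 \<Longrightarrow> vle (x * c) (y * c) \<longleftrightarrow> vle x y"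
  unfolding vle_def by (metis mult.assoc mult_right_cancel)

lemma vle_mult_cancel_left: "c \<noteq> 0 \<Longrightarrow> vle (c * x) (c * y) \<longleftrightarrow> vle x y"
  using vle_mult_cancel[of c x y] by (simp add: mult.commute)

lemma vle_add: "vle w x \<Longrightarrow> vle w y \<Longrightarrow> vle w (x + y)"
  unfolding vle_def using add_mem by (metis distrib_right)

lemma vle_uminus: "vle w x \<Longrightarrow> vle w (- x)"
  unfolding vle_def using uminus_mem by (metis mult_minus_left)

lemma vle_diff: "vle w x \<Longrightarrow> vle w y \<Longrightarrow> vle w (x - y)"
  using vle_add[of w x "- y"] vle_uminus by simp

lemma vle_sum: "(\<And>i. i \<in> S \<Longrightarrow> vle w (f i)) \<Longrightarrow> vle w (sum f S)"
  by (induction S rule: infinite_finite_induct) (auto intro: vle_add)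

text \<open>If s divided t + s over W, it would divide t; so t + s divides s, and with it t. A
  summand of strictly larger value thus cannot raise the value of a sum.\<close>

lemma vle_add_dominant:
  assumes "\<not> vle s t"
  shows "vle (t + s) t"
proof -
  have "\<not> vle s (t + s)"
    using assms vle_diff[of s "t + s" s] by auto
  then have "vle (t + s) s"
    using vle_total by blast
  then show ?thesis
    using vle_diff[of "t + s" "t + s" s] by simp
qed

text \<open>The summand of smaller value divides the sum, so the strict bound is inherited. For
  \<open>t = 1\<close> this is closure of the maximal ideal under addition.\<close>

lemma not_vle_add:
  assumes "\<not> vle x t" "\<not> vle y t"
  shows "\<not> vle (x + y) t"
proof
  assume *: "vle (x + y) t"
  from vle_total[of x y] show False
    using * assms vle_add[of x x y] vle_add[of y x y] vle_trans vle_refl by blast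
qed

lemma not_vle_sum:
  assumes "t \<noteq> 0" "\<And>i. i \<in> S \<Longrightarrow> \<not> vle (f i) t"
  shows "\<not> vle (sum f S) t"
  using assms by (induction S rule: infinite_finite_induct) (auto simp: not_vle_add)

lemma not_vle_1_iff: "\<not> vle x 1 \<longleftrightarrow> x = 0 \<or> inverse x \<notin> W"
  by (cases "x = 0") (auto simp: vle_1_right)

lemma finite_has_minimal:
  assumes "finite S" "S \<noteq> {}"
  obtains m where "m \<in> S" "\<And>x. x \<in> S \<Longrightarrow> vle m x"
proof -
  from assms have "\<exists>m\<in>S. \<forall>x\<in>S. vle m x"
  proof (induction S rule: finite_ne_induct)
    case (insert x F)
    then obtain m where m: "m \<in> F" "\<forall>x\<in>F. vle m x"
      by blast
    from vle_total[of m x] show ?case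
      using m vle_trans by (metis insert_iff vle_refl)
  qed simp
  then show ?thesis
    using that by blast
qed

end


section \<open>Existence of dominating valuation rings\<close>

text \<open>The ideal may be the whole ring, so that a pair can be enlarged by an element before it
  is known whether 1 stays outside the ideal.\<close>

locale subring_ideal =
  fixes A I :: "'k::field set"
  assumes one_mem: "1 \<in> A"
    and add_mem: "x \<in> A \<Longrightarrow> y \<in> A \<Longrightarrow> x + y \<in> A"
    and mult_mem: "x \<in> A \<Longrightarrow> y \<in> A \<Longrightarrow> x * y \<in> A"
    and uminus_mem: "x \<in> A \<Longrightarrow> - x \<in> A"
    and ideal_subset: "I \<subseteq> A"
    and zero_ideal: "0 \<in> I"
    and add_ideal: "x \<in> I \<Longrightarrow> y \<in> I \<Longrightarrow> x + y \<in> I"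
    and mult_ideal: "a \<in> A \<Longrightarrow> x \<in> I \<Longrightarrow> a * x \<in> I"
begin

lemma zero_mem: "0 \<in> A"
  using ideal_subset zero_ideal by blast

lemma diff_mem: "x \<in> A \<Longrightarrow> y \<in> A \<Longrightarrow> x - y \<in> A"
  using add_mem[of x "- y"] uminus_mem[of y] by simp

lemma sum_mem: "(\<And>i. i \<in> S \<Longrightarrow> f i \<in> A) \<Longrightarrow> sum f S \<in> A"
  by (induction S rule: infinite_finite_induct) (auto intro: add_mem zero_mem)

lemma sum_ideal: "(\<And>i. i \<in> S \<Longrightarrow> f i \<in> I) \<Longrightarrow> sum f S \<in> I"
  by (induction S rule: infinite_finite_induct) (auto intro: add_ideal zero_ideal)

end

section \<open>Adjoining an element to a ring with an ideal\<close>

definition adjoin :: "'k::field \<Rightarrow> 'k set \<Rightarrow> 'k set"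
  where "adjoin x A = {poly p x | p. \<forall>i. Polynomial.coeff p i \<in> A}"

lemma adjoinI: "(\<And>i. Polynomial.coeff p i \<in> A) \<Longrightarrow> poly p x \<in> adjoin x A"
  unfolding adjoin_def by blast

text \<open>For an ideal I of A the set \<open>adjoin x I\<close> is the extended ideal I A[x], so
  one formula serves both members of the pair.\<close>

lemma (in subring_ideal) subring_ideal_adjoin: "subring_ideal (adjoin x A) (adjoin x I)"
proof
  have "poly [:1:] x \<in> adjoin x A"
    by (rule adjoinI) (auto simp: coeff_pCons one_mem zero_mem split: nat.splits)
  then show "1 \<in> adjoin x A"
    by simp
  have "poly 0 x \<in> adjoin x I"
    by (rule adjoinI) (simp add: zero_ideal)
  then show "0 \<in> adjoin x I"
    by simp
  show "adjoin x I \<subseteq> adjoin x A"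
    unfolding adjoin_def using ideal_subset by blast
next
  fix y z
  assume "y \<in> adjoin x A" "z \<in> adjoin x A"
  then obtain p q where pq: "y = poly p x" "z = poly q x"
    "\<forall>i. Polynomial.coeff p i \<in> A" "\<forall>i. Polynomial.coeff q i \<in> A"
    unfolding adjoin_def by blast
  have "poly (p + q) x \<in> adjoin x A"
    by (rule adjoinI) (simp add: pq add_mem)
  then show "y + z \<in> adjoin x A"
    by (simp add: pq)
  have "poly (p * q) x \<in> adjoin x A"
    by (rule adjoinI) (simp add: pq coeff_mult mult_mem sum_mem)
  then show "y * z \<in> adjoin x A"
    by (simp add: pq)
next
  fix y
  assume "y \<in> adjoin x A"
  then obtain p where p: "y = poly p x" "\<forall>i. Polynomial.coeff p i \<in> A"
    unfolding adjoin_def by blast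
  have "poly (- p) x \<in> adjoin x A"
    by (rule adjoinI) (simp add: p uminus_mem)
  then show "- y \<in> adjoin x A"
    by (simp add: p)
next
  fix y z
  assume "y \<in> adjoin x I" "z \<in> adjoin x I"
  then obtain p q where pq: "y = poly p x" "z = poly q x"
    "\<forall>i. Polynomial.coeff p i \<in> I" "\<forall>i. Polynomial.coeff q i \<in> I"
    unfolding adjoin_def by blast
  have "poly (p + q) x \<in> adjoin x I"
    by (rule adjoinI) (simp add: pq add_ideal)
  then show "y + z \<in> adjoin x I"
    by (simp add: pq)
next
  fix y z
  assume "y \<in> adjoin x A" "z \<in> adjoin x I"
  then obtain p q where pq: "y = poly p x" "z = poly q x"
    "\<forall>i. Polynomial.coeff p i \<in> A" "\<forall>i. Polynomial.coeff q i \<in> I"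
    unfolding adjoin_def by blast
  have "poly (p * q) x \<in> adjoin x I"
    by (rule adjoinI) (simp add: pq coeff_mult mult_ideal sum_ideal)
  then show "y * z \<in> adjoin x I"
    by (simp add: pq)
qed

lemma (in subring_ideal) adjoin_superset:
  shows "A \<subseteq> adjoin x A" and "I \<subseteq> adjoin x I" and "x \<in> adjoin x A"
proof -
  have "poly [:a:] x \<in> adjoin x A" if "a \<in> A" for a
    by (rule adjoinI) (auto simp: coeff_pCons that zero_mem split: nat.splits)
  then show "A \<subseteq> adjoin x A"
    by auto
  have "poly [:a:] x \<in> adjoin x I" if "a \<in> I" for a
    by (rule adjoinI) (auto simp: coeff_pCons that zero_ideal split: nat.splits)
  then show "I \<subseteq> adjoin x I"
    by auto
  have "poly [:0, 1:] x \<in> adjoin x A"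
    by (rule adjoinI) (auto simp: coeff_pCons one_mem zero_mem split: nat.splits)
  then show "x \<in> adjoin x A"
    by simp
qed

text \<open>
  Two relations \<open>1 = c\<^sub>0 + \<dots> + c\<^sub>k x\<^sup>k\<close> and \<open>1 = d\<^sub>0 + \<dots> + d\<^sub>k x\<^sup>-\<^sup>k\<close> over an ideal
  can both be shortened, by eliminating the top power with the help of the other one.
\<close>

lemma (in subring_ideal) relation_shorten:
  assumes x: "x \<noteq> 0" and k: "k > 0"
    and c: "\<And>i. c i \<in> I" "(\<Sum>i\<le>k. c i * x ^ i) = 1"
    and d: "\<And>i. d i \<in> I" "(\<Sum>i\<le>k. d i * inverse x ^ i) = 1"
  obtains e where "\<And>i. e i \<in> I" "(\<Sum>i<k. e i * x ^ i) = 1"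
proof
  \<comment> \<open>The second relation times x^k reads (1 - d 0) x^k = sum of d (k - i) x^i over i
    < k. The first relation gives 1 = d 0 + (1 - d 0) (sum of c i x^i over i <= k); its top term c k
    (1 - d 0) x^k is replaced by means of the second. The \<open>e i\<close> are the resulting
    coefficients.\<close>
  define e where
    "e i = (if i = 0 then d 0 else 0) + (1 - d 0) * c i + c k * d (k - i)" for i
  show "e i \<in> I" for i
    unfolding e_def using c(1) d(1) ideal_subset one_mem zero_ideal
    by (intro add_ideal mult_ideal diff_mem) auto
  have "(\<Sum>i\<le>k. d i * x ^ (k - i)) = (\<Sum>i\<le>k. d i * inverse x ^ i) * x ^ k"
    unfolding sum_distrib_right
  proof (intro sum.cong refl)
    fix i
    assume "i \<in> {..k}"
    then have "x ^ k = x ^ i * x ^ (k - i)"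
      by (simp flip: power_add)
    then show "d i * x ^ (k - i) = d i * inverse x ^ i * x ^ k"
      using x by (simp add: field_simps)
  qed
  then have "(\<Sum>i\<le>k. d i * x ^ (k - i)) = x ^ k"
    by (simp add: d(2))
  also have "(\<Sum>i\<le>k. d i * x ^ (k - i)) = (\<Sum>i\<le>k. d (k - i) * x ^ i)"
    using sum.nat_diff_reindex[of "\<lambda>i. d (k - i) * x ^ i" "Suc k"]
    by (simp add: lessThan_Suc_atMost)
  also have "\<dots> = (\<Sum>i<k. d (k - i) * x ^ i) + d 0 * x ^ k"
    by (simp flip: lessThan_Suc_atMost)
  finally have D: "(\<Sum>i<k. d (k - i) * x ^ i) = (1 - d 0) * x ^ k"
    by (simp add: algebra_simps)
  have C: "(\<Sum>i<k. c i * x ^ i) = 1 - c k * x ^ k"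
    using c(2) by (simp add: algebra_simps flip: lessThan_Suc_atMost)
  have "(\<Sum>i<k. e i * x ^ i) = (\<Sum>i<k. (if i = 0 then d 0 else 0) * x ^ i)
      + (1 - d 0) * (\<Sum>i<k. c i * x ^ i) + c k * (\<Sum>i<k. d (k - i) * x ^ i)"
    unfolding e_def sum_distrib_left sum.distrib[symmetric]
    by (intro sum.cong refl) (simp add: algebra_simps)
  also have "(\<Sum>i<k. (if i = 0 then d 0 else 0) * x ^ i) = (\<Sum>i<k. if i = 0 then d 0 else 0)"
    by (intro sum.cong) auto
  also have "\<dots> = d 0"
    using k by simp
  finally show "(\<Sum>i<k. e i * x ^ i) = 1"
    unfolding C D by (simp add: algebra_simps)
qed

text \<open>Both relations are shortened together, each with the help of the other, until at length
  0 the relation reads \<open>c 0 = 1\<close> and puts 1 into the ideal.\<close>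

lemma (in subring_ideal) no_relations:
  assumes "1 \<notin> I" "x \<noteq> 0" "\<And>i. c i \<in> I" "(\<Sum>i\<le>k. c i * x ^ i) = 1"
    "\<And>i. d i \<in> I" "(\<Sum>i\<le>k. d i * inverse x ^ i) = 1"
  shows False
  using assms(3-)
proof (induction k arbitrary: c d)
  case 0
  then have "1 \<in> I"
    by (metis (no_types, lifting) atMost_0 finite.emptyI insert_absorb insert_not_empty mult.right_neutral
      power_0 sum.empty sum.insert add.right_neutral)
  then show ?case
    using assms(1) by blast
next
  case (Suc k)
  obtain c' where "\<And>i. c' i \<in> I" "(\<Sum>i<Suc k. c' i * x ^ i) = 1"
    using relation_shorten[of x "Suc k" c d] Suc.prems assms(2) by blast
  moreover obtain d' where "\<And>i. d' i \<in> I" "(\<Sum>i<Suc k. d' i * inverse x ^ i) = 1"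
    using relation_shorten[of "inverse x" "Suc k" d c] Suc.prems assms(2) by auto
  ultimately show ?case
    unfolding lessThan_Suc_atMost by (rule Suc.IH)
qed

lemma (in subring_ideal) one_notin_adjoin:
  assumes "1 \<notin> I" "x \<noteq> 0"
  shows "1 \<notin> adjoin x I \<or> 1 \<notin> adjoin (inverse x) I"
proof (rule ccontr)
  assume "\<not> ?thesis"
  then have "1 \<in> adjoin x I" "1 \<in> adjoin (inverse x) I"
    by auto
  then obtain p q where p: "1 = poly p x" "\<And>i. Polynomial.coeff p i \<in> I"
    and q: "1 = poly q (inverse x)" "\<And>i. Polynomial.coeff q i \<in> I"
    unfolding adjoin_def by blast
  \<comment> \<open>A common bound for both degrees: the shorter relation is padded with zero
    coefficients.\<close>
  define k where "k = max (Polynomial.degree p) (Polynomial.degree q)"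
  have "(\<Sum>i\<le>k. Polynomial.coeff p i * x ^ i) = poly p x"
    "(\<Sum>i\<le>k. Polynomial.coeff q i * inverse x ^ i) = poly q (inverse x)"
    unfolding poly_altdef k_def by (intro sum.mono_neutral_right; auto simp: coeff_eq_0)+
  then show False
    using no_relations[of x "Polynomial.coeff p" k "Polynomial.coeff q"] assms p q by simp
qed

text \<open>Chevalley's theorem. In a maximal pair (W, J) with 1 outside J, every x for which 1
  stays outside \<open>adjoin x J\<close> already lies in W, and \<open>one_notin_adjoin\<close>
  grants this for x or for its inverse. An element of I has positive value because its inverse in W
  would put 1 into J.\<close>

theorem (in subring_ideal) exists_dominating_valuation_ring:
  assumes "1 \<notin> I"
  obtains W where "valuation_ring W" "A \<subseteq> W" "\<And>x. x \<in> I \<Longrightarrow> \<not> valuation_ring.vle W x 1"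
proof -
  \<comment> \<open>A pair of sets is encoded as their disjoint sum: componentwise inclusion becomes
    plain inclusion, and Zorn's lemma for sets applies.\<close>
  define \<A> where "\<A> = {Sum_Type.Plus B J | B J. subring_ideal B J \<and> A \<subseteq> B \<and> I \<subseteq> J \<and> (1::'k) \<notin> J}"
  have "Sum_Type.Plus A I \<in> \<A>"
    unfolding \<A>_def using subring_ideal_axioms assms by blast
  have "\<exists>M\<in>\<A>. \<forall>Q\<in>\<A>. M \<subseteq> Q \<longrightarrow> Q = M"
  proof (rule subset_Zorn_nonempty)
    show "\<A> \<noteq> {}"
      using \<open>Sum_Type.Plus A I \<in> \<A>\<close> by blast
    fix \<C>
    assume ne: "\<C> \<noteq> {}" and chain: "subset.chain \<A> \<C>"
    define B where "B = {x. Inl x \<in> \<Union>\<C>}"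
    define J where "J = {x. Inr x \<in> \<Union>\<C>}"
    have eq: "\<Union>\<C> = Sum_Type.Plus B J"
    proof (rule Set.set_eqI)
      show "u \<in> \<Union>\<C> \<longleftrightarrow> u \<in> Sum_Type.Plus B J" for u
        by (cases u) (auto simp: B_def J_def)
    qed
    have C: "\<exists>B J. Q = Sum_Type.Plus B J \<and> subring_ideal B J \<and> A \<subseteq> B \<and> I \<subseteq> J \<and> (1::'k) \<notin> J"
      if "Q \<in> \<C>" for Q
      using that chain unfolding \<A>_def subset.chain_def by blast
    \<comment> \<open>Every axiom to be verified for the union concerns at most two elements, and
      these lie in a common member of the chain.\<close>
    have dir: "\<exists>B' J'. subring_ideal B' J' \<and> B' \<subseteq> B \<and> J' \<subseteq> J \<and>
        S \<subseteq> Inl ` B' \<union> Inr ` J'"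
      if S: "S \<subseteq> Inl ` B \<union> Inr ` J" "finite S" for S
    proof -
      have "S \<subseteq> \<Union>\<C>"
        using S(1) unfolding eq by blast
      then obtain Q where Q: "Q \<in> \<C>" "S \<subseteq> Q"
        using finite_subset_Union_chain[OF S(2) _ ne chain] by blast
      obtain B' J' where Q': "Q = Sum_Type.Plus B' J'" "subring_ideal B' J'"
        using C[OF Q(1)] by blast
      have "B' \<subseteq> B" "J' \<subseteq> J"
        unfolding B_def J_def using Q(1) Q'(1) by auto
      moreover have "S \<subseteq> Inl ` B' \<union> Inr ` J'"
        using Q(2) Q'(1) by blast
      ultimately show ?thesis
        using Q'(2) by blast
    qed
    obtain Q where Q: "Q \<in> \<C>"
      using ne by blast
    then have base: "A \<subseteq> B" "I \<subseteq> J"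
      unfolding B_def J_def using C[OF Q] Q by blast+
    have "subring_ideal B J"
    proof
      show "1 \<in> B" "0 \<in> J"
        using base one_mem zero_ideal by auto
      show "J \<subseteq> B"
      proof
        fix x
        assume "x \<in> J"
        then obtain B' J' where "subring_ideal B' J'" "B' \<subseteq> B" "x \<in> J'"
          using dir[of "{Inr x}"] by auto
        then show "x \<in> B"
          using subring_ideal.ideal_subset by blast
      qed
    next
      fix x y
      assume "x \<in> B" "y \<in> B"
      then obtain B' J' where "subring_ideal B' J'" "B' \<subseteq> B" "x \<in> B'" "y \<in> B'"
        using dir[of "{Inl x, Inl y}"] by auto
      then show "x + y \<in> B" "x * y \<in> B"
        using subring_ideal.add_mem[of B' J'] subring_ideal.mult_mem[of B' J'] by auto
    next
      fix x
      assume "x \<in> B"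
      then obtain B' J' where "subring_ideal B' J'" "B' \<subseteq> B" "x \<in> B'"
        using dir[of "{Inl x}"] by auto
      then show "- x \<in> B"
        using subring_ideal.uminus_mem[of B' J'] by auto
    next
      fix x y
      assume "x \<in> J" "y \<in> J"
      then obtain B' J' where "subring_ideal B' J'" "J' \<subseteq> J" "x \<in> J'" "y \<in> J'"
        using dir[of "{Inr x, Inr y}"] by auto
      then show "x + y \<in> J"
        using subring_ideal.add_ideal[of B' J'] by auto
    next
      fix x y
      assume "x \<in> B" "y \<in> J"
      then obtain B' J' where "subring_ideal B' J'" "J' \<subseteq> J" "x \<in> B'" "y \<in> J'"
        using dir[of "{Inl x, Inr y}"] by auto
      then show "x * y \<in> J"
        using subring_ideal.mult_ideal[of B' J'] by auto
    qed
    moreover have "1 \<notin> J"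
    proof
      assume "1 \<in> J"
      then obtain Q where "Q \<in> \<C>" "Inr 1 \<in> Q"
        unfolding J_def by blast
      then show False
        using C[of Q] by blast
    qed
    ultimately show "\<Union>\<C> \<in> \<A>"
      unfolding eq \<A>_def using base by blast
  qed
  then obtain M where M: "M \<in> \<A>" "\<And>Q. Q \<in> \<A> \<Longrightarrow> M \<subseteq> Q \<Longrightarrow> Q = M"
    by metis
  then obtain W J where WJ: "subring_ideal W J" "A \<subseteq> W" "I \<subseteq> J" "1 \<notin> J"
    and M_eq: "M = Sum_Type.Plus W J"
    unfolding \<A>_def by blast
  have max: "Sum_Type.Plus B J' = Sum_Type.Plus W J"
    if "subring_ideal B J'" "A \<subseteq> B" "I \<subseteq> J'" "1 \<notin> J'" "W \<subseteq> B" "J \<subseteq> J'" for B J'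
    using M(2)[of "Sum_Type.Plus B J'"] that unfolding \<A>_def M_eq by blast
  interpret W: subring_ideal W J
    by (rule WJ(1))
  have mem: "x \<in> W" if "1 \<notin> adjoin x J" for x
  proof -
    have "Sum_Type.Plus (adjoin x W) (adjoin x J) = Sum_Type.Plus W J"
      using W.adjoin_superset(1,2)[of x] WJ that
      by (intro max W.subring_ideal_adjoin) auto
    then show ?thesis
      using W.adjoin_superset(3)[of x] by blast
  qed
  have val: "valuation_ring W"
  proof
    show "x \<in> W \<or> inverse x \<in> W" for x
      using W.one_notin_adjoin[of x] mem[of x] mem[of "inverse x"] WJ(4) W.zero_mem
      by (cases "x = 0") auto
  qed (fact W.one_mem W.add_mem W.mult_mem W.uminus_mem)+
  moreover have "\<not> valuation_ring.vle W x 1" if "x \<in> I" for x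
    unfolding valuation_ring.not_vle_1_iff[OF val] using W.mult_ideal[of "inverse x" x] that WJ
    by (cases "x = 0") auto
  ultimately show ?thesis
    using that WJ(2) by blast
qed


section \<open>Orderings of torsion-free abelian groups\<close>

text \<open>The nonnegative elements of a translation-invariant partial order, in which x is below y
  iff y - x lies in P.\<close>

locale positive_cone =
  fixes P :: "'g::ab_group_add set"
  assumes zero: "0 \<in> P"
    and add: "x \<in> P \<Longrightarrow> y \<in> P \<Longrightarrow> x + y \<in> P"
    and pointed: "x \<in> P \<Longrightarrow> - x \<in> P \<Longrightarrow> x = 0"
begin

lemma nat_multiple: "x \<in> P \<Longrightarrow> (\<Sum>i<n. x) \<in> P" for n :: nat
  by (induction n) (auto simp: zero add)

end

lemma sum_const_add: "(\<Sum>i<m + n. x) = (\<Sum>i<m. x) + (\<Sum>i<n. x)"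
  for x :: "'g::comm_monoid_add" and m n :: nat
  by (induction n) (auto simp: ac_simps)

lemma sum_const_sum: "(\<Sum>i<m. \<Sum>j<n. x) = (\<Sum>i<m * n. x)"
  for x :: "'g::comm_monoid_add" and m n :: nat
  by (induction m) (auto simp: sum_const_add ac_simps)

text \<open>Torsion-free abelian groups are orderable: a maximal cone P is total. If neither x nor -
  x were in P, then adjoining either one would destroy pointedness, which puts a negative multiple
  of x and a positive one into P. A common multiple then lies in P together with its negative, so it
  is 0, and torsion-freeness gives x = 0.\<close>

theorem exists_total_cone:
  assumes torsion_free: "\<And>(n::nat) x::'g::ab_group_add. n \<ge> 1 \<Longrightarrow> (\<Sum>i<n. x) = 0 \<Longrightarrow> x = 0"
  obtains P :: "'g::ab_group_add set" where "positive_cone P" "\<And>x. x \<in> P \<or> - x \<in> P"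
proof -
  have "\<exists>M\<in>Collect positive_cone. \<forall>Q\<in>Collect positive_cone. M \<subseteq> Q \<longrightarrow> Q = (M :: 'g set)"
  proof (rule subset_Zorn_nonempty)
    have "positive_cone {0::'g}"
      by standard auto
    then show "Collect positive_cone \<noteq> ({} :: 'g set set)"
      by blast
    fix \<C> :: "'g set set"
    assume ne: "\<C> \<noteq> {}" and chain: "subset.chain (Collect positive_cone) \<C>"
    have pos: "positive_cone Q" if "Q \<in> \<C>" for Q
      using that chain unfolding subset.chain_def by blast
    have dir: "\<exists>Q\<in>\<C>. x \<in> Q \<and> y \<in> Q" if "x \<in> \<Union>\<C>" "y \<in> \<Union>\<C>" for x y
      using that chain unfolding subset.chain_def by blast
    have "positive_cone (\<Union>\<C>)"
    proof
      show "0 \<in> \<Union>\<C>"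
        using ne pos positive_cone.zero by blast
    next
      fix x y
      assume "x \<in> \<Union>\<C>" "y \<in> \<Union>\<C>"
      then show "x + y \<in> \<Union>\<C>"
        using dir[of x y] pos positive_cone.add by blast
    next
      fix x
      assume "x \<in> \<Union>\<C>" "- x \<in> \<Union>\<C>"
      then show "x = 0"
        using dir[of x "- x"] pos positive_cone.pointed by blast
    qed
    then show "\<Union>\<C> \<in> Collect positive_cone"
      by simp
  qed
  then obtain P :: "'g set" where P: "positive_cone P"
    and max: "\<And>Q. positive_cone Q \<Longrightarrow> P \<subseteq> Q \<Longrightarrow> Q = P"
    by blast
  interpret positive_cone P
    by (rule P)
  have multiple: "\<exists>n\<ge>1::nat. - (\<Sum>i<n. a) \<in> P" if "a \<notin> P" for a
  proof -
    \<comment> \<open>The submonoid generated by P and a. It properly contains the maximal cone P,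
      so it can only fail to be pointed.\<close>
    define Q where "Q = {p + (\<Sum>i<n. a) | p (n::nat). p \<in> P}"
    have QI: "p + (\<Sum>i<n. a) \<in> Q" if "p \<in> P" for p and n :: nat
      unfolding Q_def using that by blast
    have "P \<subseteq> Q" "a \<in> Q"
      using QI[of _ 0] QI[of 0 1] zero by auto
    then have "\<not> positive_cone Q"
      using max[of Q] that by blast
    moreover have "0 \<in> Q"
      using \<open>P \<subseteq> Q\<close> zero by blast
    moreover have "x + y \<in> Q" if xy: "x \<in> Q" "y \<in> Q" for x y
    proof -
      from xy obtain p q and m n :: nat where "x = p + (\<Sum>i<m. a)" "y = q + (\<Sum>i<n. a)"
        "p \<in> P" "q \<in> P"
        unfolding Q_def by blast
      then have "x + y = (p + q) + (\<Sum>i<m + n. a)"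
        by (simp only: sum_const_add ac_simps)
      then show ?thesis
        using QI[of "p + q" "m + n"] \<open>p \<in> P\<close> \<open>q \<in> P\<close> add by simp
    qed
    ultimately obtain x where x: "x \<in> Q" "- x \<in> Q" "x \<noteq> 0"
      unfolding positive_cone_def by blast
    then obtain p q and m n :: nat where pq: "x = p + (\<Sum>i<m. a)" "- x = q + (\<Sum>i<n. a)"
      "p \<in> P" "q \<in> P"
      unfolding Q_def by blast
    have "p + q + (\<Sum>i<m + n. a) = x + - x"
      unfolding pq(2) unfolding pq(1) sum_const_add by (simp only: ac_simps)
    then have sum: "- (\<Sum>i<m + n. a) = p + q"
      by (simp add: add_eq_0_iff2)
    have "m + n \<ge> 1"
    proof (rule ccontr)
      assume "\<not> m + n \<ge> 1"
      then have "m = 0" "n = 0"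
        by auto
      then have "x = p" "- x = q"
        using pq(1,2) by simp_all
      then show False
        using pointed[of x] pq x by simp
    qed
    then show ?thesis
      using sum add pq(3,4) by metis
  qed
  have "x \<in> P \<or> - x \<in> P" for x
  proof (rule ccontr)
    assume neg: "\<not> (x \<in> P \<or> - x \<in> P)"
    then obtain m n :: nat where mn: "m \<ge> 1" "n \<ge> 1" "- (\<Sum>i<m. x) \<in> P" "- (\<Sum>i<n. - x) \<in> P"
      using multiple[of x] multiple[of "- x"] by blast
    have "(\<Sum>i<n. - (\<Sum>i<m. x)) = - (\<Sum>i<n * m. x)"
      by (simp only: sum_negf sum_const_sum)
    moreover have "(\<Sum>i<m. - (\<Sum>i<n. - x)) = (\<Sum>i<n * m. x)"
      by (simp only: sum_negf minus_minus sum_const_sum mult.commute)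
    ultimately have "(\<Sum>i<n * m. x) \<in> P" "- (\<Sum>i<n * m. x) \<in> P"
      using nat_multiple mn(3,4) by metis+
    then have "(\<Sum>i<n * m. x) = 0"
      using pointed by blast
    moreover have "n * m \<ge> 1"
      using mn by simp
    ultimately show False
      using torsion_free[of "n * m" x] neg zero by simp
  qed
  then show ?thesis
    using that P by blast
qed

lemma (in positive_cone) finite_has_greatest:
  assumes total: "\<And>x. x \<in> P \<or> - x \<in> P" and S: "finite S" "S \<noteq> {}"
  obtains m where "m \<in> S" "\<And>x. x \<in> S \<Longrightarrow> m - x \<in> P"
proof -
  from S have "\<exists>m\<in>S. \<forall>x\<in>S. m - x \<in> P"
  proof (induction S rule: finite_ne_induct)
    case (singleton x)
    then show ?case
      by (simp add: zero)
  next
    case (insert x F)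
    then obtain m where m: "m \<in> F" "\<forall>x\<in>F. m - x \<in> P"
      by blast
    show ?case
    proof (cases "m - x \<in> P")
      case True
      then show ?thesis
        using m by blast
    next
      case False
      then have "x - m \<in> P"
        using total[of "m - x"] by simp
      then have "x - y \<in> P" if "y \<in> F" for y
        using add[of "x - m" "m - y"] m that by simp
      then show ?thesis
        using zero by auto
    qed
  qed
  then show ?thesis
    using that by blast
qed


section \<open>Type-based rings as HOL-Algebra structures\<close>

lemma ring_of_type_algebra_simps [simp]:
  "carrier ring_of_type_algebra = UNIV"
  "x \<otimes>\<^bsub>ring_of_type_algebra\<^esub> y = x * y"
  "x \<oplus>\<^bsub>ring_of_type_algebra\<^esub> y = x + y"
  "\<one>\<^bsub>ring_of_type_algebra\<^esub> = 1"
  "\<zero>\<^bsub>ring_of_type_algebra\<^esub> = 0"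
  by (simp_all add: ring_of_type_algebra_def)

lemma a_inv_ring_of_type_algebra [simp]:
  "\<ominus>\<^bsub>ring_of_type_algebra\<^esub> (x :: 'a::comm_ring_1) = - x"
proof -
  interpret ring "ring_of_type_algebra :: 'a ring"
    by (rule ring_from_type_algebra)
  show ?thesis
    by (rule minus_equality) simp_all
qed

lemma additive_subgroup_type_iff:
  "additive_subgroup H (ring_of_type_algebra :: 'a::comm_ring_1 ring) \<longleftrightarrow>
    0 \<in> H \<and> (\<forall>x\<in>H. \<forall>y\<in>H. x + y \<in> H) \<and> (\<forall>x\<in>H. - x \<in> H)"
proof -
  interpret ring "ring_of_type_algebra :: 'a ring"
    by (rule ring_from_type_algebra)
  have inv: "inv\<^bsub>add_monoid ring_of_type_algebra\<^esub> x = - x" for x :: 'a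
    using a_inv_ring_of_type_algebra[of x] unfolding a_inv_def .
  show ?thesis
    unfolding additive_subgroup_def subgroup_def inv by auto
qed

lemma subring_type_iff:
  "subring H (ring_of_type_algebra :: 'a::comm_ring_1 ring) \<longleftrightarrow>
    1 \<in> H \<and> (\<forall>x\<in>H. \<forall>y\<in>H. x + y \<in> H \<and> x * y \<in> H) \<and> (\<forall>x\<in>H. - x \<in> H)"
    (is "?L \<longleftrightarrow> ?R")
proof
  interpret ring "ring_of_type_algebra :: 'a ring"
    by (rule ring_from_type_algebra)
  show "?L \<Longrightarrow> ?R"
    using subringE[of H "ring_of_type_algebra :: 'a ring"] by auto
  show "?R \<Longrightarrow> ?L"
    by (rule subringI) auto
qed

text \<open>The two totality conditions differ only at 0, which lies in W as the image of 0 in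
  R.\<close>

lemma valuation_overring_iff:
  "valuation_overring W \<longleftrightarrow> valuation_ring W \<and> range to_fract \<subseteq> W"
proof
  assume W: "valuation_overring W"
  then have "0 \<in> W"
    unfolding valuation_overring_def by (metis rangeI subsetD to_fract_0)
  then show "valuation_ring W \<and> range to_fract \<subseteq> W"
    using W unfolding valuation_overring_def subring_type_iff valuation_ring_def by metis
next
  assume "valuation_ring W \<and> range to_fract \<subseteq> W"
  then show "valuation_overring W"
    unfolding valuation_overring_def subring_type_iff valuation_ring_def by metis
qed


section \<open>Homogeneous components\<close>

lemma family_sum_superset:
  assumes "finite F" "{i. c i \<noteq> 0} \<subseteq> F"
  shows "family_sum c = sum c F"
  unfolding family_sum_def by (rule sum.mono_neutral_left) (use assms in auto)

text \<open>For sums of homogeneous terms in which several terms may share a degree: collecting the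
  fibres of the degree map d turns such a sum into one indexed by degrees.\<close>

lemma family_sum_fibres:
  assumes "finite F"
  shows "family_sum (\<lambda>\<gamma>. \<Sum>p | p \<in> F \<and> d p = \<gamma>. x p) = sum x F"
proof -
  have "{\<gamma>. (\<Sum>p | p \<in> F \<and> d p = \<gamma>. x p) \<noteq> 0} \<subseteq> d ` F"
    by (force elim: contrapos_np intro!: sum.neutral)
  then have "family_sum (\<lambda>\<gamma>. \<Sum>p | p \<in> F \<and> d p = \<gamma>. x p) = (\<Sum>\<gamma>\<in>d ` F. \<Sum>p | p \<in> F \<and> d p = \<gamma>. x p)"
    using assms by (intro family_sum_superset) auto
  also have "\<dots> = sum x F"
    using assms sum.group[of F "d ` F" d x] by simp
  finally show ?thesis .
qed

lemma fibres_in_finsupp_families: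
  assumes "finite F" and M: "\<And>\<gamma>. 0 \<in> M \<gamma>" "\<And>\<gamma> x y. x \<in> M \<gamma> \<Longrightarrow> y \<in> M \<gamma> \<Longrightarrow> x + y \<in> M \<gamma>"
    and x: "\<And>p. p \<in> F \<Longrightarrow> x p \<in> M (d p)"
  shows "(\<lambda>\<gamma>. \<Sum>p | p \<in> F \<and> d p = \<gamma>. x p) \<in> finsupp_families M"
proof -
  have sum: "sum x S \<in> M \<gamma>" if "\<And>p. p \<in> S \<Longrightarrow> x p \<in> M \<gamma>" for S \<gamma>
    using that by (induction S rule: infinite_finite_induct) (auto simp: M)
  have "{\<gamma>. (\<Sum>p | p \<in> F \<and> d p = \<gamma>. x p) \<noteq> 0} \<subseteq> d ` F"
    by (force elim: contrapos_np intro!: sum.neutral)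
  then have "finite {\<gamma>. (\<Sum>p | p \<in> F \<and> d p = \<gamma>. x p) \<noteq> 0}"
    using assms(1) by (rule finite_subset[OF _ finite_imageI])
  moreover have "(\<Sum>p | p \<in> F \<and> d p = \<gamma>. x p) \<in> M \<gamma>" for \<gamma>
    by (rule sum) (use x in auto)
  ultimately show ?thesis
    unfolding finsupp_families_def by blast
qed

lemma family_sum_add:
  assumes "finite {i. c i \<noteq> 0}" "finite {i. d i \<noteq> 0}"
  shows "family_sum (\<lambda>i. c i + d i) = family_sum c + family_sum d"
proof -
  let ?F = "{i. c i \<noteq> 0} \<union> {i. d i \<noteq> 0}"
  have F: "finite ?F"
    using assms by simp
  have "family_sum (\<lambda>i. c i + d i) = (\<Sum>i\<in>?F. c i + d i)"
    by (rule family_sum_superset[OF F]) auto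
  also have "\<dots> = sum c ?F + sum d ?F"
    by (rule sum.distrib)
  also have "\<dots> = family_sum c + family_sum d"
    by (intro arg_cong2[where f = "(+)"] family_sum_superset[OF F, symmetric]) auto
  finally show ?thesis .
qed

lemma finsupp_families_add:
  assumes "c \<in> finsupp_families M" "d \<in> finsupp_families M"
    and "\<And>i x y. x \<in> M i \<Longrightarrow> y \<in> M i \<Longrightarrow> x + y \<in> M i"
  shows "(\<lambda>i. c i + d i) \<in> finsupp_families M"
proof -
  have "finite ({i. c i \<noteq> 0} \<union> {i. d i \<noteq> 0})"
    using assms(1,2) unfolding finsupp_families_def by simp
  then have "finite {i. c i + d i \<noteq> 0}"
    by (rule finite_subset[rotated]) auto
  then show ?thesis
    using assms unfolding finsupp_families_def by simp
qed

context graded_domain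
begin

lemma zero_component: "0 \<in> R \<alpha>"
  and add_component: "x \<in> R \<alpha> \<Longrightarrow> y \<in> R \<alpha> \<Longrightarrow> x + y \<in> R \<alpha>"
  and uminus_component: "x \<in> R \<alpha> \<Longrightarrow> - x \<in> R \<alpha>"
  using component_subgroup[of \<alpha>] unfolding additive_subgroup_type_iff by blast+

lemma homogeneous_component_family:
  shows "homogeneous_component R a \<in> finsupp_families R"
    and "family_sum (homogeneous_component R a) = a"
proof -
  have inj: "inj_on family_sum (finsupp_families R)" "family_sum ` finsupp_families R = UNIV"
    using direct_sum unfolding is_direct_sum_def bij_betw_def by auto
  show "homogeneous_component R a \<in> finsupp_families R"
    unfolding homogeneous_component_def using the_inv_into_into[OF inj(1), of a] inj(2) by auto
  show "family_sum (homogeneous_component R a) = a"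
    unfolding homogeneous_component_def using f_the_inv_into_f[OF inj(1), of a] inj(2) by auto
qed

lemma homogeneous_component_mem: "homogeneous_component R a \<alpha> \<in> R \<alpha>"
  and finite_homogeneous_component: "finite {\<alpha>. homogeneous_component R a \<alpha> \<noteq> 0}"
  using homogeneous_component_family(1)[of a] unfolding finsupp_families_def by auto

lemma homogeneous_component_unique:
  assumes "c \<in> finsupp_families R"
  shows "homogeneous_component R (family_sum c) = c"
  unfolding homogeneous_component_def
  using direct_sum assms unfolding is_direct_sum_def bij_betw_def by (simp add: the_inv_into_f_f)

text \<open>Collecting the terms of each degree yields a decomposition into homogeneous components,
  and there is only one.\<close>

lemma homogeneous_component_sum:
  assumes "finite F" "\<And>p. p \<in> F \<Longrightarrow> x p \<in> R (d p)"
  shows "homogeneous_component R (sum x F) \<gamma> = (\<Sum>p | p \<in> F \<and> d p = \<gamma>. x p)"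
proof -
  have "(\<lambda>\<gamma>. \<Sum>p | p \<in> F \<and> d p = \<gamma>. x p) \<in> finsupp_families R"
    using assms by (intro fibres_in_finsupp_families) (auto simp: zero_component add_component)
  from homogeneous_component_unique[OF this] show ?thesis
    unfolding family_sum_fibres[OF assms(1)] by metis
qed

lemma homogeneous_component_homogeneous:
  assumes "x \<in> R \<alpha>"
  shows "homogeneous_component R x \<gamma> = (if \<gamma> = \<alpha> then x else 0)"
proof -
  have "{p. p = () \<and> \<alpha> = \<gamma>} = (if \<gamma> = \<alpha> then {()} else {})"
    by auto
  then show ?thesis
    using homogeneous_component_sum[of "{()}" "\<lambda>_. x" "\<lambda>_. \<alpha>" \<gamma>] assms by simp
qed

lemma homogeneous_component_0 [simp]: "homogeneous_component R 0 \<gamma> = 0"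
  using homogeneous_component_homogeneous[OF zero_component, of \<gamma> \<gamma>] by simp

lemma homogeneous_component_add:
  "homogeneous_component R (a + b) \<gamma> = homogeneous_component R a \<gamma> + homogeneous_component R b \<gamma>"
proof -
  let ?c = "\<lambda>\<gamma>. homogeneous_component R a \<gamma> + homogeneous_component R b \<gamma>"
  have "?c \<in> finsupp_families R"
    by (intro finsupp_families_add homogeneous_component_family add_component)
  moreover have "family_sum ?c = a + b"
    by (simp add: family_sum_add finite_homogeneous_component homogeneous_component_family)
  ultimately show ?thesis
    using homogeneous_component_unique[of ?c] by metis
qed

lemma homogeneous_component_eq_0_iff: "(\<forall>\<gamma>. homogeneous_component R a \<gamma> = 0) \<longleftrightarrow> a = 0"
proof
  assume "\<forall>\<gamma>. homogeneous_component R a \<gamma> = 0"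
  then have "family_sum (homogeneous_component R a) = 0"
    by (simp add: family_sum_def)
  then show "a = 0"
    by (simp add: homogeneous_component_family)
qed auto

lemma sum_homogeneous_component:
  assumes "finite F" "{\<alpha>. homogeneous_component R a \<alpha> \<noteq> 0} \<subseteq> F"
  shows "sum (homogeneous_component R a) F = a"
  using family_sum_superset[OF assms] by (simp add: homogeneous_component_family)

text \<open>R[X] is graded by pairs of an X-degree and a degree in \<Gamma>. The components of this
  finer grading generate A_f, so contents of polynomials and Gauss's lemma concern a single
  grading.\<close>

definition poly_component :: "'a poly \<Rightarrow> nat \<times> 'g \<Rightarrow> 'a"
  where "poly_component f p = homogeneous_component R (Polynomial.coeff f (fst p)) (snd p)"

abbreviation support :: "'a poly \<Rightarrow> (nat \<times> 'g) set"
  where "support f \<equiv> {p. poly_component f p \<noteq> 0}"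

lemma poly_component_mem: "poly_component f p \<in> R (snd p)"
  unfolding poly_component_def by (rule homogeneous_component_mem)

lemma poly_component_0 [simp]: "poly_component 0 p = 0"
  by (simp add: poly_component_def)

lemma poly_component_add: "poly_component (f + g) p = poly_component f p + poly_component g p"
  by (simp add: poly_component_def homogeneous_component_add)

lemma poly_component_eq_0_iff: "(\<forall>p. poly_component f p = 0) \<longleftrightarrow> f = 0"
proof
  assume *: "\<forall>p. poly_component f p = 0"
  have "Polynomial.coeff f i = 0" for i
    using * homogeneous_component_eq_0_iff[of "Polynomial.coeff f i"]
    by (simp add: poly_component_def)
  then show "f = 0"
    by (simp add: poly_eq_iff)
qed auto

lemma finite_support: "finite (support f)"
proof -
  have "support f \<subseteq>
      (SIGMA i:{..Polynomial.degree f}. {\<alpha>. homogeneous_component R (Polynomial.coeff f i) \<alpha> \<noteq> 0})"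
    unfolding poly_component_def by (auto intro!: le_degree; metis homogeneous_component_0)
  then show ?thesis
    by (rule finite_subset) (auto simp: finite_homogeneous_component)
qed

lemma coeff_eq_sum_poly_component:
  "Polynomial.coeff f k = (\<Sum>p | p \<in> support f \<and> fst p = k. poly_component f p)"
proof -
  let ?F = "{\<alpha>. homogeneous_component R (Polynomial.coeff f k) \<alpha> \<noteq> 0}"
  have "(\<Sum>p | p \<in> support f \<and> fst p = k. poly_component f p) =
      (\<Sum>\<alpha>\<in>?F. homogeneous_component R (Polynomial.coeff f k) \<alpha>)"
    by (rule sum.reindex_bij_witness[of _ "\<lambda>\<alpha>. (k, \<alpha>)" snd])
      (auto simp: poly_component_def)
  also have "\<dots> = Polynomial.coeff f k"
    by (rule sum_homogeneous_component) (auto simp: finite_homogeneous_component)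
  finally show ?thesis ..
qed

lemma poly_eq_sum_monom:
  "f = (\<Sum>p\<in>support f. Polynomial.monom (poly_component f p) (fst p))"
proof (rule poly_eqI)
  fix k
  have "Polynomial.coeff (\<Sum>p\<in>support f. Polynomial.monom (poly_component f p) (fst p)) k =
      (\<Sum>p\<in>support f. if fst p = k then poly_component f p else 0)"
    by (simp add: Polynomial.coeff_sum)
  also have "\<dots> = Polynomial.coeff f k"
    unfolding coeff_eq_sum_poly_component[of f k]
    by (simp add: sum.If_cases finite_support Int_def)
  finally show "Polynomial.coeff f k =
      Polynomial.coeff (\<Sum>p\<in>support f. Polynomial.monom (poly_component f p) (fst p)) k" ..
qed

lemma poly_component_mult:
  "poly_component (f * g) r =
    (\<Sum>p | p \<in> support f \<times> support g \<and> fst p + snd p = r. poly_component f (fst p) * poly_component g (snd p))"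
proof -
  let ?S = "support f \<times> support g"
  let ?t = "\<lambda>p. poly_component f (fst p) * poly_component g (snd p)"
  have S: "finite ?S"
    by (simp add: finite_support)
  have "f * g = (\<Sum>p\<in>support f. Polynomial.monom (poly_component f p) (fst p)) *
      (\<Sum>q\<in>support g. Polynomial.monom (poly_component g q) (fst q))"
    using poly_eq_sum_monom[of f] poly_eq_sum_monom[of g] by simp
  also have "\<dots> = (\<Sum>p\<in>?S. Polynomial.monom (?t p) (fst (fst p) + fst (snd p)))"
    by (simp add: sum_product sum.cartesian_product mult_monom case_prod_beta)
  finally have "Polynomial.coeff (f * g) k =
      (\<Sum>p\<in>?S. if fst (fst p) + fst (snd p) = k then ?t p else 0)" for k
    by (simp add: Polynomial.coeff_sum)
  also have "\<dots> k = (\<Sum>p | p \<in> ?S \<and> fst (fst p) + fst (snd p) = k. ?t p)" for k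
    using S by (simp add: sum.If_cases Int_def)
  finally have coeff: "Polynomial.coeff (f * g) k =
      (\<Sum>p | p \<in> ?S \<and> fst (fst p) + fst (snd p) = k. ?t p)" for k .
  \<comment> \<open>Sorting by X-degree has produced the coefficient; its terms are now sorted by
    their degree in \<Gamma>. Both conditions together are the equality of pairs
    \<open>fst p + snd p = r\<close>.\<close>
  have "poly_component (f * g) r =
      (\<Sum>p | p \<in> {p \<in> ?S. fst (fst p) + fst (snd p) = fst r} \<and> snd (fst p) + snd (snd p) = snd r. ?t p)"
    unfolding poly_component_def[of "f * g"] coeff
    by (rule homogeneous_component_sum)
      (use S component_mult poly_component_mem in auto)
  also have "{p. p \<in> {p \<in> ?S. fst (fst p) + fst (snd p) = fst r} \<and> snd (fst p) + snd (snd p) = snd r} =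
      {p. p \<in> ?S \<and> fst p + snd p = r}"
    by (auto simp: prod_eq_iff)
  finally show ?thesis .
qed

end


section \<open>The quotient group\<close>

lemma of_monoid_0: "of_monoid 0 = 0"
  by transfer (simp add: diff_rel_def)

lemma of_monoid_add: "of_monoid (a + b) = of_monoid a + of_monoid b"
  by transfer (simp add: diff_rel_def)

lemma of_monoid_eq_iff [simp]: "of_monoid a = of_monoid b \<longleftrightarrow> a = b"
  by transfer (simp add: diff_rel_def)

lemma quotient_group_cases:
  obtains a b where "q = of_monoid a - of_monoid b"
proof -
  have "\<exists>a b. q = of_monoid a + - of_monoid b"
    by transfer (auto simp: diff_rel_def)
  then show ?thesis
    using that by auto
qed

lemma of_monoid_diff_eq_iff:
  "of_monoid a - of_monoid b = of_monoid c - of_monoid d \<longleftrightarrow> a + d = c + b"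
proof -
  have "of_monoid a - of_monoid b = of_monoid c - of_monoid d \<longleftrightarrow>
      of_monoid (a + d) = of_monoid (c + b)"
    unfolding of_monoid_add by (simp add: diff_eq_eq eq_diff_eq algebra_simps)
  then show ?thesis
    by simp
qed

lemma of_monoid_sum: "of_monoid (\<Sum>i<n. a) = (\<Sum>i<n. of_monoid a)" for n :: nat
  by (induction n) (auto simp: of_monoid_0 of_monoid_add)

text \<open>For q = a - b, n q = 0 says n a = n b, which already holds in \<Gamma> because \<Gamma>
  embeds into its quotient group.\<close>

lemma torsion_free_quotient_group:
  assumes torsionless:
      "\<And>(n::nat) (\<alpha>::'g::{comm_monoid_add, cancel_semigroup_add}) \<beta>.
        n \<ge> 1 \<Longrightarrow> (\<Sum>i<n. \<alpha>) = (\<Sum>i<n. \<beta>) \<Longrightarrow> \<alpha> = \<beta>"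
    and n: "n \<ge> (1::nat)" and sum: "(\<Sum>i<n. q :: 'g quotient_group) = 0"
  shows "q = 0"
proof -
  obtain a b where q: "q = of_monoid a - of_monoid b"
    by (rule quotient_group_cases)
  have "of_monoid (\<Sum>i<n. a) = of_monoid (\<Sum>i<n. b)"
    using sum by (simp add: q sum_subtractf of_monoid_sum del: of_monoid_eq_iff)
  then have "a = b"
    using torsionless[OF n, of a b] by simp
  then show ?thesis
    by (simp add: q)
qed


section \<open>Contents with respect to a valuation\<close>

context graded_domain
begin

text \<open>For a valuation ring V containing R this is the inclusion of A_f V in A_g V: as A_g V is
  generated by one component of g, a single multiple of a single component suffices each time. In
  this form the relation also makes sense for a graded valuation overring.\<close>

definition dominated :: "'a fract set \<Rightarrow> 'a poly \<Rightarrow> 'a poly \<Rightarrow> bool"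
  where "dominated V f g \<longleftrightarrow>
    (\<forall>p. \<exists>q. \<exists>z\<in>V. to_fract (poly_component f p) = z * to_fract (poly_component g q))"

definition kronecker_extension :: "'a fract set \<Rightarrow> 'a poly fract set"
  where "kronecker_extension V = {Fract f g | f g. g \<noteq> 0 \<and> dominated V f g}"

lemma poly_component_in_poly_content: "poly_component f p \<in> poly_content R f"
proof -
  interpret ring "ring_of_type_algebra :: 'a ring"
    by (rule ring_from_type_algebra)
  have "ideal (content_ideal R a) ring_of_type_algebra" for a
    unfolding content_ideal_def by (intro genideal_ideal) simp
  then have zero: "0 \<in> content_ideal R a" for a
    using additive_subgroup.zero_closed[OF ideal.axioms(1)] by fastforce
  have comp: "homogeneous_component R a \<alpha> \<in> content_ideal R a" for a \<alpha>
    using genideal_self[of "range (homogeneous_component R a)"] unfolding content_ideal_def by auto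
  define s where "s i = (if i = fst p then poly_component f p else 0)" for i
  have "s i \<in> content_ideal R (Polynomial.coeff f i)" for i
    unfolding s_def poly_component_def using zero comp by simp
  moreover have "poly_component f p = sum s {..Polynomial.degree f}"
    by (auto simp: s_def poly_component_def coeff_eq_0)
  ultimately show ?thesis
    unfolding poly_content_def by (subst set_sum_alt) auto
qed

end

locale graded_valuation = graded_domain R + valuation_ring W
  for R :: "'g::{comm_monoid_add, cancel_semigroup_add} \<Rightarrow> 'a::idom set"
    and W :: "'a fract set" +
  assumes to_fract_mem: "to_fract a \<in> W"
begin

text \<open>The element w generates the ideal A_f W. This is a relation because generators are
  unique only up to units of W; in this way a product of contents is a content without a new
  choice.\<close>

definition has_content :: "'a poly \<Rightarrow> 'a fract \<Rightarrow> bool"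
  where "has_content f w \<longleftrightarrow> (\<forall>p. vle w (to_fract (poly_component f p))) \<and>
    (\<exists>p. vle (to_fract (poly_component f p)) w)"

lemma dominated_iff_vle:
  "dominated W f g \<longleftrightarrow> (\<forall>p. \<exists>q. vle (to_fract (poly_component g q)) (to_fract (poly_component f p)))"
  unfolding dominated_def vle_def ..

text \<open>A generator is found among the components of f themselves. This is what later makes f an
  associate of a constant polynomial.\<close>

lemma exists_content:
  obtains p where "has_content f (to_fract (poly_component f p))"
proof (cases "f = 0")
  case True
  then show ?thesis
    using that by (simp add: has_content_def)
next
  case False
  then have ne: "support f \<noteq> {}"
    using poly_component_eq_0_iff[of f] by auto
  obtain m where m: "m \<in> (\<lambda>p. to_fract (poly_component f p)) ` support f"
    "\<And>x. x \<in> (\<lambda>p. to_fract (poly_component f p)) ` support f \<Longrightarrow> vle m x"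
    using finite_has_minimal[of "(\<lambda>p. to_fract (poly_component f p)) ` support f"] ne finite_support
    by blast
  then obtain p where p: "m = to_fract (poly_component f p)"
    by blast
  have "vle m (to_fract (poly_component f q))" for q
    using m(2) by (cases "poly_component f q = 0") auto
  then have "has_content f m"
    unfolding has_content_def p by (meson vle_refl)
  then show ?thesis
    using that p by blast
qed

lemma content_eq_0_iff:
  assumes "has_content f w"
  shows "w = 0 \<longleftrightarrow> f = 0"
  using assms poly_component_eq_0_iff[of f] unfolding has_content_def
  by (metis to_fract_eq_0_iff vle_0_left)

lemma dominated_iff_content:
  assumes "has_content f w" "has_content g v"
  shows "dominated W f g \<longleftrightarrow> vle v w"
  unfolding dominated_iff_vle using assms unfolding has_content_def by (meson vle_trans)

lemma vle_content_add:
  assumes "has_content f u" "has_content g v" "has_content (f + g) w" "vle x u" "vle x v"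
  shows "vle x w"
proof -
  have "vle x (to_fract (poly_component (f + g) p))" for p
    using assms unfolding has_content_def poly_component_add to_fract_add
    by (meson vle_add vle_trans)
  then show ?thesis
    using assms(3) vle_trans unfolding has_content_def by blast
qed

lemma content_uminus:
  assumes "has_content f w"
  shows "has_content (- f) w"
proof -
  have eq: "poly_component (- f) p = - poly_component f p" for p
    using poly_component_add[of f "- f" p] by (simp add: add_eq_0_iff)
  have "vle (- x) y \<longleftrightarrow> vle x y" for x y
    using vle_mult[of "- 1" 1 x y] vle_mult[of "- 1" 1 "- x" y] vle_uminus[of 1 1]
      vle_uminus[of "- 1" "- 1"] by auto
  moreover have "vle y (- x) \<longleftrightarrow> vle y x" for x y
    using vle_uminus[of y x] vle_uminus[of y "- x"] by auto
  ultimately show ?thesis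
    using assms unfolding has_content_def eq by simp
qed

text \<open>Since R is contained in W, the elements of R whose value is at least that of w form an
  ideal; it contains the generators of every \<open>content_ideal\<close> in the sum.\<close>

lemma vle_poly_content:
  assumes "has_content f w" "x \<in> poly_content R f"
  shows "vle w (to_fract x)"
proof -
  interpret ring "ring_of_type_algebra :: 'a ring"
    by (rule ring_from_type_algebra)
  let ?I = "{x. vle w (to_fract x)}"
  have "additive_subgroup ?I ring_of_type_algebra"
    unfolding additive_subgroup_type_iff by (auto intro: vle_add vle_uminus)
  moreover have "vle w (to_fract x * to_fract a)" "vle w (to_fract a * to_fract x)"
    if "vle w (to_fract a)" for a x
    using vle_mult_mem[OF to_fract_mem[of x] that] by (simp_all add: mult.commute)
  ultimately have "ideal ?I ring_of_type_algebra"
    by (intro ideal.intro ideal_axioms.intro ring_from_type_algebra) auto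
  moreover have "homogeneous_component R (Polynomial.coeff f i) \<alpha> \<in> ?I" for i \<alpha>
    using assms(1) unfolding has_content_def poly_component_def by (metis fst_conv mem_Collect_eq snd_conv)
  ultimately have "content_ideal R (Polynomial.coeff f i) \<subseteq> ?I" for i
    unfolding content_ideal_def by (intro genideal_minimal) auto
  moreover obtain s where "x = sum s {..Polynomial.degree f}"
    "\<And>i. i \<le> Polynomial.degree f \<Longrightarrow> s i \<in> content_ideal R (Polynomial.coeff f i)"
    using assms(2) unfolding poly_content_def by (subst (asm) set_sum_alt) auto
  moreover have "to_fract (sum s S) = (\<Sum>i\<in>S. to_fract (s i))" for S and s :: "nat \<Rightarrow> 'a"
    by (induction S rule: infinite_finite_induct) auto
  ultimately show ?thesis
    by (auto intro!: vle_sum)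
qed

lemma vle_ideal_prod:
  assumes "has_content f w" "has_content h v"
    and "x \<in> ideal_prod ring_of_type_algebra (poly_content R f) (poly_content R h)"
  shows "vle (w * v) (to_fract x)"
  using assms(3)
proof induction
  case (prod i j)
  then show ?case
    using vle_mult vle_poly_content assms(1,2) by simp
next
  case (sum s1 s2)
  then show ?case
    using vle_add by simp
qed

text \<open>
  Over a valuation ring the products \<open>A\<^sub>f A\<^sub>h W\<close> are principal, so the factor \<open>A\<^sub>h\<close> in the definition
  of the Kronecker function ring cancels.
\<close>

lemma ideal_prod_subset_iff_dominated:
  assumes "h \<noteq> 0"
  shows "to_fract ` ideal_prod ring_of_type_algebra (poly_content R f) (poly_content R h) \<subseteq>
      ideal_prod ring_of_type_algebra
        (to_fract ` ideal_prod ring_of_type_algebra (poly_content R g) (poly_content R h)) W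
    \<longleftrightarrow> dominated W f g" (is "to_fract ` ?F \<subseteq> ?G \<longleftrightarrow> _")
proof -
  obtain pf pg ph where p:
    "has_content f (to_fract (poly_component f pf))" (is "has_content f ?u")
    "has_content g (to_fract (poly_component g pg))" (is "has_content g ?v")
    "has_content h (to_fract (poly_component h ph))" (is "has_content h ?w")
    using exists_content by metis
  have "?w \<noteq> 0"
    using content_eq_0_iff[OF p(3)] assms by simp
  then have iff: "dominated W f g \<longleftrightarrow> vle (?v * ?w) (?u * ?w)"
    by (simp add: dominated_iff_content[OF p(1,2)] vle_mult_cancel)
  have vle_G: "vle (?v * ?w) y" if "y \<in> ?G" for y
    using that
  proof induction
    case (prod i j)
    then show ?case
      using vle_ideal_prod[OF p(2,3)] vle_mult_mem[of j] by (auto simp: mult.commute)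
  next
    case (sum s1 s2)
    then show ?case
      using vle_add by simp
  qed
  show ?thesis
    unfolding iff
  proof
    assume "to_fract ` ?F \<subseteq> ?G"
    \<comment> \<open>The inclusion is tested only at \<open>?u * ?w\<close>, which generates the
      left-hand side over W.\<close>
    moreover have "poly_component f pf * poly_component h ph \<in> ?F"
      using ideal_prod.prod[OF poly_component_in_poly_content poly_component_in_poly_content,
          of "ring_of_type_algebra"] by simp
    ultimately show "vle (?v * ?w) (?u * ?w)"
      using vle_G by fastforce
  next
    assume *: "vle (?v * ?w) (?u * ?w)"
    show "to_fract ` ?F \<subseteq> ?G"
    proof
      fix y
      assume "y \<in> to_fract ` ?F"
      then have "vle (?v * ?w) y"
        using * vle_ideal_prod[OF p(1,3)] vle_trans by blast
      then obtain z where z: "z \<in> W" "y = (?v * ?w) * z"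
        unfolding vle_def by (auto simp: mult.commute)
      have "poly_component g pg * poly_component h ph \<in>
          ideal_prod ring_of_type_algebra (poly_content R g) (poly_content R h)"
        using ideal_prod.prod[OF poly_component_in_poly_content poly_component_in_poly_content,
            of "ring_of_type_algebra"] by simp
      then have "?v * ?w \<in> to_fract ` ideal_prod ring_of_type_algebra (poly_content R g) (poly_content R h)"
        by (metis imageI to_fract_mult)
      then show "y \<in> ?G"
        using ideal_prod.prod[OF _ z(1), of _ _ "ring_of_type_algebra"] z(2) by simp
    qed
  qed
qed

end


section \<open>Gauss's lemma and the Kronecker extension of a valuation ring\<close>

locale torsionless_graded_domain = graded_domain R
  for R :: "'g::{comm_monoid_add, cancel_semigroup_add} \<Rightarrow> 'a::idom set" +
  assumes torsionless:
    "\<And>(n::nat) (\<alpha>::'g) \<beta>. n \<ge> 1 \<Longrightarrow> (\<Sum>i<n. \<alpha>) = (\<Sum>i<n. \<beta>) \<Longrightarrow> \<alpha> = \<beta>"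
begin

text \<open>The X-degree is taken in the integers so that degrees lie in a group, where a total cone
  exists.\<close>

definition degree_pair :: "nat \<times> 'g \<Rightarrow> int \<times> 'g quotient_group"
  where "degree_pair p = (int (fst p), of_monoid (snd p))"

lemma degree_pair_add: "degree_pair (p + q) = degree_pair p + degree_pair q"
  by (simp add: degree_pair_def of_monoid_add plus_prod_def)

lemma degree_pair_eq_iff: "degree_pair p = degree_pair q \<longleftrightarrow> p = q"
  by (auto simp: degree_pair_def prod_eq_iff)

lemma exists_degree_cone:
  obtains P :: "(int \<times> 'g quotient_group) set"
  where "positive_cone P" "\<And>x. x \<in> P \<or> - x \<in> P"
proof -
  have torsion_free: "x = 0" if n: "n \<ge> 1" and sum: "(\<Sum>i<n. x) = 0"
    for n :: nat and x :: "int \<times> 'g quotient_group"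
  proof -
    have "(\<Sum>i<n. fst x) = 0" "(\<Sum>i<n. snd x) = 0"
      using arg_cong[OF sum, of fst] arg_cong[OF sum, of snd]
      by (simp_all only: fst_sum snd_sum fst_zero snd_zero)
    then show ?thesis
      using n torsion_free_quotient_group[OF torsionless n, where q = "snd x"]
      by (simp add: prod_eq_iff)
  qed
  show ?thesis
    by (rule exists_total_cone) (rule torsion_free, assumption+, rule that)
qed

end

locale torsionless_graded_valuation = torsionless_graded_domain R + graded_valuation R W
  for R :: "'g::{comm_monoid_add, cancel_semigroup_add} \<Rightarrow> 'a::idom set"
    and W :: "'a fract set"
begin

text \<open>
  Order the degrees totally. The product of the terms of largest degree among those of minimal
  value in \<open>f\<close> and in \<open>g\<close> is the only term of minimal value in its degree.
\<close>

theorem content_mult: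
  assumes fw: "has_content f w" and gv: "has_content g v"
  shows "has_content (f * g) (w * v)"
proof (cases "f = 0 \<or> g = 0")
  case True
  then have zero: "w * v = 0" "f * g = 0"
    using content_eq_0_iff[OF fw] content_eq_0_iff[OF gv] by auto
  show ?thesis
    unfolding zero by (simp add: has_content_def)
next
  case False
  then have w0: "w \<noteq> 0" and v0: "v \<noteq> 0"
    using content_eq_0_iff[OF fw] content_eq_0_iff[OF gv] by auto
  let ?f = "\<lambda>p. to_fract (poly_component f p)" and ?g = "\<lambda>p. to_fract (poly_component g p)"
  have to_fract_sum: "to_fract (sum s S) = (\<Sum>i\<in>S. to_fract (s i))"
    for S and s :: "(nat \<times> 'g) \<times> (nat \<times> 'g) \<Rightarrow> 'a"
    by (induction S rule: infinite_finite_induct) auto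
  let ?I = "\<lambda>r. {p. p \<in> support f \<times> support g \<and> fst p + snd p = r}"
  have prod: "to_fract (poly_component (f * g) r) = (\<Sum>p\<in>?I r. ?f (fst p) * ?g (snd p))" for r
    unfolding poly_component_mult to_fract_sum to_fract_mult ..
  have vle_f: "vle w (?f p)" and vle_g: "vle v (?g p)" for p
    using fw gv unfolding has_content_def by blast+
  have lower: "vle (w * v) (to_fract (poly_component (f * g) r))" for r
    unfolding prod by (intro vle_sum vle_mult vle_f vle_g)
  obtain P :: "(int \<times> 'g quotient_group) set"
    where P: "positive_cone P" and total_P: "\<And>x. x \<in> P \<or> - x \<in> P"
    using exists_degree_cone by blast
  interpret P: positive_cone P
    by (rule P)
  have greatest: "\<exists>p. vle (to_fract (poly_component h p)) u \<and>
      (\<forall>q. vle (to_fract (poly_component h q)) u \<longrightarrow> degree_pair p - degree_pair q \<in> P)"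
    if h: "has_content h u" "u \<noteq> 0" for h u
  proof -
    let ?S = "{p. vle (to_fract (poly_component h p)) u}"
    have "?S \<subseteq> support h"
      using h(2) by auto
    then have "finite ?S"
      using finite_support finite_subset by blast
    moreover have "?S \<noteq> {}"
      using h(1) unfolding has_content_def by blast
    ultimately obtain m where "m \<in> degree_pair ` ?S" "\<And>x. x \<in> degree_pair ` ?S \<Longrightarrow> m - x \<in> P"
      using P.finite_has_greatest[of "degree_pair ` ?S"] total_P by blast
    then show ?thesis
      by blast
  qed
  obtain p where p: "vle (?f p) w" "\<And>p'. vle (?f p') w \<Longrightarrow> degree_pair p - degree_pair p' \<in> P"
    using greatest[OF fw w0] by blast
  obtain q where q: "vle (?g q) v" "\<And>q'. vle (?g q') v \<Longrightarrow> degree_pair q - degree_pair q' \<in> P"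
    using greatest[OF gv v0] by blast
  have unique: "p' = p \<and> q' = q" if "p' + q' = p + q" "vle (?f p') w" "vle (?g q') v" for p' q'
  proof -
    have "degree_pair p' + degree_pair q' = degree_pair p + degree_pair q"
      using that(1) by (metis degree_pair_add)
    then have "degree_pair q - degree_pair q' = - (degree_pair p - degree_pair p')"
      by (simp add: algebra_simps)
    \<comment> \<open>Both differences lie in P and each is the negative of the other, so
      pointedness makes them vanish.\<close>
    then have "degree_pair p - degree_pair p' = 0"
      using P.pointed[of "degree_pair p - degree_pair p'"] p(2) q(2) that by metis
    then show ?thesis
      using \<open>degree_pair q - degree_pair q' = _\<close> by (simp add: degree_pair_eq_iff)
  qed
  let ?t = "?f p * ?g q"
  let ?s = "\<Sum>p'\<in>?I (p + q) - {(p, q)}. ?f (fst p') * ?g (snd p')"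
  have mem: "(p, q) \<in> ?I (p + q)"
    using p(1) q(1) w0 v0 by auto
  have fin: "finite (?I (p + q))"
    by (rule finite_subset[of _ "support f \<times> support g"]) (auto simp: finite_support)
  have split: "to_fract (poly_component (f * g) (p + q)) = ?t + ?s"
    unfolding prod
    using sum.remove[OF fin mem, of "\<lambda>p. ?f (fst p) * ?g (snd p)"] by (simp only: fst_conv snd_conv)
  \<comment> \<open>Exchanging one factor for the content \<open>v\<close> or \<open>w\<close> can
    only lower the value. Hence a product of minimal value has both factors of minimal value, and
    \<open>unique\<close> leaves only the pair (p, q).\<close>
  have strict: "\<not> vle (?f p' * ?g q') (w * v)" if "p' + q' = p + q" "(p', q') \<noteq> (p, q)" for p' q'
  proof
    assume *: "vle (?f p' * ?g q') (w * v)"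
    have "vle (?f p' * v) (w * v)"
      using vle_mult[OF vle_refl vle_g] * vle_trans by blast
    moreover have "vle (w * ?g q') (w * v)"
      using vle_mult[OF vle_f vle_refl] * vle_trans by blast
    ultimately have "vle (?f p') w" "vle (?g q') v"
      using w0 v0 by (simp_all add: vle_mult_cancel vle_mult_cancel_left)
    then show False
      using unique[OF that(1)] that(2) by blast
  qed
  \<comment> \<open>The remaining terms of this degree have strictly larger value than
    \<open>?t\<close>, so by \<open>vle_add_dominant\<close> they cannot cancel it.\<close>
  have "\<not> vle ?s (w * v)"
  proof (rule not_vle_sum)
    fix x
    assume "x \<in> ?I (p + q) - {(p, q)}"
    then have "fst x + snd x = p + q" "(fst x, snd x) \<noteq> (p, q)"
      by simp_all
    then show "\<not> vle (?f (fst x) * ?g (snd x)) (w * v)"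
      by (rule strict)
  qed (use w0 v0 in simp)
  then have "\<not> vle ?s ?t"
    using vle_mult[OF p(1) q(1)] vle_trans by blast
  then have "vle (to_fract (poly_component (f * g) (p + q))) (w * v)"
    unfolding split using vle_add_dominant vle_mult[OF p(1) q(1)] vle_trans by blast
  then show ?thesis
    unfolding has_content_def using lower by blast
qed

text \<open>Independence of the representation is Gauss's lemma: if f g' = f' g, then u v' and u' v
  are contents of the same polynomial, so u / v and u' / v' have the same value.\<close>

lemma Fract_in_kronecker_extension_iff:
  assumes "g \<noteq> 0"
  shows "Fract f g \<in> kronecker_extension W \<longleftrightarrow> dominated W f g"
proof
  assume "Fract f g \<in> kronecker_extension W"
  then obtain f' g' where fg: "Fract f g = Fract f' g'" "g' \<noteq> 0" "dominated W f' g'"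
    unfolding kronecker_extension_def by blast
  have eq: "f * g' = f' * g"
    using fg(1,2) assms by (simp add: eq_fract)
  obtain u v u' v' where c: "has_content f u" "has_content g v" "has_content f' u'" "has_content g' v'"
    using exists_content by metis
  have "vle v' u'"
    using fg(3) dominated_iff_content[OF c(3,4)] by simp
  obtain x where "has_content (f * g') x"
    using exists_content by blast
  have "v' \<noteq> 0" "v \<noteq> 0"
    using content_eq_0_iff c fg(2) assms by metis+
  have "vle (v * v') (v * u')"
    using \<open>vle v' u'\<close> by (simp add: vle_mult)
  moreover have "vle (u' * v) (u * v')"
    using content_mult[OF c(3,2)] content_mult[OF c(1,4)] unfolding eq has_content_def
    by (meson vle_trans)
  ultimately have "vle (v * v') (u * v')"
    using vle_trans by (simp add: mult.commute)
  then show "dominated W f g"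
    using \<open>v' \<noteq> 0\<close> by (simp add: dominated_iff_content[OF c(1,2)] vle_mult_cancel)
next
  assume "dominated W f g"
  then show "Fract f g \<in> kronecker_extension W"
    unfolding kronecker_extension_def using assms by blast
qed

text \<open>This is the Gauss extension of W, with f / g valued as the quotient of the contents.
  Gauss's lemma gives closure under products and common denominators for sums; totality is that of
  \<open>vle\<close> on contents.\<close>

lemma valuation_ring_kronecker_extension: "valuation_ring (kronecker_extension W)"
proof
  have "dominated W 1 1"
    unfolding dominated_iff_vle by (meson vle_refl)
  then show "1 \<in> kronecker_extension W"
    using Fract_in_kronecker_extension_iff[of 1 1] by (simp add: One_fract_def)
next
  fix x y
  assume "x \<in> kronecker_extension W" "y \<in> kronecker_extension W"
  then obtain f g f' g' where x: "x = Fract f g" "g \<noteq> 0" "dominated W f g"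
    and y: "y = Fract f' g'" "g' \<noteq> 0" "dominated W f' g'"
    unfolding kronecker_extension_def by blast
  obtain u v u' v' z where c: "has_content f u" "has_content g v" "has_content f' u'" "has_content g' v'"
    "has_content (f * g' + f' * g) z"
    using exists_content by metis
  have vle: "vle v u" "vle v' u'"
    using x(3) y(3) c dominated_iff_content by metis+
  have "vle (v * v') z"
    using vle_content_add[OF content_mult[OF c(1,4)] content_mult[OF c(3,2)] c(5)] vle vle_mult vle_refl
    by (metis mult.commute)
  then have "dominated W (f * g' + f' * g) (g * g')"
    using dominated_iff_content[OF c(5) content_mult[OF c(2,4)]] by simp
  then show "x + y \<in> kronecker_extension W"
    using x y by (simp add: Fract_in_kronecker_extension_iff)
  have "dominated W (f * f') (g * g')"
    using dominated_iff_content[OF content_mult[OF c(1,3)] content_mult[OF c(2,4)]] vle vle_mult by simp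
  then show "x * y \<in> kronecker_extension W"
    using x y by (simp add: Fract_in_kronecker_extension_iff)
next
  fix x
  assume "x \<in> kronecker_extension W"
  then obtain f g where x: "x = Fract f g" "g \<noteq> 0" "dominated W f g"
    unfolding kronecker_extension_def by blast
  obtain u v where "has_content f u" "has_content g v"
    using exists_content by metis
  then have "dominated W (- f) g"
    using x(3) dominated_iff_content content_uminus by metis
  then show "- x \<in> kronecker_extension W"
    using x by (simp add: Fract_in_kronecker_extension_iff)
next
  fix x :: "'a poly fract"
  obtain f g where x: "x = Fract f g" "g \<noteq> 0"
    by (cases x)
  obtain u v where c: "has_content f u" "has_content g v"
    using exists_content by metis
  show "x \<in> kronecker_extension W \<or> inverse x \<in> kronecker_extension W"
  proof (cases "f = 0")
    case True
    then have "vle v u"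
      using content_eq_0_iff[OF c(1)] by simp
    then show ?thesis
      using x dominated_iff_content[OF c] by (simp add: Fract_in_kronecker_extension_iff)
  next
    case False
    then show ?thesis
      using x vle_total[of u v] dominated_iff_content[OF c] dominated_iff_content[OF c(2,1)]
      by (auto simp: Fract_in_kronecker_extension_iff)
  qed
qed

end

context torsionless_graded_domain
begin

lemma valuation_overring_interpretation:
  "valuation_overring W \<Longrightarrow> torsionless_graded_valuation R W"
  unfolding valuation_overring_iff torsionless_graded_valuation_def graded_valuation_def
    graded_valuation_axioms_def
  using torsionless_graded_domain_axioms graded_domain_axioms by auto

text \<open>An inclusion in a \<open>b_operation\<close> is one inclusion for each W, and there the
  factor belonging to h cancels. So all nonzero h give the same condition, and \<open>h = 1\<close>
  is a witness.\<close>

theorem Kr_h_eq_Inter: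
  "Kr_h R b_operation = (\<Inter>W \<in> {W. valuation_overring W}. kronecker_extension W)"
proof -
  have iff: "(\<exists>h. h \<noteq> 0 \<and>
      to_fract ` ideal_prod ring_of_type_algebra (poly_content R f) (poly_content R h)
        \<subseteq> b_operation (to_fract ` ideal_prod ring_of_type_algebra (poly_content R g) (poly_content R h)))
      \<longleftrightarrow> (\<forall>W. valuation_overring W \<longrightarrow> dominated W f g)" for f g
  proof -
    have "to_fract ` ideal_prod ring_of_type_algebra (poly_content R f) (poly_content R h)
        \<subseteq> b_operation (to_fract ` ideal_prod ring_of_type_algebra (poly_content R g) (poly_content R h))
      \<longleftrightarrow> (\<forall>W. valuation_overring W \<longrightarrow> dominated W f g)" if "h \<noteq> 0" for h
    proof -
      have "to_fract ` ideal_prod ring_of_type_algebra (poly_content R f) (poly_content R h)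
          \<subseteq> ideal_prod ring_of_type_algebra
            (to_fract ` ideal_prod ring_of_type_algebra (poly_content R g) (poly_content R h)) W
          \<longleftrightarrow> dominated W f g" if "valuation_overring W" for W
      proof -
        interpret torsionless_graded_valuation R W
          by (rule valuation_overring_interpretation[OF that])
        show ?thesis
          by (rule ideal_prod_subset_iff_dominated[OF \<open>h \<noteq> 0\<close>])
      qed
      then show ?thesis
        unfolding b_operation_def by (simp add: le_INF_iff)
    qed
    then show ?thesis
      using one_neq_zero by blast
  qed
  show ?thesis
  proof (rule Set.set_eqI)
    fix x :: "'a poly fract"
    obtain f g where x: "x = Fract f g" "g \<noteq> 0"
      by (cases x)
    have ext: "Fract f g \<in> kronecker_extension W \<longleftrightarrow> dominated W f g"
      if "valuation_overring W" "g \<noteq> 0" for W f g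
      using torsionless_graded_valuation.Fract_in_kronecker_extension_iff
        [OF valuation_overring_interpretation[OF that(1)] that(2)] .
    \<comment> \<open>The left side asks for one representation that works for all W, the
      intersection for one that may vary with W; by \<open>ext\<close> domination does not depend on
      the representation.\<close>
    have "x \<in> Kr_h R b_operation \<longleftrightarrow>
        (\<exists>f g. x = Fract f g \<and> g \<noteq> 0 \<and> (\<forall>W. valuation_overring W \<longrightarrow> dominated W f g))"
      unfolding Kr_h_def iff by blast
    also have "\<dots> \<longleftrightarrow> (\<forall>W. valuation_overring W \<longrightarrow> x \<in> kronecker_extension W)"
      using x ext by metis
    finally show "x \<in> Kr_h R b_operation \<longleftrightarrow>
        x \<in> (\<Inter>W \<in> {W. valuation_overring W}. kronecker_extension W)"
      by simp
  qed
qed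

end


section \<open>Additive spans\<close>

text \<open>Only sums are formed; if S is closed under negation, the span is a subgroup by
  \<open>additive_span_uminus\<close>.\<close>

inductive_set additive_span :: "'b::comm_monoid_add set \<Rightarrow> 'b set" for S where
  zero: "0 \<in> additive_span S"
| add_gen: "x \<in> S \<Longrightarrow> y \<in> additive_span S \<Longrightarrow> x + y \<in> additive_span S"

lemma additive_span_gen: "x \<in> S \<Longrightarrow> x \<in> additive_span S"
  using additive_span.add_gen[OF _ additive_span.zero, of x S] by simp

lemma additive_span_add:
  "x \<in> additive_span S \<Longrightarrow> y \<in> additive_span S \<Longrightarrow> x + y \<in> additive_span S"
  by (induction rule: additive_span.induct) (auto simp: add.assoc intro: additive_span.add_gen)

lemma additive_span_minimal:
  assumes "S \<subseteq> T" "0 \<in> T" "\<And>x y. x \<in> T \<Longrightarrow> y \<in> T \<Longrightarrow> x + y \<in> T"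
  shows "additive_span S \<subseteq> T"
proof
  fix x
  assume "x \<in> additive_span S"
  then show "x \<in> T"
    by induction (use assms in auto)
qed

lemma additive_span_sum: "(\<And>i. i \<in> F \<Longrightarrow> f i \<in> S) \<Longrightarrow> sum f F \<in> additive_span S"
  by (induction F rule: infinite_finite_induct) (auto intro: additive_span.intros)

lemma additive_span_uminus:
  fixes S :: "'b::ab_group_add set"
  assumes "\<And>x. x \<in> S \<Longrightarrow> - x \<in> S" "x \<in> additive_span S"
  shows "- x \<in> additive_span S"
  using assms(2)
proof induction
  case (add_gen x y)
  then show ?case
    using additive_span.add_gen[of "- x" S "- y"] assms(1) by simp
qed (simp add: additive_span.zero)

lemma additive_span_mult:
  fixes S T U :: "'b::comm_semiring_0 set"
  assumes "\<And>x y. x \<in> S \<Longrightarrow> y \<in> T \<Longrightarrow> x * y \<in> U"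
    and "x \<in> additive_span S" "y \<in> additive_span T"
  shows "x * y \<in> additive_span U"
proof -
  have single: "a * y \<in> additive_span U" if "a \<in> S" for a
    using assms(3)
    by induction (auto simp: distrib_left additive_span.zero intro: additive_span.add_gen assms(1) that)
  show ?thesis
    using assms(2)
    by induction (auto simp: distrib_right additive_span.zero intro: additive_span_add single)
qed

lemma additive_span_family:
  assumes M: "\<And>i. 0 \<in> M i" "\<And>i x y. x \<in> M i \<Longrightarrow> y \<in> M i \<Longrightarrow> x + y \<in> M i"
    and x: "x \<in> additive_span (\<Union>i. M i)"
  obtains c where "c \<in> finsupp_families M" "family_sum c = x"
proof -
  have "\<exists>c\<in>finsupp_families M. family_sum c = x"
    using x
  proof induction
    case zero
    have "(\<lambda>_. 0) \<in> finsupp_families M" "family_sum (\<lambda>_. 0) = 0"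
      by (simp_all add: finsupp_families_def M family_sum_def)
    then show ?case
      by blast
  next
    case (add_gen x y)
    then obtain c i where c: "c \<in> finsupp_families M" "family_sum c = y" and i: "x \<in> M i"
      by blast
    let ?d = "\<lambda>j. if j = i then x else 0"
    have sub: "{j. ?d j \<noteq> 0} \<subseteq> {i}"
      by auto
    have d: "?d \<in> finsupp_families M" "family_sum ?d = x"
      using finite_subset[OF sub] family_sum_superset[OF _ sub] M(1) i
      by (auto simp: finsupp_families_def)
    have "(\<lambda>j. ?d j + c j) \<in> finsupp_families M"
      using finsupp_families_add[OF d(1) c(1)] M(2) by blast
    moreover have "family_sum (\<lambda>j. ?d j + c j) = x + y"
      using family_sum_add[of ?d c] c d unfolding finsupp_families_def by simp
    ultimately show ?case
      by blast
  qed
  then show ?thesis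
    using that by blast
qed

lemma family_sum_in_additive_span:
  assumes "c \<in> finsupp_families M" "\<And>i. M i \<subseteq> S"
  shows "family_sum c \<in> additive_span S"
  unfolding family_sum_def
  by (rule additive_span_sum) (use assms in \<open>auto simp: finsupp_families_def\<close>)


section \<open>The homogeneous localization\<close>

context graded_domain
begin

lemma exists_nonzero_homogeneous:
  obtains b \<beta> where "b \<in> R \<beta>" "b \<noteq> 0"
proof -
  obtain \<beta> where "homogeneous_component R 1 \<beta> \<noteq> 0"
    using homogeneous_component_eq_0_iff[of 1] by auto
  then show ?thesis
    using that homogeneous_component_mem by blast
qed

text \<open>The grading axioms do not mention 1. Multiplying the decomposition of 1 by a homogeneous
  b and comparing components in the degree of b leaves b = b e, where e is the component of 1 in
  degree 0, because \<Gamma> is cancellative.\<close>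

lemma one_component: "1 \<in> R 0"
proof -
  obtain b \<beta> where b: "b \<in> R \<beta>" "b \<noteq> 0"
    by (rule exists_nonzero_homogeneous)
  let ?F = "{\<alpha>. homogeneous_component R 1 \<alpha> \<noteq> 0}"
  have "b = (\<Sum>\<alpha>\<in>?F. b * homogeneous_component R 1 \<alpha>)"
    unfolding sum_distrib_left[symmetric]
    by (simp add: sum_homogeneous_component finite_homogeneous_component)
  then have "homogeneous_component R b \<beta> =
      (\<Sum>\<alpha> | \<alpha> \<in> ?F \<and> \<beta> + \<alpha> = \<beta>. b * homogeneous_component R 1 \<alpha>)"
    using homogeneous_component_sum[of ?F "\<lambda>\<alpha>. b * homogeneous_component R 1 \<alpha>" "\<lambda>\<alpha>. \<beta> + \<alpha>" \<beta>]
      finite_homogeneous_component component_mult[OF b(1) homogeneous_component_mem] by simp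
  also have "homogeneous_component R b \<beta> = b"
    using homogeneous_component_homogeneous[OF b(1)] by simp
  also have "{\<alpha>. \<alpha> \<in> ?F \<and> \<beta> + \<alpha> = \<beta>} = ?F \<inter> {0}"
    by (auto dest: add_left_imp_eq[of \<beta> _ 0, simplified])
  also have "(\<Sum>\<alpha>\<in>?F \<inter> {0}. b * homogeneous_component R 1 \<alpha>) = b * homogeneous_component R 1 0"
    by (cases "homogeneous_component R 1 0 = 0") (auto simp: Int_insert_right)
  finally have "b = b * homogeneous_component R 1 0" .
  then show ?thesis
    using b(2) homogeneous_component_mem[of 1 0] by simp
qed

lemma localization_componentI:
  "a \<in> R \<beta> \<Longrightarrow> b \<in> R \<gamma> \<Longrightarrow> b \<noteq> 0 \<Longrightarrow>
    Fract a b \<in> localization_component R (of_monoid \<beta> - of_monoid \<gamma>)"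
  unfolding localization_component_def by blast

lemma localization_componentE:
  assumes "x \<in> localization_component R \<alpha>" "x \<noteq> 0"
  obtains a b \<beta> \<gamma> where "x = Fract a b" "a \<in> R \<beta>" "b \<in> R \<gamma>" "b \<noteq> 0"
    "of_monoid \<beta> - of_monoid \<gamma> = \<alpha>"
  using assms unfolding localization_component_def by blast

lemma to_fract_localization_component:
  "a \<in> R \<beta> \<Longrightarrow> to_fract a \<in> localization_component R (of_monoid \<beta>)"
  using localization_componentI[OF _ one_component, of a \<beta>]
  by (simp add: of_monoid_0 to_fract_def)

lemma localization_component_zero: "0 \<in> localization_component R \<alpha>"
  by (simp add: localization_component_def)

lemma localization_component_add:
  assumes "x \<in> localization_component R \<alpha>" "y \<in> localization_component R \<alpha>"
  shows "x + y \<in> localization_component R \<alpha>"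
proof (cases "x = 0 \<or> y = 0")
  case False
  then have nz: "x \<noteq> 0" "y \<noteq> 0"
    by auto
  obtain a b \<beta> \<gamma> where x: "x = Fract a b" "a \<in> R \<beta>" "b \<in> R \<gamma>" "b \<noteq> 0"
      "of_monoid \<beta> - of_monoid \<gamma> = \<alpha>"
    by (rule localization_componentE[OF assms(1) nz(1)])
  obtain c d \<beta>' \<gamma>' where y: "y = Fract c d" "c \<in> R \<beta>'" "d \<in> R \<gamma>'" "d \<noteq> 0"
      "of_monoid \<beta>' - of_monoid \<gamma>' = \<alpha>"
    by (rule localization_componentE[OF assms(2) nz(2)])
  have "\<beta> + \<gamma>' = \<beta>' + \<gamma>"
    using x(5) y(5) of_monoid_diff_eq_iff[of \<beta> \<gamma> \<beta>' \<gamma>'] by simp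
  then have "a * d + c * b \<in> R (\<beta> + \<gamma>')"
    using component_mult[OF x(2) y(3)] component_mult[OF y(2) x(3)] add_component by simp
  moreover have "b * d \<in> R (\<gamma> + \<gamma>')" "b * d \<noteq> 0"
    using component_mult x y by auto
  ultimately have "Fract (a * d + c * b) (b * d) \<in>
      localization_component R (of_monoid (\<beta> + \<gamma>') - of_monoid (\<gamma> + \<gamma>'))"
    by (rule localization_componentI)
  moreover have "of_monoid (\<beta> + \<gamma>') - of_monoid (\<gamma> + \<gamma>') = \<alpha>"
    using x(5) by (simp add: of_monoid_add)
  ultimately show ?thesis
    using x(1,4) y(1,4) by simp
qed (use assms in auto)

lemma localization_component_mult:
  assumes "x \<in> localization_component R \<alpha>" "y \<in> localization_component R \<beta>"
  shows "x * y \<in> localization_component R (\<alpha> + \<beta>)"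
proof (cases "x = 0 \<or> y = 0")
  case True
  then show ?thesis
    by (auto simp: localization_component_zero)
next
  case False
  then have nz: "x \<noteq> 0" "y \<noteq> 0"
    by auto
  obtain a b \<beta>1 \<gamma>1 where x: "x = Fract a b" "a \<in> R \<beta>1" "b \<in> R \<gamma>1" "b \<noteq> 0"
      "of_monoid \<beta>1 - of_monoid \<gamma>1 = \<alpha>"
    by (rule localization_componentE[OF assms(1) nz(1)])
  obtain c d \<beta>2 \<gamma>2 where y: "y = Fract c d" "c \<in> R \<beta>2" "d \<in> R \<gamma>2" "d \<noteq> 0"
      "of_monoid \<beta>2 - of_monoid \<gamma>2 = \<beta>"
    by (rule localization_componentE[OF assms(2) nz(2)])
  have "Fract (a * c) (b * d) \<in>
      localization_component R (of_monoid (\<beta>1 + \<beta>2) - of_monoid (\<gamma>1 + \<gamma>2))"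
    using component_mult x y by (intro localization_componentI) auto
  moreover have "of_monoid (\<beta>1 + \<beta>2) - of_monoid (\<gamma>1 + \<gamma>2) = \<alpha> + \<beta>"
    unfolding x(5)[symmetric] y(5)[symmetric] by (simp add: of_monoid_add)
  ultimately show ?thesis
    using x(1) y(1) by simp
qed

lemma localization_component_inverse:
  assumes "x \<in> localization_component R \<alpha>"
  shows "inverse x \<in> localization_component R (- \<alpha>)"
proof (cases "x = 0")
  case True
  then show ?thesis
    by (simp add: localization_component_zero)
next
  case False
  obtain a b \<beta> \<gamma> where x: "x = Fract a b" "a \<in> R \<beta>" "b \<in> R \<gamma>" "b \<noteq> 0"
      "of_monoid \<beta> - of_monoid \<gamma> = \<alpha>"
    by (rule localization_componentE[OF assms False])
  moreover have "a \<noteq> 0"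
    using False x(1,4) by (auto simp: fract_collapse)
  ultimately show ?thesis
    using localization_componentI[of b \<gamma> a \<beta>] by auto
qed

lemma homogeneous_fractions_iff:
  "x \<in> homogeneous_fractions R \<longleftrightarrow> (\<exists>\<alpha>. x \<in> localization_component R \<alpha>)"
  by (simp add: homogeneous_fractions_def)

lemma homogeneous_fractions_mult:
  "x \<in> homogeneous_fractions R \<Longrightarrow> y \<in> homogeneous_fractions R \<Longrightarrow> x * y \<in> homogeneous_fractions R"
  using localization_component_mult unfolding homogeneous_fractions_iff by blast

lemma homogeneous_fractions_inverse:
  "x \<in> homogeneous_fractions R \<Longrightarrow> inverse x \<in> homogeneous_fractions R"
  using localization_component_inverse unfolding homogeneous_fractions_iff by blast

lemma to_fract_homogeneous_fractions: "a \<in> R \<beta> \<Longrightarrow> to_fract a \<in> homogeneous_fractions R"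
  using to_fract_localization_component unfolding homogeneous_fractions_iff by blast

lemma homogeneous_fractions_divide:
  "x \<in> homogeneous_fractions R \<Longrightarrow> y \<in> homogeneous_fractions R \<Longrightarrow> x / y \<in> homogeneous_fractions R"
  unfolding divide_inverse by (intro homogeneous_fractions_mult homogeneous_fractions_inverse)

lemma one_homogeneous_fractions: "1 \<in> homogeneous_fractions R"
  using to_fract_homogeneous_fractions[OF one_component] by simp

lemma zero_homogeneous_fractions: "0 \<in> homogeneous_fractions R"
  using localization_component_zero unfolding homogeneous_fractions_iff by blast

lemma uminus_homogeneous_fractions:
  assumes "x \<in> homogeneous_fractions R"
  shows "- x \<in> homogeneous_fractions R"
proof -
  have "- 1 \<in> homogeneous_fractions R"
    using to_fract_homogeneous_fractions[OF uminus_component[OF one_component]] by simp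
  from homogeneous_fractions_mult[OF this assms] show ?thesis
    by simp
qed

lemma homogeneous_fractionsE:
  assumes "u \<in> homogeneous_fractions R"
  obtains a b \<beta> \<gamma> where "u = Fract a b" "a \<in> R \<beta>" "b \<in> R \<gamma>" "b \<noteq> 0"
proof (cases "u = 0")
  case True
  then show ?thesis
    using that[OF _ zero_component one_component] by (simp add: Zero_fract_def)
next
  case False
  then show ?thesis
    using assms localization_componentE that unfolding homogeneous_fractions_iff by metis
qed

text \<open>A homogeneous common denominator shifts all degrees by the same \<delta>, so distinct
  degrees stay distinct. This reduces independence of the components of the localization to the
  direct sum decomposition of R.\<close>

lemma common_denominator:
  assumes "finite F" "\<And>\<alpha>. \<alpha> \<in> F \<Longrightarrow> x \<alpha> \<in> localization_component R \<alpha> \<and> x \<alpha> \<noteq> 0"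
  obtains b \<delta> where "b \<in> R \<delta>" "b \<noteq> 0"
    "\<And>\<alpha>. \<alpha> \<in> F \<Longrightarrow> \<exists>a \<gamma>. a \<in> R \<gamma> \<and> to_fract b * x \<alpha> = to_fract a \<and> of_monoid \<gamma> = \<alpha> + of_monoid \<delta>"
proof -
  have "\<exists>b \<delta>. b \<in> R \<delta> \<and> b \<noteq> 0 \<and>
    (\<forall>\<alpha>\<in>F. \<exists>a \<gamma>. a \<in> R \<gamma> \<and> to_fract b * x \<alpha> = to_fract a \<and> of_monoid \<gamma> = \<alpha> + of_monoid \<delta>)"
    using assms
  proof (induction F)
    case empty
    then show ?case
      using one_component by force
  next
    case (insert \<alpha> F)
    have "x \<alpha>' \<in> localization_component R \<alpha>' \<and> x \<alpha>' \<noteq> 0" if "\<alpha>' \<in> F" for \<alpha>'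
      using insert.prems that by blast
    from insert.IH[OF this] obtain b \<delta> where b: "b \<in> R \<delta>" "b \<noteq> 0"
      "\<And>\<alpha>. \<alpha> \<in> F \<Longrightarrow> \<exists>a \<gamma>. a \<in> R \<gamma> \<and> to_fract b * x \<alpha> = to_fract a \<and> of_monoid \<gamma> = \<alpha> + of_monoid \<delta>"
      by blast
    obtain c d \<beta> \<gamma> where x: "x \<alpha> = Fract c d" "c \<in> R \<beta>" "d \<in> R \<gamma>" "d \<noteq> 0"
      "of_monoid \<beta> - of_monoid \<gamma> = \<alpha>"
      using localization_componentE insert.prems by (metis insertI1)
    have bd: "b * d \<in> R (\<delta> + \<gamma>)" "b * d \<noteq> 0"
      using b(1,2) x(3,4) component_mult by auto
    moreover have "\<exists>a \<epsilon>. a \<in> R \<epsilon> \<and> to_fract (b * d) * x \<alpha>' = to_fract a \<and>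
        of_monoid \<epsilon> = \<alpha>' + of_monoid (\<delta> + \<gamma>)" if \<alpha>': "\<alpha>' \<in> insert \<alpha> F" for \<alpha>'
    proof (cases "\<alpha>' = \<alpha>")
      case True
      have "to_fract (b * d) * x \<alpha> = to_fract (b * c)"
        using x(1,4) by (simp add: to_fract_def eq_fract)
      moreover have "of_monoid (\<delta> + \<beta>) = \<alpha> + of_monoid (\<delta> + \<gamma>)"
        unfolding x(5)[symmetric] by (simp add: of_monoid_add)
      ultimately show ?thesis
        using component_mult[OF b(1) x(2)] True by blast
    next
      case False
      then obtain a \<epsilon> where a: "a \<in> R \<epsilon>" "to_fract b * x \<alpha>' = to_fract a"
        "of_monoid \<epsilon> = \<alpha>' + of_monoid \<delta>"
        using b(3) \<alpha>' by blast
      have "to_fract (b * d) * x \<alpha>' = to_fract (a * d)"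
        unfolding to_fract_mult a(2)[symmetric] by (simp add: ac_simps)
      moreover have "of_monoid (\<epsilon> + \<gamma>) = \<alpha>' + of_monoid (\<delta> + \<gamma>)"
        by (simp add: of_monoid_add a(3) add.assoc)
      ultimately show ?thesis
        using component_mult[OF a(1) x(3)] by blast
    qed
    ultimately show ?case
      by blast
  qed
  then show ?thesis
    using that by blast
qed

lemma localization_component_independent:
  assumes "finite F" "\<And>\<alpha>. \<alpha> \<in> F \<Longrightarrow> x \<alpha> \<in> localization_component R \<alpha> \<and> x \<alpha> \<noteq> 0"
    and "sum x F = 0"
  shows "F = {}"
proof (rule ccontr)
  assume "F \<noteq> {}"
  then obtain \<alpha>0 where \<alpha>0: "\<alpha>0 \<in> F"
    by blast
  obtain b \<delta> where b: "b \<in> R \<delta>" "b \<noteq> 0"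
    "\<And>\<alpha>. \<alpha> \<in> F \<Longrightarrow> \<exists>a \<gamma>. a \<in> R \<gamma> \<and> to_fract b * x \<alpha> = to_fract a \<and> of_monoid \<gamma> = \<alpha> + of_monoid \<delta>"
    using common_denominator[of F x] assms(1,2) by blast
  then obtain a d where a: "\<And>\<alpha>. \<alpha> \<in> F \<Longrightarrow> a \<alpha> \<in> R (d \<alpha>)"
    "\<And>\<alpha>. \<alpha> \<in> F \<Longrightarrow> to_fract b * x \<alpha> = to_fract (a \<alpha>)"
    "\<And>\<alpha>. \<alpha> \<in> F \<Longrightarrow> of_monoid (d \<alpha>) = \<alpha> + of_monoid \<delta>"
    by metis
  have to_fract_sum: "to_fract (sum a S) = (\<Sum>i\<in>S. to_fract (a i))" for S
    by (induction S rule: infinite_finite_induct) auto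
  have "to_fract (sum a F) = to_fract b * sum x F"
    unfolding to_fract_sum sum_distrib_left using a(2) by simp
  also have "\<dots> = 0"
    by (simp add: assms(3))
  finally have "sum a F = 0"
    by (simp only: to_fract_eq_0_iff)
  then have "(\<Sum>\<alpha> | \<alpha> \<in> F \<and> d \<alpha> = d \<alpha>0. a \<alpha>) = 0"
    using homogeneous_component_sum[of F a d "d \<alpha>0"] assms(1) a(1) by simp
  \<comment> \<open>The map d is injective on F, since \<open>of_monoid (d \<alpha>)\<close> is
    \<alpha> shifted by a constant.\<close>
  moreover have "{\<alpha>. \<alpha> \<in> F \<and> d \<alpha> = d \<alpha>0} = {\<alpha>0}"
    using a(3) \<alpha>0 by (auto; metis add_right_imp_eq)
  ultimately have "a \<alpha>0 = 0"
    by simp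
  then show False
    using a(2)[OF \<alpha>0] assms(2)[OF \<alpha>0] b(2) by simp
qed

text \<open>The difference of two families with equal sums has sum 0, to which independence applies.
  Every candidate for a homogeneous overring inherits this injectivity.\<close>

lemma inj_on_family_sum_localization:
  "inj_on family_sum (finsupp_families (localization_component R))"
proof (rule inj_onI)
  fix c c'
  assume c: "c \<in> finsupp_families (localization_component R)"
    "c' \<in> finsupp_families (localization_component R)" and eq: "family_sum c = family_sum c'"
  have uminus: "- x \<in> localization_component R \<alpha>" if "x \<in> localization_component R \<alpha>" for x \<alpha>
    using localization_component_mult[OF
        to_fract_localization_component[OF uminus_component[OF one_component]] that]
    by (simp add: of_monoid_0)
  let ?d = "\<lambda>\<alpha>. c \<alpha> + - c' \<alpha>"
  have fin: "finite {\<alpha>. c \<alpha> \<noteq> 0}" "finite {\<alpha>. c' \<alpha> \<noteq> 0}"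
    using c unfolding finsupp_families_def by auto
  have d: "?d \<in> finsupp_families (localization_component R)"
    by (rule finsupp_families_add)
      (use c uminus localization_component_add in \<open>auto simp: finsupp_families_def\<close>)
  have "family_sum ?d = family_sum c + family_sum (\<lambda>\<alpha>. - c' \<alpha>)"
    by (rule family_sum_add) (use fin in auto)
  also have "family_sum (\<lambda>\<alpha>. - c' \<alpha>) = - family_sum c'"
    by (simp add: family_sum_def sum_negf)
  finally have "(\<Sum>\<alpha> | ?d \<alpha> \<noteq> 0. ?d \<alpha>) = 0"
    using eq by (simp add: family_sum_def)
  then have "{\<alpha>. ?d \<alpha> \<noteq> 0} = {}"
    using d unfolding finsupp_families_def by (intro localization_component_independent) auto
  then show "c = c'"
    by (auto simp: fun_eq_iff)
qed

lemma homogeneous_localization_add: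
  assumes "x \<in> homogeneous_localization R" "y \<in> homogeneous_localization R"
  shows "x + y \<in> homogeneous_localization R"
proof -
  obtain a b c d where x: "x = Fract a b" "b \<in> nonzero_homogeneous R"
    and y: "y = Fract c d" "d \<in> nonzero_homogeneous R"
    using assms unfolding homogeneous_localization_def by blast
  have bd: "b * d \<in> nonzero_homogeneous R" "b \<noteq> 0" "d \<noteq> 0"
    using x(2) y(2) unfolding nonzero_homogeneous_def by (auto intro: component_mult)
  have "x + y = Fract (a * d + c * b) (b * d)"
    using x(1) y(1) bd by simp
  then show ?thesis
    unfolding homogeneous_localization_def using bd(1) by blast
qed

lemma homogeneous_fractions_subset_localization:
  "homogeneous_fractions R \<subseteq> homogeneous_localization R"
proof
  fix x
  assume "x \<in> homogeneous_fractions R"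
  then obtain a b \<beta> \<gamma> where "x = Fract a b" "b \<in> R \<gamma>" "b \<noteq> 0"
    by (rule homogeneous_fractionsE)
  then show "x \<in> homogeneous_localization R"
    unfolding homogeneous_localization_def nonzero_homogeneous_def by blast
qed


section \<open>Graded valuation overrings and valuation overrings\<close>

text \<open>For a valuation overring W of K this passes to the graded valuation overring with the
  same homogeneous elements; \<open>Zar_h_extension\<close> goes the other way.\<close>

definition graded_core :: "'a fract set \<Rightarrow> 'a fract set"
  where "graded_core V = additive_span (V \<inter> homogeneous_fractions R)"

lemma to_fract_in_graded_core:
  assumes "range to_fract \<subseteq> V"
  shows "to_fract a \<in> graded_core V"
proof -
  have to_fract_sum: "to_fract (sum s S) = (\<Sum>i\<in>S. to_fract (s i))" for S and s :: "'g \<Rightarrow> 'a"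
    by (induction S rule: infinite_finite_induct) auto
  have "to_fract a = (\<Sum>\<alpha> | homogeneous_component R a \<alpha> \<noteq> 0. to_fract (homogeneous_component R a \<alpha>))"
    unfolding to_fract_sum[symmetric]
    by (simp add: sum_homogeneous_component finite_homogeneous_component)
  also have "\<dots> \<in> graded_core V"
    unfolding graded_core_def using assms
    by (intro additive_span_sum) (auto intro: to_fract_homogeneous_fractions[OF homogeneous_component_mem])
  finally show ?thesis .
qed

lemma homogeneous_overring_graded_core:
  assumes V: "subring V ring_of_type_algebra" "range to_fract \<subseteq> V"
  shows "homogeneous_overring R (graded_core V)"
    and "graded_core V \<inter> homogeneous_fractions R = V \<inter> homogeneous_fractions R"
proof -
  have ring: "0 \<in> V" "1 \<in> V" "\<And>x y. x \<in> V \<Longrightarrow> y \<in> V \<Longrightarrow> x + y \<in> V"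
    "\<And>x y. x \<in> V \<Longrightarrow> y \<in> V \<Longrightarrow> x * y \<in> V" "\<And>x. x \<in> V \<Longrightarrow> - x \<in> V"
    using V(1) subringE(2)[OF V(1)] unfolding subring_type_iff by auto
  have sub: "graded_core V \<subseteq> V"
    unfolding graded_core_def using ring by (intro additive_span_minimal) auto
  have gen: "V \<inter> homogeneous_fractions R \<subseteq> graded_core V"
    unfolding graded_core_def by (auto intro: additive_span_gen)
  show "graded_core V \<inter> homogeneous_fractions R = V \<inter> homogeneous_fractions R"
    using sub gen by blast
  have "subring (graded_core V) ring_of_type_algebra"
    unfolding subring_type_iff
  proof (intro conjI ballI)
    show "1 \<in> graded_core V"
      using gen ring(2) one_homogeneous_fractions by blast
    fix x
    assume x: "x \<in> graded_core V"
    show "- x \<in> graded_core V"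
      using x unfolding graded_core_def
      by (intro additive_span_uminus) (use ring uminus_homogeneous_fractions in auto)
    fix y
    assume y: "y \<in> graded_core V"
    show "x + y \<in> graded_core V"
      using x y unfolding graded_core_def by (rule additive_span_add)
    show "x * y \<in> graded_core V"
      using x y unfolding graded_core_def
      by (intro additive_span_mult[of "V \<inter> homogeneous_fractions R" "V \<inter> homogeneous_fractions R"])
        (use ring homogeneous_fractions_mult in auto)
  qed
  moreover have "graded_core V \<subseteq> homogeneous_localization R"
    unfolding graded_core_def using homogeneous_fractions_subset_localization zero_homogeneous_fractions
    by (intro additive_span_minimal homogeneous_localization_add) auto
  moreover have "is_direct_sum (\<lambda>\<alpha>. graded_core V \<inter> localization_component R \<alpha>) (graded_core V)"
    unfolding is_direct_sum_def bij_betw_def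
  proof
    let ?M = "\<lambda>\<alpha>. graded_core V \<inter> localization_component R \<alpha>"
    show "inj_on family_sum (finsupp_families ?M)"
      by (rule inj_on_subset[OF inj_on_family_sum_localization]) (auto simp: finsupp_families_def)
    have M_eq: "?M \<alpha> = V \<inter> localization_component R \<alpha>" for \<alpha>
      using sub gen unfolding homogeneous_fractions_def by blast
    show "family_sum ` finsupp_families ?M = graded_core V"
    proof (intro equalityI subsetI)
      fix x
      assume "x \<in> family_sum ` finsupp_families ?M"
      then obtain c where c: "c \<in> finsupp_families ?M" "x = family_sum c"
        by blast
      have "?M \<alpha> \<subseteq> V \<inter> homogeneous_fractions R" for \<alpha>
        using sub unfolding homogeneous_fractions_def by blast
      from family_sum_in_additive_span[OF c(1) this] show "x \<in> graded_core V"
        by (simp add: c(2) graded_core_def[of V])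
    next
      fix x
      assume "x \<in> graded_core V"
      moreover have "V \<inter> homogeneous_fractions R = (\<Union>\<alpha>. ?M \<alpha>)"
        unfolding M_eq homogeneous_fractions_def by blast
      ultimately have "x \<in> additive_span (\<Union>\<alpha>. ?M \<alpha>)"
        unfolding graded_core_def by simp
      then obtain c where "c \<in> finsupp_families ?M" "family_sum c = x"
        by (rule additive_span_family[rotated 2])
          (use ring localization_component_zero localization_component_add in \<open>auto simp: M_eq\<close>)
      then show "x \<in> family_sum ` finsupp_families ?M"
        by blast
    qed
  qed
  ultimately show "homogeneous_overring R (graded_core V)"
    unfolding homogeneous_overring_def using to_fract_in_graded_core[OF V(2)] by blast
qed

text \<open>The direct sum condition writes each element of A as a sum of homogeneous elements of A.
  Hence A is determined by these, and comparisons may be restricted to them.\<close>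

lemma graded_core_homogeneous_overring:
  assumes "homogeneous_overring R A"
  shows "graded_core A = A"
proof
  have A: "subring A ring_of_type_algebra"
    "is_direct_sum (\<lambda>\<alpha>. A \<inter> localization_component R \<alpha>) A"
    using assms unfolding homogeneous_overring_def by auto
  then show "graded_core A \<subseteq> A"
    unfolding graded_core_def subring_type_iff using subringE(2)[OF A(1)]
    by (intro additive_span_minimal) auto
  show "A \<subseteq> graded_core A"
  proof
    fix x
    assume "x \<in> A"
    then obtain c where c: "c \<in> finsupp_families (\<lambda>\<alpha>. A \<inter> localization_component R \<alpha>)"
      "x = family_sum c"
      using A(2) unfolding is_direct_sum_def bij_betw_def by blast
    have "A \<inter> localization_component R \<alpha> \<subseteq> A \<inter> homogeneous_fractions R" for \<alpha>
      unfolding homogeneous_fractions_def by blast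
    from family_sum_in_additive_span[OF c(1) this] show "x \<in> graded_core A"
      by (simp add: c(2) graded_core_def)
  qed
qed

lemma Zar_h_eqI:
  assumes "V \<in> Zar_h R" "V' \<in> Zar_h R"
    and "V \<inter> homogeneous_fractions R = V' \<inter> homogeneous_fractions R"
  shows "V = V'"
proof -
  have "graded_core V = V" "graded_core V' = V'"
    using assms(1,2) by (auto simp: Zar_h_def intro!: graded_core_homogeneous_overring)
  moreover have "graded_core V = graded_core V'"
    unfolding graded_core_def assms(3) ..
  ultimately show ?thesis
    by metis
qed

lemma graded_core_in_Zar_h:
  assumes "valuation_overring W"
  shows "graded_core W \<in> Zar_h R" "graded_core W \<inter> homogeneous_fractions R = W \<inter> homogeneous_fractions R"
proof -
  have W: "subring W ring_of_type_algebra" "range to_fract \<subseteq> W"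
    "\<And>x. x \<noteq> 0 \<Longrightarrow> x \<in> W \<or> inverse x \<in> W"
    using assms unfolding valuation_overring_def by auto
  show eq: "graded_core W \<inter> homogeneous_fractions R = W \<inter> homogeneous_fractions R"
    by (rule homogeneous_overring_graded_core[OF W(1,2)])
  show "graded_core W \<in> Zar_h R"
    unfolding Zar_h_def using homogeneous_overring_graded_core(1)[OF W(1,2)] W(3) eq
      homogeneous_fractions_inverse by blast
qed

text \<open>The dominating ring W acquires no new homogeneous elements: if a homogeneous x were in W
  but not in V, then its inverse would be a nonunit of V, hence in J and of positive value in W,
  against x in W.\<close>

lemma Zar_h_extension:
  assumes V: "V \<in> Zar_h R"
  obtains W where "valuation_overring W" "W \<inter> homogeneous_fractions R = V \<inter> homogeneous_fractions R"
proof -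
  have over: "homogeneous_overring R V"
    and val: "\<And>x. x \<in> homogeneous_fractions R \<Longrightarrow> x \<noteq> 0 \<Longrightarrow> x \<in> V \<or> inverse x \<in> V"
    using V unfolding Zar_h_def by auto
  have sub: "subring V ring_of_type_algebra" "range to_fract \<subseteq> V"
    using over unfolding homogeneous_overring_def by auto
  have ring: "0 \<in> V" "1 \<in> V" "\<And>x y. x \<in> V \<Longrightarrow> y \<in> V \<Longrightarrow> x + y \<in> V"
    "\<And>x y. x \<in> V \<Longrightarrow> y \<in> V \<Longrightarrow> x * y \<in> V" "\<And>x. x \<in> V \<Longrightarrow> - x \<in> V"
    using sub(1) subringE(2)[OF sub(1)] unfolding subring_type_iff by auto
  \<comment> \<open>The nonunits of degree \<alpha>, with 0. Within one degree quotients are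
    homogeneous and therefore comparable in V, which makes \<open>N \<alpha>\<close> closed under
    addition; different degrees are combined only in \<open>J\<close>.\<close>
  define N where "N \<alpha> = {x \<in> V \<inter> localization_component R \<alpha>. x = 0 \<or> inverse x \<notin> V}" for \<alpha>
  define J where "J = additive_span (\<Union>\<alpha>. N \<alpha>)"
  have N_zero: "0 \<in> N \<alpha>" for \<alpha>
    unfolding N_def using ring localization_component_zero by simp
  have half: "inverse (x + y) \<notin> V"
    if "x \<in> N \<alpha>" "y \<in> N \<alpha>" "x \<noteq> 0" "y \<noteq> 0" "x + y \<noteq> 0" "x / y \<in> V" for x y \<alpha>
  proof
    assume "inverse (x + y) \<in> V"
    then have "(1 + x / y) * inverse (x + y) \<in> V"
      using ring(2-4) that(6) by blast
    moreover have "(1 + x / y) * inverse (x + y) = inverse y"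
      using that(4,5) by (simp add: field_simps)
    ultimately show False
      using that(2,4) unfolding N_def by simp
  qed
  have N_add: "x + y \<in> N \<alpha>" if xy: "x \<in> N \<alpha>" "y \<in> N \<alpha>" for x y \<alpha>
  proof (cases "x = 0 \<or> y = 0 \<or> x + y = 0")
    case True
    then show ?thesis
      using xy N_zero by auto
  next
    case False
    then have "x / y \<in> homogeneous_fractions R" "x / y \<noteq> 0"
      using xy homogeneous_fractions_divide unfolding N_def by (auto simp: homogeneous_fractions_iff)
    then have "x / y \<in> V \<or> y / x \<in> V"
      using val[of "x / y"] by simp
    then have "inverse (x + y) \<notin> V"
      using half[OF xy] half[OF xy(2,1)] False by (auto simp: add.commute)
    then show ?thesis
      using xy ring localization_component_add unfolding N_def by auto
  qed
  have J_sub: "J \<subseteq> V"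
    unfolding J_def by (rule additive_span_minimal) (use ring in \<open>auto simp: N_def\<close>)
  have mult: "a * x \<in> (\<Union>\<alpha>. N \<alpha>)" if ax: "a \<in> V \<inter> homogeneous_fractions R" "x \<in> (\<Union>\<alpha>. N \<alpha>)" for a x
  proof -
    obtain \<alpha> \<beta> where a: "a \<in> V" "a \<in> localization_component R \<alpha>" and x: "x \<in> N \<beta>"
      using ax unfolding homogeneous_fractions_def by blast
    have "inverse (a * x) \<notin> V" if "a * x \<noteq> 0"
    proof
      assume "inverse (a * x) \<in> V"
      then have "a * inverse (a * x) \<in> V"
        using ring(4) a(1) by blast
      moreover have "a * inverse (a * x) = inverse x"
        using that by (simp add: field_simps)
      ultimately have "inverse x \<in> V"
        by metis
      then show False
        using x that unfolding N_def by auto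
    qed
    then have "a * x \<in> N (\<alpha> + \<beta>)"
      using a x ring(4) localization_component_mult unfolding N_def by blast
    then show ?thesis
      by blast
  qed
  have V_eq: "V = additive_span (V \<inter> homogeneous_fractions R)"
    using graded_core_homogeneous_overring[OF over] unfolding graded_core_def ..
  interpret subring_ideal V J
  proof
    fix a x
    assume a: "a \<in> V" and x: "x \<in> J"
    from a have "a \<in> additive_span (V \<inter> homogeneous_fractions R)"
      by (rule subsetD[OF equalityD1[OF V_eq]])
    from additive_span_mult[OF mult this x[unfolded J_def]] show "a * x \<in> J"
      by (simp add: J_def)
  qed (use ring J_sub in \<open>auto simp: J_def intro: additive_span.zero additive_span_add\<close>)
  have "1 \<notin> J"
  proof
    assume "1 \<in> J"
    then obtain c where c: "c \<in> finsupp_families N" "family_sum c = 1"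
      unfolding J_def by (rule additive_span_family[rotated 2]) (use N_zero N_add in auto)
    \<comment> \<open>The family whose only nonzero member is 1 in degree 0. By uniqueness of the
      decomposition it is the family \<open>c\<close>, so the unit 1 would lie in
      \<open>N 0\<close>.\<close>
    let ?d = "\<lambda>\<alpha>::'g quotient_group. if \<alpha> = 0 then 1 else 0 :: 'a fract"
    have d: "?d \<in> finsupp_families (localization_component R)"
      using to_fract_localization_component[OF one_component] localization_component_zero
      unfolding finsupp_families_def by (simp add: of_monoid_0)
    have "family_sum ?d = 1"
      by (simp add: family_sum_def)
    then have eq: "family_sum c = family_sum ?d"
      by (simp only: c(2))
    have "c \<in> finsupp_families (localization_component R)"
      using c(1) unfolding finsupp_families_def N_def by auto
    then have "c = ?d"
      by (rule inj_onD[of family_sum, OF inj_on_family_sum_localization eq]) (rule d)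
    then have "1 \<in> N 0"
      using c(1) unfolding finsupp_families_def by (metis (mono_tags, lifting) mem_Collect_eq)
    then show False
      unfolding N_def using ring(2) by simp
  qed
  then obtain W where W: "valuation_ring W" "V \<subseteq> W" "\<And>x. x \<in> J \<Longrightarrow> \<not> valuation_ring.vle W x 1"
    using exists_dominating_valuation_ring by metis
  interpret W: valuation_ring W
    by (rule W(1))
  have "valuation_overring W"
    unfolding valuation_overring_iff using W(1,2) sub(2) by blast
  moreover have "x \<in> V" if x: "x \<in> W" "x \<in> homogeneous_fractions R" for x
  proof (rule ccontr)
    assume "x \<notin> V"
    then have "x \<noteq> 0"
      using ring(1) by blast
    then have "inverse x \<in> V"
      using val[OF x(2)] \<open>x \<notin> V\<close> by blast
    then have "inverse x \<in> (\<Union>\<alpha>. N \<alpha>)"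
      using homogeneous_fractions_inverse[OF x(2)] \<open>x \<notin> V\<close> unfolding N_def homogeneous_fractions_iff by auto
    then have "inverse x \<in> J"
      unfolding J_def by (rule additive_span_gen)
    then show False
      using W(3) W.vle_1_right[of "inverse x"] x(1) \<open>x \<noteq> 0\<close> by simp
  qed
  ultimately show ?thesis
    using that[of W] W(2) by blast
qed

end

section \<open>Compactness of the patch topology on the valuation overrings of K\<close>

lemma valuation_overring_compactness:
  assumes fin: "\<And>F. finite F \<Longrightarrow> \<exists>W. valuation_overring W \<and> F \<inter> U \<subseteq> W \<and> W \<inter> (F \<inter> T) = {}"
  obtains W where "valuation_overring W" "U \<subseteq> W" "W \<inter> T = {}"
proof -
  \<comment> \<open>An element of F imposes membership in W if it lies in U and non-membership if it
    lies in T. Two finite sets of conditions are joined by their union, which makes \<open>A\<close>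
    and \<open>I\<close> closed under the ring operations.\<close>
  define good where "good F W \<longleftrightarrow> valuation_overring W \<and> F \<inter> U \<subseteq> W \<and> W \<inter> (F \<inter> T) = {}" for F W
  define A where "A = {x. \<exists>F. finite F \<and> (\<forall>W. good F W \<longrightarrow> x \<in> W)}"
  define I where "I = {x. \<exists>F. finite F \<and> (\<forall>W. good F W \<longrightarrow> \<not> valuation_ring.vle W x 1)}"
  have val: "valuation_ring W" if "good F W" for F W
    using that unfolding good_def valuation_overring_iff by blast
  have good_Un: "good F1 W" "good F2 W" if "good (F1 \<union> F2) W" for F1 F2 W
    using that unfolding good_def by auto
  have A_I: "x \<in> A" if "finite F" "\<And>W. good F W \<Longrightarrow> x \<in> W" for x F
    unfolding A_def using that by blast
  have I_I: "x \<in> I" if "finite F" "\<And>W. good F W \<Longrightarrow> \<not> valuation_ring.vle W x 1" for x F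
    unfolding I_def using that by blast
  interpret subring_ideal A I
  proof
    show "1 \<in> A" "0 \<in> I"
      using A_I[of "{}"] I_I[of "{}"] val valuation_ring.one_mem valuation_ring.vle_0_left
      by (blast, metis (no_types, lifting) finite.emptyI one_neq_zero)
  next
    fix x y
    assume "x \<in> A" "y \<in> A"
    then obtain F1 F2 where T: "finite F1" "\<forall>W. good F1 W \<longrightarrow> x \<in> W"
      "finite F2" "\<forall>W. good F2 W \<longrightarrow> y \<in> W"
      unfolding A_def by blast
    have W: "valuation_ring W" "x \<in> W" "y \<in> W" if "good (F1 \<union> F2) W" for W
      using T(2,4) good_Un[OF that] val[OF that] by blast+
    show "x + y \<in> A"
      by (rule A_I[of "F1 \<union> F2"]) (use T W valuation_ring.add_mem in blast)+
    show "x * y \<in> A"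
      by (rule A_I[of "F1 \<union> F2"]) (use T W valuation_ring.mult_mem in blast)+
  next
    fix x
    assume "x \<in> A"
    then obtain F where F: "finite F" "\<forall>W. good F W \<longrightarrow> x \<in> W"
      unfolding A_def by blast
    show "- x \<in> A"
      by (rule A_I[of F]) (use F val valuation_ring.uminus_mem in blast)+
  next
    show "I \<subseteq> A"
    proof
      fix x
      assume "x \<in> I"
      then obtain F where F: "finite F"
        "\<forall>W. good F W \<longrightarrow> \<not> valuation_ring.vle W x 1"
        unfolding I_def by blast
      show "x \<in> A"
      proof (rule A_I[OF F(1)])
        fix W
        assume W: "good F W"
        interpret valuation_ring W
          using val[OF W] .
        show "x \<in> W"
          using F(2) W vle_total[of x 1] vle_1_left[of x] by blast
      qed
    qed
  next
    fix x y
    assume "x \<in> I" "y \<in> I"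
    then obtain F1 F2 where T: "finite F1" "\<forall>W. good F1 W \<longrightarrow> \<not> valuation_ring.vle W x 1"
      "finite F2" "\<forall>W. good F2 W \<longrightarrow> \<not> valuation_ring.vle W y 1"
      unfolding I_def by blast
    have W: "valuation_ring W" "\<not> valuation_ring.vle W x 1" "\<not> valuation_ring.vle W y 1"
      if "good (F1 \<union> F2) W" for W
      using T(2,4) good_Un[OF that] val[OF that] by blast+
    show "x + y \<in> I"
      by (rule I_I[of "F1 \<union> F2"]) (use T W valuation_ring.not_vle_add in blast)+
  next
    fix x y
    assume "x \<in> A" "y \<in> I"
    then obtain F1 F2 where T: "finite F1" "\<forall>W. good F1 W \<longrightarrow> x \<in> W"
      "finite F2" "\<forall>W. good F2 W \<longrightarrow> \<not> valuation_ring.vle W y 1"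
      unfolding A_def I_def by blast
    show "x * y \<in> I"
    proof (rule I_I[of "F1 \<union> F2"])
      fix W
      assume W: "good (F1 \<union> F2) W"
      interpret valuation_ring W
        using val[OF W] .
      have "vle y (x * y)" "\<not> vle y 1"
        using T(2,4) good_Un[OF W] vle_mult_mem[of x y y] by auto
      then show "\<not> vle (x * y) 1"
        using vle_trans by blast
    qed (use T in auto)
  qed
  \<comment> \<open>The element 1 has positive value in no valuation ring, so finitely many
    conditions that force it would be contradictory.\<close>
  have "1 \<notin> I"
  proof
    assume "1 \<in> I"
    then obtain F where F: "finite F" "\<forall>W. good F W \<longrightarrow> \<not> valuation_ring.vle W 1 1"
      unfolding I_def by blast
    then obtain W where "good F W"
      using fin unfolding good_def by blast
    then show False
      using F(2) val valuation_ring.vle_refl by blast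
  qed
  then obtain W where W: "valuation_ring W" "A \<subseteq> W" "\<And>x. x \<in> I \<Longrightarrow> \<not> valuation_ring.vle W x 1"
    using exists_dominating_valuation_ring by metis
  have "U \<subseteq> A"
    using A_I[of "{u}" u for u] unfolding good_def by blast
  moreover have "range to_fract \<subseteq> A"
    using A_I[of "{}"] unfolding good_def valuation_overring_def by blast
  ultimately have "valuation_overring W" "U \<subseteq> W"
    unfolding valuation_overring_iff using W(1,2) by auto
  moreover have "t \<notin> W" if "t \<in> T" for t
  proof -
    \<comment> \<open>For nonzero t, not lying in a valuation ring means that the inverse has
      positive value there. In this form the negative conditions enter through the ideal.\<close>
    have "\<not> valuation_ring.vle W' (inverse t) 1" if "good {t} W'" for W'
      using that \<open>t \<in> T\<close> valuation_ring.not_vle_1_iff[OF val[OF that]] unfolding good_def by simp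
    then have "inverse t \<in> I"
      using I_I[of "{t}"] \<open>t \<in> T\<close> by simp
    moreover have "t \<noteq> 0"
      using fin[of "{t}"] \<open>t \<in> T\<close> valuation_ring.zero_mem unfolding valuation_overring_iff by auto
    ultimately show ?thesis
      using W(3) valuation_ring.not_vle_1_iff[OF W(1)] by fastforce
  qed
  ultimately show ?thesis
    using that by blast
qed


section \<open>Spectral spaces from a subbase\<close>

lemma generate_topology_on_finite_Inter:
  assumes "generate_topology_on \<S> U" "x \<in> U"
  shows "\<exists>F. finite F \<and> F \<subseteq> \<S> \<and> F \<noteq> {} \<and> x \<in> \<Inter>F \<and> \<Inter>F \<subseteq> U"
  using assms
proof (induction arbitrary: x)
  case Empty
  then show ?case
    by simp
next
  case (Int U V)
  from Int.prems have "x \<in> U" "x \<in> V"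
    by auto
  from Int.IH(1)[OF this(1)] Int.IH(2)[OF this(2)] obtain F G
    where FG: "finite F" "F \<subseteq> \<S>" "F \<noteq> {}" "x \<in> \<Inter>F" "\<Inter>F \<subseteq> U"
      "finite G" "G \<subseteq> \<S>" "x \<in> \<Inter>G" "\<Inter>G \<subseteq> V"
    by auto
  have "\<Inter>(F \<union> G) \<subseteq> U \<inter> V"
    using FG(5,9) by blast
  then show ?case
    using FG by (intro exI[of _ "F \<union> G"]) auto
next
  case (UN K)
  from UN.prems obtain k where "k \<in> K" "x \<in> k"
    by blast
  from UN.IH[OF this] obtain F where "finite F" "F \<subseteq> \<S>" "F \<noteq> {}" "x \<in> \<Inter>F" "\<Inter>F \<subseteq> k"
    by auto
  moreover from this have "\<Inter>F \<subseteq> \<Union>K"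
    using \<open>k \<in> K\<close> by blast
  ultimately show ?case
    by auto
next
  case (Basis s)
  then show ?case
    by (intro exI[of _ "{s}"]) auto
qed

text \<open>Intersecting with the whole space admits the empty F, whose own intersection would be
  the universe of the type.\<close>

lemma openin_generated_finite_Inter:
  assumes "finite F" "F \<subseteq> \<S>"
  shows "openin (topology_generated_by \<S>) (\<Inter>F \<inter> \<Union>\<S>)"
proof (cases "F = {}")
  case True
  then show ?thesis
    using openin_topspace[of "topology_generated_by \<S>"] by simp
next
  case False
  then have "openin (topology_generated_by \<S>) (\<Inter>F)"
    using assms topology_generated_by_Basis by (intro openin_Inter) blast+
  then show ?thesis
    using openin_topspace[of "topology_generated_by \<S>"] by (auto intro: openin_Int)
qed

text \<open>Alexander's subbase theorem is applied to K with the topology generated by the traces of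
  the subbase. The inclusion of this compact space is continuous, so its image is compact.\<close>

lemma compactin_topology_generated_by:
  assumes K: "K \<subseteq> \<Union>\<S>"
    and fin: "\<And>C. C \<subseteq> \<S> \<Longrightarrow> K \<subseteq> \<Union>C \<Longrightarrow> \<exists>C'. finite C' \<and> C' \<subseteq> C \<and> K \<subseteq> \<Union>C'"
  shows "compactin (topology_generated_by \<S>) K"
proof -
  define Y where "Y = topology (arbitrary union_of (finite intersection_of (\<lambda>s. s \<in> \<S>) relative_to K))"
  have openin_Y: "openin Y U \<longleftrightarrow>
      (arbitrary union_of (finite intersection_of (\<lambda>s. s \<in> \<S>) relative_to K)) U" for U
    unfolding Y_def by (rule openin_subbase)
  have topspace_Y: "topspace Y = K"
    unfolding Y_def by (rule topspace_subbase)
  have "compact_space Y"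
    using K fin Y_def[symmetric] by (rule Alexander_subbase_alt)
  moreover have "continuous_map Y (topology_generated_by \<S>) (\<lambda>x. x)"
  proof (rule continuous_on_generated_topo)
    fix s
    assume "s \<in> \<S>"
    then have "(finite intersection_of (\<lambda>s. s \<in> \<S>) relative_to K) (K \<inter> s)"
      by (intro relative_to_inc finite_intersection_of_inc)
    then show "openin Y ((\<lambda>x. x) -` s \<inter> topspace Y)"
      unfolding openin_Y topspace_Y by (simp add: arbitrary_union_of_inc Int_commute)
  qed (use K topspace_Y in auto)
  ultimately have "compactin (topology_generated_by \<S>) ((\<lambda>x. x) ` K)"
    using image_compactin[of Y K] topspace_Y unfolding compact_space_def by metis
  then show ?thesis
    by simp
qed

lemma irreducible_in_finite_Union:
  assumes irr: "irreducible_in T C" "C \<noteq> {}" and "finite F" "\<And>A. A \<in> F \<Longrightarrow> closedin T A" "C \<subseteq> \<Union>F"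
  shows "\<exists>A\<in>F. C \<subseteq> A"
  using assms(3-)
proof (induction F)
  case (insert A F)
  then have "C \<subseteq> A \<or> C \<subseteq> \<Union>F"
    using irr(1) unfolding irreducible_in_def by (metis Union_insert closedin_Union insertCI)
  then show ?case
    using insert by blast
qed (use irr(2) in auto)

text \<open>
  The second assumption says that the space is compact in the patch topology, in which the members
  of the subbase are clopen.
\<close>

theorem spectral_space_topology_generated_by:
  assumes separated: "\<And>x y. x \<in> \<Union>\<S> \<Longrightarrow> y \<in> \<Union>\<S> \<Longrightarrow> (\<And>s. s \<in> \<S> \<Longrightarrow> x \<in> s \<longleftrightarrow> y \<in> s) \<Longrightarrow> x = y"
    and patch_compact: "\<And>\<A> \<B>. \<A> \<subseteq> \<S> \<Longrightarrow> \<B> \<subseteq> \<S> \<Longrightarrow>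
      (\<And>F G. finite F \<Longrightarrow> F \<subseteq> \<A> \<Longrightarrow> finite G \<Longrightarrow> G \<subseteq> \<B> \<Longrightarrow> \<exists>x\<in>\<Union>\<S>. x \<in> \<Inter>F \<and> x \<notin> \<Union>G) \<Longrightarrow>
      \<exists>x\<in>\<Union>\<S>. x \<in> \<Inter>\<A> \<and> x \<notin> \<Union>\<B>"
  shows "spectral_space (topology_generated_by \<S>)"
proof -
  let ?T = "topology_generated_by \<S>" and ?b = "\<lambda>F. \<Inter>F \<inter> \<Union>\<S>"
  have compact_basic: "compactin ?T (?b F)" if F: "finite F" "F \<subseteq> \<S>" for F
  proof (rule compactin_topology_generated_by)
    fix C
    assume C: "C \<subseteq> \<S>" "?b F \<subseteq> \<Union>C"
    show "\<exists>C'. finite C' \<and> C' \<subseteq> C \<and> ?b F \<subseteq> \<Union>C'"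
    proof (rule ccontr)
      assume "\<not> ?thesis"
      then have neg: "\<And>C'. finite C' \<Longrightarrow> C' \<subseteq> C \<Longrightarrow> \<not> ?b F \<subseteq> \<Union>C'"
        by metis
      \<comment> \<open>Without a finite subcover, the conditions of lying in the members of F and
        outside those of C are finitely satisfiable; patch compactness then yields an uncovered
        point.\<close>
      have "\<exists>x\<in>\<Union>\<S>. x \<in> \<Inter>F \<and> x \<notin> \<Union>C"
      proof (rule patch_compact[OF F(2) C(1)])
        fix F' G
        assume "F' \<subseteq> F" "finite G" "G \<subseteq> C"
        then obtain x where "x \<in> ?b F" "x \<notin> \<Union>G"
          using neg[of G] by (meson subsetI)
        then show "\<exists>x\<in>\<Union>\<S>. x \<in> \<Inter>F' \<and> x \<notin> \<Union>G"
          using \<open>F' \<subseteq> F\<close> by (intro bexI[of _ x]) auto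
      qed
      then show False
        using C(2) by blast
    qed
  qed simp
  have basic: "\<exists>F. finite F \<and> F \<subseteq> \<S> \<and> x \<in> ?b F \<and> ?b F \<subseteq> U" if U: "openin ?T U" "x \<in> U" for x U
  proof -
    from generate_topology_on_finite_Inter[OF openin_topology_generated_by[OF U(1)] U(2)]
    obtain F where "finite F" "F \<subseteq> \<S>" "x \<in> \<Inter>F" "\<Inter>F \<subseteq> U"
      by auto
    moreover have "x \<in> \<Union>\<S>"
      using openin_subset[OF U(1)] U(2) by auto
    ultimately show ?thesis
      by (intro exI[of _ F]) auto
  qed
  have "compact_space ?T"
    using compact_basic[of "{}"] by (simp add: compact_space_def)
  moreover have "t0_space ?T"
    unfolding t0_space_def
  proof (intro ballI impI)
    fix x y
    assume "x \<in> topspace ?T" "y \<in> topspace ?T" "x \<noteq> y"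
    then obtain s where "s \<in> \<S>" "x \<in> s \<longleftrightarrow> y \<notin> s"
      using separated[of x y] by auto
    then show "\<exists>U. openin ?T U \<and> (x \<notin> U) = (y \<in> U)"
      using topology_generated_by_Basis by blast
  qed
  moreover have "compactin ?T (U \<inter> V)"
    if U: "openin ?T U" "compactin ?T U" and V: "openin ?T V" "compactin ?T V" for U V
  proof -
    \<comment> \<open>A compact open set is a finite union of basic ones, so intersections reduce to
      basic sets, and \<open>?b F\<close> meets \<open>?b G\<close> in
      \<open>?b (F \<union> G)\<close>.\<close>
    have cover: "\<exists>\<F>. finite \<F> \<and> (\<forall>F\<in>\<F>. finite F \<and> F \<subseteq> \<S>) \<and> U = (\<Union>F\<in>\<F>. ?b F)"
      if U: "openin ?T U" "compactin ?T U" for U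
    proof -
      define S where "S = {F. finite F \<and> F \<subseteq> \<S> \<and> ?b F \<subseteq> U}"
      have "\<exists>\<G>. finite \<G> \<and> \<G> \<subseteq> ?b ` S \<and> U \<subseteq> \<Union>\<G>"
      proof (rule compactinD[OF U(2)])
        show "openin ?T B" if "B \<in> ?b ` S" for B
          using that
        proof (rule imageE)
          fix F
          assume B: "B = ?b F" and F: "F \<in> S"
          show "openin ?T B"
            unfolding B by (rule openin_generated_finite_Inter) (use F in \<open>auto simp: S_def\<close>)
        qed
        show "U \<subseteq> \<Union>(?b ` S)"
        proof
          fix x
          assume "x \<in> U"
          from basic[OF U(1) this] obtain F where F: "F \<in> S" "x \<in> ?b F"
            unfolding S_def by auto
          show "x \<in> \<Union>(?b ` S)"
            by (rule UnionI[of "?b F"]) (rule imageI[OF F(1)], rule F(2))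
        qed
      qed
      then obtain \<G> where \<G>: "finite \<G>" "\<G> \<subseteq> ?b ` S" "U \<subseteq> \<Union>\<G>"
        by auto
      from finite_subset_image[OF \<G>(1,2)] obtain \<F> where \<F>: "\<F> \<subseteq> S" "finite \<F>" "\<G> = ?b ` \<F>"
        by auto
      have "(\<Union>F\<in>\<F>. ?b F) \<subseteq> U"
        by (rule UN_least) (use \<F>(1) in \<open>auto simp: S_def\<close>)
      then have "U = (\<Union>F\<in>\<F>. ?b F)"
        using \<G>(3) unfolding \<F>(3) by (intro equalityI)
      moreover have "\<forall>F\<in>\<F>. finite F \<and> F \<subseteq> \<S>"
        using \<F>(1) unfolding S_def by auto
      ultimately show ?thesis
        using \<F>(2) by (intro exI[of _ \<F>]) simp
    qed
    obtain \<F> \<G> where \<F>: "finite \<F>" "\<forall>F\<in>\<F>. finite F \<and> F \<subseteq> \<S>" "U = (\<Union>F\<in>\<F>. ?b F)"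
      and \<G>: "finite \<G>" "\<forall>F\<in>\<G>. finite F \<and> F \<subseteq> \<S>" "V = (\<Union>F\<in>\<G>. ?b F)"
      using cover[OF U] cover[OF V] by blast
    have Int: "?b F \<inter> ?b G = ?b (F \<union> G)" for F G
      by auto
    have "U \<inter> V = (\<Union>F\<in>\<F>. \<Union>G\<in>\<G>. ?b (F \<union> G))"
      unfolding \<F>(3) \<G>(3) Int_UN_distrib2 Int ..
    moreover have "compactin ?T (\<Union>F\<in>\<F>. \<Union>G\<in>\<G>. ?b (F \<union> G))"
    proof (rule compactin_Union)
      fix S
      assume "S \<in> (\<lambda>F. \<Union>G\<in>\<G>. ?b (F \<union> G)) ` \<F>"
      then obtain F where F: "F \<in> \<F>" "S = (\<Union>G\<in>\<G>. ?b (F \<union> G))"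
        by (rule imageE)
      show "compactin ?T S"
        unfolding F(2)
      proof (rule compactin_Union)
        fix S'
        assume "S' \<in> (\<lambda>G. ?b (F \<union> G)) ` \<G>"
        then obtain G where G: "G \<in> \<G>" "S' = ?b (F \<union> G)"
          by (rule imageE)
        show "compactin ?T S'"
          unfolding G(2) by (rule compact_basic) (use \<F>(2) \<G>(2) F(1) G(1) in auto)
      qed (use \<G>(1) in simp)
    qed (use \<F>(1) in simp)
    ultimately show ?thesis
      by simp
  qed
  moreover have "openin ?T = arbitrary union_of (\<lambda>U. openin ?T U \<and> compactin ?T U)"
  proof
    fix U
    show "openin ?T U = (arbitrary union_of (\<lambda>U. openin ?T U \<and> compactin ?T U)) U"
      unfolding arbitrary_union_of_alt
    proof
      assume U: "openin ?T U"
      show "\<forall>x\<in>U. \<exists>V. (openin ?T V \<and> compactin ?T V) \<and> x \<in> V \<and> V \<subseteq> U"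
      proof
        fix x
        assume "x \<in> U"
        from basic[OF U this] obtain F where F: "finite F" "F \<subseteq> \<S>" "x \<in> ?b F" "?b F \<subseteq> U"
          by auto
        then show "\<exists>V. (openin ?T V \<and> compactin ?T V) \<and> x \<in> V \<and> V \<subseteq> U"
          using openin_generated_finite_Inter[OF F(1,2)] compact_basic[OF F(1,2)]
          by (intro exI[of _ "?b F"]) auto
      qed
    next
      assume "\<forall>x\<in>U. \<exists>V. (openin ?T V \<and> compactin ?T V) \<and> x \<in> V \<and> V \<subseteq> U"
      then show "openin ?T U"
        by (subst openin_subopen) blast
    qed
  qed
  moreover have "\<exists>x\<in>C. Abstract_Topology.closure_of ?T {x} = C"
    if C: "closedin ?T C" "irreducible_in ?T C" "C \<noteq> {}" for C
  proof -
    have C_sub: "C \<subseteq> \<Union>\<S>"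
      using closedin_subset[OF C(1)] by simp
    \<comment> \<open>Otherwise finitely many closed complements of members of F cover C; by
      irreducibility C lies in one of them and misses a member that it should meet.\<close>
    have meet: "C \<inter> \<Inter>F \<noteq> {}" if F: "finite F" "F \<subseteq> \<S>" "\<And>s. s \<in> F \<Longrightarrow> s \<inter> C \<noteq> {}" for F
    proof
      assume "C \<inter> \<Inter>F = {}"
      have "C \<subseteq> \<Union>((\<lambda>s. \<Union>\<S> - s) ` F)"
      proof
        fix y
        assume "y \<in> C"
        then obtain s where "s \<in> F" "y \<notin> s"
          using \<open>C \<inter> \<Inter>F = {}\<close> by auto
        then show "y \<in> \<Union>((\<lambda>s. \<Union>\<S> - s) ` F)"
          using \<open>y \<in> C\<close> C_sub by auto
      qed
      moreover have "closedin ?T (\<Union>\<S> - s)" if "s \<in> F" for s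
        using that F(2) topology_generated_by_Basis[of s \<S>] closedin_diff[of ?T "topspace ?T" s]
        by (metis closedin_topspace subsetD topology_generated_by_topspace)
      ultimately have "\<exists>A\<in>(\<lambda>s. \<Union>\<S> - s) ` F. C \<subseteq> A"
        using F(1) by (intro irreducible_in_finite_Union[OF C(2,3)]) auto
      then show False
        using F(3) by blast
    qed
    \<comment> \<open>A generic point lies in every open set that meets C and in none that misses C.
      On the subbase these conditions are finitely satisfiable by \<open>meet\<close>.\<close>
    define \<A> where "\<A> = {s \<in> \<S>. s \<inter> C \<noteq> {}}"
    have "\<exists>x\<in>\<Union>\<S>. x \<in> \<Inter>\<A> \<and> x \<notin> \<Union>(\<S> - \<A>)"
    proof (rule patch_compact)
      fix F G
      assume "finite F" "F \<subseteq> \<A>" and G: "G \<subseteq> \<S> - \<A>"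
      then have "C \<inter> \<Inter>F \<noteq> {}"
        by (intro meet) (auto simp: \<A>_def)
      then show "\<exists>x\<in>\<Union>\<S>. x \<in> \<Inter>F \<and> x \<notin> \<Union>G"
        using C_sub G unfolding \<A>_def by blast
    qed (auto simp: \<A>_def)
    then obtain x where x: "x \<in> \<Union>\<S>" "x \<in> \<Inter>\<A>" "x \<notin> \<Union>(\<S> - \<A>)"
      by blast
    \<comment> \<open>Otherwise some basic neighbourhood of x misses C. It is cut out by members of
      the subbase that contain x, hence meet C, and by \<open>meet\<close> they share a point with
      C.\<close>
    have "x \<in> C"
    proof (rule ccontr)
      assume "x \<notin> C"
      then obtain F where F: "finite F" "F \<subseteq> \<S>" "x \<in> ?b F" "?b F \<subseteq> \<Union>\<S> - C"
        using basic[of "\<Union>\<S> - C" x] C(1) x(1) by (auto simp: closedin_def)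
      then have "C \<inter> \<Inter>F \<noteq> {}"
        using x(3) by (intro meet) (auto simp: \<A>_def)
      then show False
        using F(4) C_sub by blast
    qed
    moreover have "Abstract_Topology.closure_of ?T {x} = C"
    proof
      show "Abstract_Topology.closure_of ?T {x} \<subseteq> C"
        using \<open>x \<in> C\<close> C(1) by (intro closure_of_minimal) auto
      show "C \<subseteq> Abstract_Topology.closure_of ?T {x}"
      proof
        fix y
        assume y: "y \<in> C"
        have "x \<in> U" if U: "y \<in> U" "openin ?T U" for U
        proof -
          obtain F where F: "F \<subseteq> \<S>" "y \<in> ?b F" "?b F \<subseteq> U"
            using basic[OF U(2,1)] by blast
          then have "F \<subseteq> \<A>"
            using y unfolding \<A>_def by blast
          then show ?thesis
            using F(3) x(1,2) by blast
        qed
        then show "y \<in> Abstract_Topology.closure_of ?T {x}"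
          using y C_sub by (auto simp: in_closure_of)
      qed
    qed
    ultimately show ?thesis
      by blast
  qed
  ultimately show ?thesis
    unfolding spectral_space_def by blast
qed


section \<open>Prime ideals of subrings of a field\<close>

lemma primeideal_subring_iff:
  fixes B :: "'k::field set"
  assumes B: "subring B ring_of_type_algebra"
  shows "primeideal P (ring_of_type_algebra\<lparr>carrier := B\<rparr>) \<longleftrightarrow>
    P \<subseteq> B \<and> 0 \<in> P \<and> (\<forall>x\<in>P. \<forall>y\<in>P. x + y \<in> P) \<and> (\<forall>b\<in>B. \<forall>x\<in>P. b * x \<in> P) \<and> 1 \<notin> P \<and>
    (\<forall>a\<in>B. \<forall>b\<in>B. a * b \<in> P \<longrightarrow> a \<in> P \<or> b \<in> P)" (is "?L \<longleftrightarrow> ?R")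
proof -
  let ?Q = "ring_of_type_algebra\<lparr>carrier := B\<rparr>"
  interpret K: ring "ring_of_type_algebra :: 'k ring"
    by (rule ring_from_type_algebra)
  interpret Q: ring ?Q
    by (rule K.subring_is_ring[OF B])
  have cring: "cring ?Q"
    by unfold_locales (simp add: mult.commute)
  have one: "1 \<in> B" and uminus: "\<And>x. x \<in> B \<Longrightarrow> - x \<in> B"
    using B unfolding subring_type_iff by auto
  show ?thesis
  proof
    assume ?L
    then interpret primeideal P ?Q .
    have "1 \<notin> P"
      using one_imp_carrier I_notcarr by auto
    then show ?R
      using a_subset zero_closed a_closed I_l_closed I_prime by auto
  next
    assume R: ?R
    have inv: "\<ominus>\<^bsub>?Q\<^esub> x = - x" if "x \<in> B" for x
      using Q.minus_equality[of "- x" x] that uminus by simp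
    have "subgroup P (add_monoid ?Q)"
    proof (rule Q.add.subgroupI)
      show "\<ominus>\<^bsub>?Q\<^esub> x \<in> P" if "x \<in> P" for x
      proof -
        have "- 1 * x \<in> P"
          using R that uminus[OF one] by blast
        then show ?thesis
          using R that inv[of x] by auto
      qed
    qed (use R in auto)
    moreover have "x * b \<in> P" if "x \<in> P" "b \<in> B" for x b
      using R that by (metis mult.commute)
    ultimately have "ideal P ?Q"
      by (intro idealI Q.ring_axioms) (use R in auto)
    then show ?L
      by (rule primeidealI[OF _ cring]) (use R one in auto)
  qed
qed

context valuation_ring
begin

lemma subring: "subring W ring_of_type_algebra"
  unfolding subring_type_iff using one_mem add_mem mult_mem uminus_mem by blast

text \<open>The condition \<open>\<not> vle x 1\<close> describes the maximal ideal of W, 0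
  included.\<close>

definition center :: "'k set \<Rightarrow> 'k set"
  where "center B = {x \<in> B. \<not> vle x 1}"

lemma primeideal_center:
  assumes B: "subring B ring_of_type_algebra" "B \<subseteq> W"
  shows "primeideal (center B) (ring_of_type_algebra\<lparr>carrier := B\<rparr>)"
proof -
  have ring: "0 \<in> B" "1 \<in> B" "\<And>x y. x \<in> B \<Longrightarrow> y \<in> B \<Longrightarrow> x + y \<in> B"
    "\<And>x y. x \<in> B \<Longrightarrow> y \<in> B \<Longrightarrow> x * y \<in> B"
    using B(1) subringE(2)[OF B(1)] unfolding subring_type_iff by auto
  have "\<not> vle (b * x) 1" if "b \<in> B" "\<not> vle x 1" for b x
    using vle_mult_mem[of b x x] that B(2) vle_trans by auto
  moreover have "vle (a * b) 1" if "vle a 1" "vle b 1" for a b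
    using vle_mult[OF that] by simp
  ultimately show ?thesis
    unfolding primeideal_subring_iff[OF B(1)] center_def
    using ring not_vle_add by auto
qed

end


section \<open>The Kronecker function ring\<close>

context graded_domain
begin

text \<open>With zero components set aside, V is only asked about quotients of homogeneous elements.
  This is why domination depends on nothing but the homogeneous part of V.\<close>

lemma dominated_iff_divide:
  assumes "0 \<in> V"
  shows "dominated V f g \<longleftrightarrow> (\<forall>p. poly_component f p \<noteq> 0 \<longrightarrow>
    (\<exists>q. poly_component g q \<noteq> 0 \<and>
      to_fract (poly_component f p) / to_fract (poly_component g q) \<in> V))"
proof -
  have "(\<exists>q. \<exists>z\<in>V. to_fract (poly_component f p) = z * to_fract (poly_component g q)) \<longleftrightarrow>
      (poly_component f p \<noteq> 0 \<longrightarrow> (\<exists>q. poly_component g q \<noteq> 0 \<and>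
        to_fract (poly_component f p) / to_fract (poly_component g q) \<in> V))" for p
  proof (cases "poly_component f p = 0")
    case True
    then show ?thesis
      using assms by auto
  next
    case False
    have "(\<exists>z\<in>V. to_fract (poly_component f p) = z * to_fract (poly_component g q)) \<longleftrightarrow>
        poly_component g q \<noteq> 0 \<and> to_fract (poly_component f p) / to_fract (poly_component g q) \<in> V" for q
      using False
      by (cases "poly_component g q = 0")
        (auto intro!: bexI[of _ "to_fract (poly_component f p) / to_fract (poly_component g q)"])
    then show ?thesis
      using False by simp
  qed
  then show ?thesis
    unfolding dominated_def by simp
qed

lemma divide_poly_component_homogeneous:
  "to_fract (poly_component f p) / to_fract (poly_component g q) \<in> homogeneous_fractions R"
  by (intro homogeneous_fractions_divide to_fract_homogeneous_fractions[OF poly_component_mem])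

lemma dominated_cong:
  assumes eq: "V \<inter> homogeneous_fractions R = V' \<inter> homogeneous_fractions R" and zero: "0 \<in> V"
  shows "dominated V = dominated V'"
proof (rule ext)+
  fix f g
  have iff: "x \<in> V \<longleftrightarrow> x \<in> V'" if "x \<in> homogeneous_fractions R" for x
    using eq that by blast
  have zero': "0 \<in> V'"
    using iff zero zero_homogeneous_fractions by blast
  show "dominated V f g = dominated V' f g"
    unfolding dominated_iff_divide[OF zero] dominated_iff_divide[OF zero']
      iff[OF divide_poly_component_homogeneous] ..
qed

lemma dominatedI:
  assumes "0 \<in> V" "1 \<in> V"
    and "\<And>p. poly_component f p \<noteq> 0 \<Longrightarrow> \<exists>q. poly_component g q = poly_component f p"
  shows "dominated V f g"
  unfolding dominated_iff_divide[OF assms(1)]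
proof (intro allI impI)
  fix p
  assume p: "poly_component f p \<noteq> 0"
  then obtain q where "poly_component g q = poly_component f p"
    using assms(3) by blast
  then show "\<exists>q. poly_component g q \<noteq> 0 \<and>
      to_fract (poly_component f p) / to_fract (poly_component g q) \<in> V"
    using p assms(2) by (intro exI[of _ q]) simp
qed

lemma poly_component_const:
  assumes "a \<in> R \<alpha>"
  shows "poly_component [:a:] p = (if p = (0, \<alpha>) then a else 0)"
  using homogeneous_component_homogeneous[OF assms]
  by (cases p; cases "fst p") (auto simp: poly_component_def)

lemma poly_component_linear:
  assumes "a \<in> R \<alpha>" "b \<in> R \<beta>"
  shows "poly_component [:a, b:] p = (if p = (0, \<alpha>) then a else if p = (1, \<beta>) then b else 0)"
  using homogeneous_component_homogeneous[OF assms(1)] homogeneous_component_homogeneous[OF assms(2)]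
  by (cases p; cases "fst p"; cases "fst p - 1") (auto simp: poly_component_def)

end

context torsionless_graded_domain
begin

abbreviation Kr :: "'a poly fract set"
  where "Kr \<equiv> Kr_h R b_operation"

lemma Fract_in_Kr_iff:
  assumes "g \<noteq> 0"
  shows "Fract f g \<in> Kr \<longleftrightarrow> (\<forall>W. valuation_overring W \<longrightarrow> dominated W f g)"
  unfolding Kr_h_eq_Inter
  using torsionless_graded_valuation.Fract_in_kronecker_extension_iff
    [OF valuation_overring_interpretation assms] by blast

text \<open>If the components of f reappear in g, domination holds over every W. All genuine
  fractions that the proof needs in the Kronecker function ring are obtained in this way.\<close>

lemma Fract_in_KrI:
  assumes "g \<noteq> 0" "\<And>p. poly_component f p \<noteq> 0 \<Longrightarrow> \<exists>q. poly_component g q = poly_component f p"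
  shows "Fract f g \<in> Kr"
  unfolding Fract_in_Kr_iff[OF assms(1)]
proof (intro allI impI)
  fix W :: "'a fract set"
  assume "valuation_overring W"
  then interpret valuation_ring W
    unfolding valuation_overring_iff by blast
  show "dominated W f g"
    by (rule dominatedI[OF zero_mem one_mem assms(2)])
qed

lemma subring_Kr: "subring Kr ring_of_type_algebra"
proof -
  have val: "valuation_ring (kronecker_extension W)" if "valuation_overring W" for W
    by (rule torsionless_graded_valuation.valuation_ring_kronecker_extension
        [OF valuation_overring_interpretation[OF that]])
  show ?thesis
    unfolding subring_type_iff Kr_h_eq_Inter
    using valuation_ring.one_mem[OF val] valuation_ring.add_mem[OF val]
      valuation_ring.mult_mem[OF val] valuation_ring.uminus_mem[OF val] by auto
qed

text \<open>The extension is built from \<open>dominated\<close>, which sees only homogeneous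
  elements; so V may be replaced by a valuation overring with the same ones, to which Gauss's lemma
  applies.\<close>

lemma Zar_h_kronecker_extension:
  assumes V: "V \<in> Zar_h R"
  shows "valuation_ring (kronecker_extension V)"
    and "Kr \<subseteq> kronecker_extension V"
    and "\<And>f g. g \<noteq> 0 \<Longrightarrow> Fract f g \<in> kronecker_extension V \<longleftrightarrow> dominated V f g"
    and "0 \<in> V"
proof -
  obtain W where W: "valuation_overring W" "W \<inter> homogeneous_fractions R = V \<inter> homogeneous_fractions R"
    using Zar_h_extension[OF V] .
  interpret torsionless_graded_valuation R W
    by (rule valuation_overring_interpretation[OF W(1)])
  have eq: "dominated V = dominated W"
    by (rule dominated_cong[OF W(2) zero_mem, symmetric])
  have ext: "kronecker_extension V = kronecker_extension W"
    unfolding kronecker_extension_def eq ..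
  show "valuation_ring (kronecker_extension V)"
    unfolding ext by (rule valuation_ring_kronecker_extension)
  show "Kr \<subseteq> kronecker_extension V"
    unfolding ext Kr_h_eq_Inter using W(1) by blast
  show "Fract f g \<in> kronecker_extension V \<longleftrightarrow> dominated V f g" if "g \<noteq> 0" for f g
    unfolding ext eq by (rule Fract_in_kronecker_extension_iff[OF that])
  show "0 \<in> V"
    using W(2) zero_mem zero_homogeneous_fractions by blast
qed

definition prime_of :: "'a fract set \<Rightarrow> 'a poly fract set"
  where "prime_of V = valuation_ring.center (kronecker_extension V) Kr"

lemma primeideal_prime_of:
  assumes "V \<in> Zar_h R"
  shows "primeideal (prime_of V) (ring_of_type_algebra\<lparr>carrier := Kr\<rparr>)"
  unfolding prime_of_def
  using valuation_ring.primeideal_center[OF _ subring_Kr] Zar_h_kronecker_extension[OF assms] by blast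

lemma Fract_in_prime_of_iff:
  assumes V: "V \<in> Zar_h R" and g: "g \<noteq> 0" and Kr: "Fract f g \<in> Kr"
  shows "Fract f g \<in> prime_of V \<longleftrightarrow> \<not> dominated V g f"
proof -
  note ext = Zar_h_kronecker_extension[OF V]
  interpret valuation_ring "kronecker_extension V"
    by (rule ext(1))
  show ?thesis
  proof (cases "f = 0")
    \<comment> \<open>The test by inverses fails for 0, because \<open>inverse 0 = 0\<close> lies in
      the extension. But 0 is in the center, and a nonzero g is not dominated by 0.\<close>
    case True
    have "\<not> dominated V g 0"
      using g poly_component_eq_0_iff[of g] by (auto simp: dominated_iff_divide[OF ext(4)])
    then show ?thesis
      using Kr True by (simp add: prime_of_def center_def fract_collapse)
  next
    case False
    then have "Fract f g \<noteq> 0"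
      using g by (simp add: Zero_fract_def eq_fract)
    then show ?thesis
      using Kr ext(3)[OF False, of g] by (simp add: prime_of_def center_def vle_1_right)
  qed
qed

lemma linear_fraction_in_Kr:
  assumes "a \<in> R \<alpha>" "b \<in> R \<beta>" "b \<noteq> 0"
  shows "Fract [:b:] [:a, b:] \<in> Kr"
proof (rule Fract_in_KrI)
  fix p
  assume "poly_component [:b:] p \<noteq> 0"
  then have "poly_component [:b:] p = b"
    by (simp add: poly_component_const[OF assms(2)] split: if_splits)
  moreover have "poly_component [:a, b:] (1, \<beta>) = b"
    by (simp add: poly_component_linear[OF assms(1,2)])
  ultimately show "\<exists>q. poly_component [:a, b:] q = poly_component [:b:] p"
    by metis
qed (use assms(3) in simp)

text \<open>The fraction stays outside the center iff its inverse (a + b X) / b is in the extension,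
  that is, iff both components a and b of the numerator are multiples of b over V. Only the
  condition on a is a restriction.\<close>

lemma Fract_mem_iff_prime_of:
  assumes V: "V \<in> Zar_h R" and ab: "a \<in> R \<alpha>" "b \<in> R \<beta>" "b \<noteq> 0"
  shows "Fract a b \<in> V \<longleftrightarrow> Fract [:b:] [:a, b:] \<notin> prime_of V"
proof -
  obtain W where W: "valuation_overring W" "W \<inter> homogeneous_fractions R = V \<inter> homogeneous_fractions R"
    using Zar_h_extension[OF V] .
  interpret torsionless_graded_valuation R W
    by (rule valuation_overring_interpretation[OF W(1)])
  have zero: "0 \<in> V" and one: "1 \<in> V"
    using W(2) zero_mem zero_homogeneous_fractions one_mem one_homogeneous_fractions by blast+
  have b_comp: "poly_component [:b:] p = b \<or> poly_component [:b:] p = 0" for p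
    by (simp add: poly_component_const[OF ab(2)])
  have b_at: "poly_component [:b:] (0, \<beta>) = b"
    by (simp add: poly_component_const[OF ab(2)])
  have div: "Fract a b = to_fract a / to_fract b"
    using ab(3) by (simp add: to_fract_def)
  have "dominated V [:a, b:] [:b:] \<longleftrightarrow> Fract a b \<in> V"
  proof
    assume *: "dominated V [:a, b:] [:b:]"
    show "Fract a b \<in> V"
    proof (cases "a = 0")
      case True
      then show ?thesis
        using zero by (simp add: fract_collapse)
    next
      case False
      have "poly_component [:a, b:] (0, \<alpha>) = a"
        by (simp add: poly_component_linear[OF ab(1,2)])
      then obtain q where "poly_component [:b:] q \<noteq> 0" "to_fract a / to_fract (poly_component [:b:] q) \<in> V"
        using * False unfolding dominated_iff_divide[OF zero] by metis
      then show ?thesis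
        using b_comp[of q] div by auto
    qed
  next
    assume *: "Fract a b \<in> V"
    show "dominated V [:a, b:] [:b:]"
      unfolding dominated_iff_divide[OF zero]
    proof (intro allI impI exI conjI)
      fix p
      assume "poly_component [:a, b:] p \<noteq> 0"
      then have "poly_component [:a, b:] p \<in> {a, b}"
        by (simp add: poly_component_linear[OF ab(1,2)] split: if_splits)
      then show "to_fract (poly_component [:a, b:] p) / to_fract (poly_component [:b:] (0, \<beta>)) \<in> V"
        using * ab(3) one div unfolding b_at by auto
      show "poly_component [:b:] (0, \<beta>) \<noteq> 0"
        unfolding b_at by (rule ab(3))
    qed
  qed
  moreover have "[:a, b:] \<noteq> 0"
    using ab(3) by simp
  ultimately show ?thesis
    using Fract_in_prime_of_iff[OF V _ linear_fraction_in_Kr[OF ab]] by simp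
qed

end

section \<open>Every prime of the Kronecker function ring is the center of a graded valuation\<close>

definition prime_localization :: "'k::field set \<Rightarrow> 'k set \<Rightarrow> 'k set"
  where "prime_localization B P = {r / s | r s. r \<in> B \<and> s \<in> B - P}"

text \<open>The center is P because \<open>inverse x = r / s\<close> with s outside P gives
  \<open>s = r * x\<close>, which keeps x out of P.\<close>

lemma prime_localization_valuation_ring:
  fixes B :: "'k::field set"
  assumes B: "subring B ring_of_type_algebra"
    and P: "primeideal P (ring_of_type_algebra\<lparr>carrier := B\<rparr>)"
    and total: "\<And>x. x \<in> prime_localization B P \<or> inverse x \<in> prime_localization B P"
  shows "valuation_ring (prime_localization B P)"
    and "B \<subseteq> prime_localization B P"
    and "valuation_ring.center (prime_localization B P) B = P"
proof -
  let ?L = "prime_localization B P"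
  have ring: "1 \<in> B" "\<And>x y. x \<in> B \<Longrightarrow> y \<in> B \<Longrightarrow> x + y \<in> B"
    "\<And>x y. x \<in> B \<Longrightarrow> y \<in> B \<Longrightarrow> x * y \<in> B" "\<And>x. x \<in> B \<Longrightarrow> - x \<in> B"
    using B unfolding subring_type_iff by auto
  have prime: "P \<subseteq> B" "0 \<in> P" "\<And>b x. b \<in> B \<Longrightarrow> x \<in> P \<Longrightarrow> b * x \<in> P" "1 \<notin> P"
    "\<And>a b. a \<in> B \<Longrightarrow> b \<in> B \<Longrightarrow> a * b \<in> P \<Longrightarrow> a \<in> P \<or> b \<in> P"
    using P unfolding primeideal_subring_iff[OF B] by auto
  have LI: "r / s \<in> ?L" if "r \<in> B" "s \<in> B" "s \<notin> P" for r s
    unfolding prime_localization_def using that by blast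
  have LE: "\<exists>r s. x = r / s \<and> r \<in> B \<and> s \<in> B \<and> s \<notin> P \<and> s \<noteq> 0" if "x \<in> ?L" for x
    using that prime(2) unfolding prime_localization_def by blast
  show "B \<subseteq> ?L"
    using LI[OF _ ring(1) prime(4)] by auto
  show val: "valuation_ring ?L"
  proof
    show "1 \<in> ?L"
      using \<open>B \<subseteq> ?L\<close> ring(1) by blast
  next
    fix x y
    assume "x \<in> ?L" "y \<in> ?L"
    then obtain r s r' s' where x: "x = r / s" "r \<in> B" "s \<in> B" "s \<notin> P" "s \<noteq> 0"
      and y: "y = r' / s'" "r' \<in> B" "s' \<in> B" "s' \<notin> P" "s' \<noteq> 0"
      using LE by metis
    have ss: "s * s' \<in> B" "s * s' \<notin> P"
      using x y ring(3) prime(5) by blast+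
    have "x + y = (r * s' + r' * s) / (s * s')"
      using x y by (simp add: field_simps)
    then show "x + y \<in> ?L"
      using LI[OF _ ss] x y ring by simp
    have "x * y = (r * r') / (s * s')"
      using x y by simp
    then show "x * y \<in> ?L"
      using LI[OF _ ss] x y ring by simp
  next
    fix x
    assume "x \<in> ?L"
    then obtain r s where x: "x = r / s" "r \<in> B" "s \<in> B" "s \<notin> P"
      using LE by blast
    then have "- x = (- r) / s"
      by simp
    then show "- x \<in> ?L"
      using LI[OF ring(4)[OF x(2)] x(3,4)] by simp
  qed (rule total)
  interpret valuation_ring ?L
    by (rule val)
  have "vle x 1 \<longleftrightarrow> x \<notin> P" if x: "x \<in> B" for x
  proof
    assume *: "vle x 1"
    then have "x \<noteq> 0"
      by auto
    then obtain r s where rs: "inverse x = r / s" "r \<in> B" "s \<in> B" "s \<notin> P" "s \<noteq> 0"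
      using LE vle_1_right * by blast
    have "s = r * x"
      using rs(1,5) \<open>x \<noteq> 0\<close> by (simp add: field_simps)
    then show "x \<notin> P"
      using rs prime(3) by blast
  next
    assume "x \<notin> P"
    then have "x \<noteq> 0" "inverse x \<in> ?L"
      using prime(2) LI[OF ring(1) x] by (auto simp: inverse_eq_divide)
    then show "vle x 1"
      by (simp add: vle_1_right)
  qed
  then show "center B = P"
    unfolding center_def using prime(1) by blast
qed

section \<open>The embedding of K into K(X)\<close>

definition const_fract :: "'a::idom fract \<Rightarrow> 'a poly fract"
  where "const_fract x = (SOME y. \<exists>a b. b \<noteq> 0 \<and> x = Fract a b \<and> y = Fract [:a:] [:b:])"

text \<open>The fraction a / b behind \<open>const_fract\<close> is selected by choice;
  cross-multiplication shows that all representations give the same value.\<close>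

lemma const_fract_Fract:
  assumes "b \<noteq> 0"
  shows "const_fract (Fract a b) = Fract [:a:] [:b:]"
proof -
  have "\<exists>a' b'. b' \<noteq> 0 \<and> Fract a b = Fract a' b' \<and> const_fract (Fract a b) = Fract [:a':] [:b':]"
    unfolding const_fract_def by (rule someI[of _ "Fract [:a:] [:b:]"]) (use assms in blast)
  then obtain a' b' where "b' \<noteq> 0" "Fract a b = Fract a' b'"
    "const_fract (Fract a b) = Fract [:a':] [:b':]"
    by blast
  then show ?thesis
    using assms by (simp add: eq_fract mult.commute)
qed

lemma const_fract_add: "const_fract (x + y) = const_fract x + const_fract y"
  by (cases x; cases y) (simp add: const_fract_Fract mult.commute)

lemma const_fract_mult: "const_fract (x * y) = const_fract x * const_fract y"
  by (cases x; cases y) (simp add: const_fract_Fract mult.commute)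

lemma const_fract_to_fract: "const_fract (to_fract a) = Fract [:a:] 1"
  by (simp add: to_fract_def const_fract_Fract one_pCons)

lemma const_fract_1: "const_fract 1 = 1"
  using const_fract_to_fract[of 1] by (simp add: One_fract_def one_pCons)

lemma const_fract_uminus: "const_fract (- x) = - const_fract x"
  by (cases x) (simp add: const_fract_Fract)

lemma const_fract_inverse: "const_fract (inverse x) = inverse (const_fract x)"
proof (cases x)
  case (Fract a b)
  then show ?thesis
    by (cases "a = 0") (simp_all add: const_fract_Fract fract_collapse const_fract_to_fract[of 0, simplified])
qed


context torsionless_graded_domain
begin

text \<open>The components of f lie in R and so in every W, while 1 is a component of the polynomial
  1.\<close>

lemma poly_in_Kr: "Fract f 1 \<in> Kr"
  unfolding Fract_in_Kr_iff[OF one_neq_zero]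
proof (intro allI impI)
  fix W :: "'a fract set"
  assume W: "valuation_overring W"
  then interpret torsionless_graded_valuation R W
    by (rule valuation_overring_interpretation)
  have one: "poly_component 1 (0, 0) = 1"
    using poly_component_const[OF one_component, of "(0, 0)"] by (simp add: one_pCons)
  show "dominated W f 1"
    unfolding dominated_iff_divide[OF zero_mem]
    by (intro allI impI exI[of _ "(0, 0)"]) (simp add: one to_fract_mem)
qed

text \<open>
  In \<open>K(X)\<close> every \<open>f / g\<close> is a quotient of the elements \<open>f / k\<close> and \<open>g / k\<close> of the Kronecker function
  ring, where \<open>k = f + X\<^sup>n g\<close> and \<open>n\<close> exceeds the degree of \<open>f\<close>; these generate the unit ideal.
\<close>

lemma prime_localization_Kr_total:
  assumes P: "primeideal P (ring_of_type_algebra\<lparr>carrier := Kr\<rparr>)"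
  shows "x \<in> prime_localization Kr P \<or> inverse x \<in> prime_localization Kr P"
proof -
  have prime: "0 \<in> P" "\<And>x y. x \<in> P \<Longrightarrow> y \<in> P \<Longrightarrow> x + y \<in> P"
    "\<And>b x. b \<in> Kr \<Longrightarrow> x \<in> P \<Longrightarrow> b * x \<in> P" "1 \<notin> P"
    using P unfolding primeideal_subring_iff[OF subring_Kr] by auto
  have LI: "r / s \<in> prime_localization Kr P" if "r \<in> Kr" "s \<in> Kr" "s \<notin> P" for r s
    unfolding prime_localization_def using that by blast
  obtain f g where x: "x = Fract f g" "g \<noteq> 0"
    by (cases x)
  show ?thesis
  proof (cases "f = 0")
    case True
    then show ?thesis
      using x LI[OF poly_in_Kr[of 0] poly_in_Kr[of 1]] prime(4)
      by (simp add: fract_collapse flip: One_fract_def)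
  next
    case False
    define n where "n = Suc (Polynomial.degree f)"
    define k where "k = f + Polynomial.monom 1 n * g"
    have coeff_k: "Polynomial.coeff k i =
        Polynomial.coeff f i + (if n \<le> i then Polynomial.coeff g (i - n) else 0)" for i
      unfolding k_def by (simp add: coeff_monom_mult)
    \<comment> \<open>The shift by n moves the coefficients of g past those of f, so the components
      of both occur unchanged in k and nothing cancels.\<close>
    have f_k: "poly_component k p = poly_component f p" if "poly_component f p \<noteq> 0" for p
    proof -
      have "fst p \<le> Polynomial.degree f"
        using that by (intro le_degree) (auto simp: poly_component_def)
      then show ?thesis
        unfolding poly_component_def by (simp add: coeff_k n_def)
    qed
    have g_k: "poly_component k (n + fst p, snd p) = poly_component g p" for p
      unfolding poly_component_def by (simp add: coeff_k n_def coeff_eq_0)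
    have k: "k \<noteq> 0"
      using False f_k poly_component_eq_0_iff[of f] by auto
    have r: "Fract f k \<in> Kr"
      using f_k by (intro Fract_in_KrI k) blast
    have s: "Fract g k \<in> Kr"
      using g_k by (intro Fract_in_KrI k) blast
    have "Fract f k + Fract (Polynomial.monom 1 n) 1 * Fract g k =
        Fract (f * k + Polynomial.monom 1 n * g * k) (k * k)"
      using k by simp
    also have "f * k + Polynomial.monom 1 n * g * k = k * k"
      by (simp add: k_def algebra_simps)
    also have "Fract (k * k) (k * k) = 1"
      using k by (simp add: One_fract_def eq_fract)
    finally have "Fract f k \<notin> P \<or> Fract g k \<notin> P"
      using prime(2-4) poly_in_Kr[of "Polynomial.monom 1 n"] by metis
    moreover have "x = Fract f k / Fract g k" "inverse x = Fract g k / Fract f k"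
      using x k False by (simp_all add: eq_fract mult.commute)
    ultimately show ?thesis
      using LI[OF r s] LI[OF s r] by auto
  qed
qed

theorem exists_prime_of:
  assumes P: "primeideal P (ring_of_type_algebra\<lparr>carrier := Kr\<rparr>)"
  obtains V where "V \<in> Zar_h R" "prime_of V = P"
proof -
  define L where "L = prime_localization Kr P"
  note L = prime_localization_valuation_ring[OF subring_Kr P prime_localization_Kr_total[OF P],
      folded L_def]
  interpret L: valuation_ring L
    by (rule L(1))
  define W where "W = {y. const_fract y \<in> L}"
  have "valuation_ring W"
  proof
    show "1 \<in> W"
      unfolding W_def by (simp add: const_fract_1 L.one_mem)
    show "x + y \<in> W" "x * y \<in> W" if "x \<in> W" "y \<in> W" for x y
      using that unfolding W_def by (simp_all add: const_fract_add const_fract_mult L.add_mem L.mult_mem)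
    show "- x \<in> W" if "x \<in> W" for x
      using that unfolding W_def by (simp add: const_fract_uminus L.uminus_mem)
    show "x \<in> W \<or> inverse x \<in> W" for x
      unfolding W_def using L.total by (simp add: const_fract_inverse)
  qed
  moreover have "range to_fract \<subseteq> W"
    unfolding W_def using poly_in_Kr L(2) by (auto simp: const_fract_to_fract)
  ultimately have W: "valuation_overring W"
    unfolding valuation_overring_iff by blast
  interpret torsionless_graded_valuation R W
    by (rule valuation_overring_interpretation[OF W])
  \<comment> \<open>A component w of least value is associated to f in L: w / f is in the Kronecker
    function ring since w occurs in f, and f / w is a sum of powers of X with coefficients in the
    trace of L.\<close>
  have content_unit: "Fract f [:poly_component f p:] \<in> L" "Fract [:poly_component f p:] f \<in> L"
    "poly_component f p \<noteq> 0"
    if f: "f \<noteq> 0" and p: "has_content f (to_fract (poly_component f p))" for f p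
  proof -
    let ?w = "poly_component f p"
    show w: "?w \<noteq> 0"
      using content_eq_0_iff[OF p] f by simp
    have "Fract [:?w:] f \<in> Kr"
    proof (rule Fract_in_KrI[OF f])
      fix q
      assume "poly_component [:?w:] q \<noteq> 0"
      then have "poly_component [:?w:] q = ?w"
        unfolding poly_component_const[OF poly_component_mem] by (simp split: if_splits)
      then show "\<exists>q'. poly_component f q' = poly_component [:?w:] q"
        by metis
    qed
    then show "Fract [:?w:] f \<in> L"
      using L(2) by blast
    have Fract_sum: "Fract (sum s S) [:?w:] = (\<Sum>i\<in>S. Fract (s i) [:?w:])" for S and s :: "nat \<times> 'g \<Rightarrow> 'a poly"
    proof (induction S rule: infinite_finite_induct)
      case (insert i S)
      have "Fract (s i + sum s S) [:?w:] = Fract (s i) [:?w:] + Fract (sum s S) [:?w:]"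
        using w by (simp add: eq_fract smult_add_right)
      then show ?case
        using insert by simp
    qed (simp_all add: fract_collapse)
    have "Fract f [:?w:] =
        (\<Sum>q\<in>support f. Fract (Polynomial.monom (poly_component f q) (fst q)) [:?w:])"
      unfolding Fract_sum[symmetric] poly_eq_sum_monom[of f, symmetric] ..
    also have "\<dots> \<in> L"
    proof -
      have "Fract (Polynomial.monom (poly_component f q) (fst q)) [:?w:] \<in> L" for q
      proof -
        have "to_fract (poly_component f q) / to_fract ?w \<in> W"
          using p w vle_iff_divide[of "to_fract ?w" "to_fract (poly_component f q)"]
          unfolding has_content_def to_fract_eq_0_iff by blast
        then have "Fract [:poly_component f q:] [:?w:] \<in> L"
          using w unfolding W_def by (simp add: to_fract_def const_fract_Fract)
        moreover have "Fract (Polynomial.monom 1 (fst q)) 1 \<in> L"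
          using poly_in_Kr L(2) by blast
        ultimately have "Fract [:poly_component f q:] [:?w:] * Fract (Polynomial.monom 1 (fst q)) 1 \<in> L"
          by (rule L.mult_mem)
        then show ?thesis
          by (simp add: smult_monom)
      qed
      then have "L.vle 1 (\<Sum>q\<in>support f. Fract (Polynomial.monom (poly_component f q) (fst q)) [:?w:])"
        by (intro L.vle_sum) (simp add: L.vle_1_left)
      then show ?thesis
        by (simp add: L.vle_1_left)
    qed
    finally show "Fract f [:?w:] \<in> L" .
  qed
  \<comment> \<open>Replacing f and g by associated constants turns membership in L into a question
    about a quotient in K, that is, about W.\<close>
  have L_iff: "Fract f g \<in> L \<longleftrightarrow> dominated W f g" if f: "f \<noteq> 0" and g: "g \<noteq> 0" for f g
  proof -
    obtain p q where p: "has_content f (to_fract (poly_component f p))"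
      and q: "has_content g (to_fract (poly_component g q))"
      using exists_content by metis
    let ?u = "poly_component f p" and ?v = "poly_component g q"
    note u = content_unit[OF f p] and v = content_unit[OF g q]
    have "Fract f g \<in> L \<longleftrightarrow> Fract [:?u:] [:?v:] \<in> L"
    proof
      assume "Fract f g \<in> L"
      then have "Fract [:?u:] f * Fract f g * Fract g [:?v:] \<in> L"
        using u(2) v(1) by (intro L.mult_mem)
      moreover have "Fract [:?u:] f * Fract f g * Fract g [:?v:] = Fract [:?u:] [:?v:]"
        using f g v(3) by (simp add: eq_fract)
      ultimately show "Fract [:?u:] [:?v:] \<in> L"
        by metis
    next
      assume "Fract [:?u:] [:?v:] \<in> L"
      then have "Fract f [:?u:] * Fract [:?u:] [:?v:] * Fract [:?v:] g \<in> L"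
        using u(1) v(2) by (intro L.mult_mem)
      moreover have "Fract f [:?u:] * Fract [:?u:] [:?v:] * Fract [:?v:] g = Fract f g"
        using g u(3) v(3) by (simp add: eq_fract)
      ultimately show "Fract f g \<in> L"
        by metis
    qed
    also have "\<dots> \<longleftrightarrow> to_fract ?u / to_fract ?v \<in> W"
      using v(3) unfolding W_def by (simp add: to_fract_def const_fract_Fract)
    also have "\<dots> \<longleftrightarrow> dominated W f g"
      using v(3) by (simp add: dominated_iff_content[OF p q] vle_iff_divide)
    finally show ?thesis .
  qed
  let ?V = "graded_core W"
  note V = graded_core_in_Zar_h[OF W]
  note ext = Zar_h_kronecker_extension[OF V(1)]
  \<comment> \<open>W and its graded core have the same homogeneous elements, hence the same
    domination relation. As \<open>L_iff\<close> requires a nonzero numerator, 0 is treated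
    apart.\<close>
  have "x \<in> kronecker_extension ?V \<longleftrightarrow> x \<in> L" for x
  proof (cases x)
    case (Fract f g)
    show ?thesis
    proof (cases "f = 0")
      case True
      then have "x = 0"
        by (simp add: Fract(1) fract_collapse)
      then show ?thesis
        using L.zero_mem valuation_ring.zero_mem[OF ext(1)] by simp
    next
      case False
      show ?thesis
        unfolding Fract(1) ext(3)[OF Fract(2)] L_iff[OF False Fract(2)] dominated_cong[OF V(2) ext(4)] ..
    qed
  qed
  then have "kronecker_extension ?V = L"
    by blast
  then have "prime_of ?V = P"
    unfolding prime_of_def by (simp add: L(3))
  then show ?thesis
    using that V(1) by blast
qed


section \<open>The homeomorphism\<close>

abbreviation Zar_basic :: "'a fract \<Rightarrow> 'a fract set set"
  where "Zar_basic u \<equiv> {V \<in> Zar_h R. u \<in> V}"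

text \<open>The subbasic set belonging to u = 0 is already the whole space.\<close>

lemma topspace_Zar_h: "topspace (Zar_h_topology R) = Zar_h R"
proof -
  have "\<Union>(Zar_basic ` homogeneous_fractions R) = Zar_h R"
    using zero_homogeneous_fractions Zar_h_kronecker_extension(4) by blast
  then show ?thesis
    unfolding Zar_h_topology_def by simp
qed

lemma openin_Zar_basic: "u \<in> homogeneous_fractions R \<Longrightarrow> openin (Zar_h_topology R) (Zar_basic u)"
  unfolding Zar_h_topology_def by (intro topology_generated_by_Basis imageI)

lemma openin_finite_Ball:
  assumes "finite F" "\<And>p. p \<in> F \<Longrightarrow> openin T {x \<in> topspace T. Q p x}"
  shows "openin T {x \<in> topspace T. \<forall>p\<in>F. Q p x}"
  using assms
proof (induction F)
  case (insert p F)
  then have "openin T ({x \<in> topspace T. Q p x} \<inter> {x \<in> topspace T. \<forall>p\<in>F. Q p x})"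
    by (intro openin_Int) auto
  also have "{x \<in> topspace T. Q p x} \<inter> {x \<in> topspace T. \<forall>p\<in>F. Q p x} =
      {x \<in> topspace T. \<forall>p\<in>insert p F. Q p x}"
    by auto
  finally show ?case .
qed simp

text \<open>Domination is an intersection, over the support of g, of unions of subbasic sets; the
  support is finite, so the intersection is open.\<close>

lemma openin_dominated: "openin (Zar_h_topology R) {V \<in> Zar_h R. dominated V g f}"
proof -
  let ?Q = "\<lambda>p V. \<exists>q\<in>support f. to_fract (poly_component g p) / to_fract (poly_component f q) \<in> V"
  have "openin (Zar_h_topology R) {V \<in> topspace (Zar_h_topology R). \<forall>p\<in>support g. ?Q p V}"
  proof (rule openin_finite_Ball[OF finite_support])
    fix p
    have "openin (Zar_h_topology R)
        (\<Union>q\<in>support f. Zar_basic (to_fract (poly_component g p) / to_fract (poly_component f q)))"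
      by (rule openin_Union) (auto intro: openin_Zar_basic divide_poly_component_homogeneous)
    also have "(\<Union>q\<in>support f. Zar_basic (to_fract (poly_component g p) / to_fract (poly_component f q))) =
        {V \<in> topspace (Zar_h_topology R). ?Q p V}"
      unfolding topspace_Zar_h by blast
    finally show "openin (Zar_h_topology R) {V \<in> topspace (Zar_h_topology R). ?Q p V}" .
  qed
  also have "{V \<in> topspace (Zar_h_topology R). \<forall>p\<in>support g. ?Q p V} = {V \<in> Zar_h R. dominated V g f}"
    unfolding topspace_Zar_h using dominated_iff_divide[OF Zar_h_kronecker_extension(4)] by auto
  finally show ?thesis .
qed

lemma inj_on_prime_of: "inj_on prime_of (Zar_h R)"
proof (rule inj_onI)
  fix V V'
  assume V: "V \<in> Zar_h R" "V' \<in> Zar_h R" and eq: "prime_of V = prime_of V'"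
  have "u \<in> V \<longleftrightarrow> u \<in> V'" if mem: "u \<in> homogeneous_fractions R" for u
  proof -
    obtain a b \<beta> \<gamma> where u: "u = Fract a b" "a \<in> R \<beta>" "b \<in> R \<gamma>" "b \<noteq> 0"
      using homogeneous_fractionsE[OF mem] by blast
    show ?thesis
      unfolding u(1) Fract_mem_iff_prime_of[OF V(1) u(2-4)] Fract_mem_iff_prime_of[OF V(2) u(2-4)] eq ..
  qed
  then show "V = V'"
    by (intro Zar_h_eqI[OF V]) blast
qed

abbreviation Kr_ring :: "'a poly fract ring"
  where "Kr_ring \<equiv> ring_of_type_algebra\<lparr>carrier := Kr\<rparr>"

lemma prime_of_image: "prime_of ` Zar_h R = Spec Kr_ring"
  unfolding Spec_def using primeideal_prime_of exists_prime_of by (auto; blast)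

lemma topspace_Spec: "topspace (Spec_topology Q) = Spec Q"
proof
  show "topspace (Spec_topology Q) \<subseteq> Spec Q"
    using openin_topspace[of "Spec_topology Q"] unfolding openin_Spec_topology by blast
  have "P \<noteq> carrier Q" "P \<subseteq> carrier Q" if "P \<in> Spec Q" for P
  proof -
    interpret primeideal P Q
      using that by (simp add: Spec_def)
    show "P \<noteq> carrier Q" "P \<subseteq> carrier Q"
      using I_notcarr a_subset by auto
  qed
  \<comment> \<open>The whole carrier is taken as the defining set: no prime ideal contains
    it.\<close>
  then have "openin (Spec_topology Q) (Spec Q)"
    unfolding openin_Spec_topology by (intro exI[of _ "carrier Q"]) blast
  then show "Spec Q \<subseteq> topspace (Spec_topology Q)"
    by (rule openin_subset)
qed

theorem homeomorphic_Zar_h_Spec: "Zar_h_topology R homeomorphic_space Spec_topology Kr_ring"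
proof -
  let ?X = "Zar_h_topology R" and ?Y = "Spec_topology Kr_ring"
  define valuation_of where "valuation_of = the_inv_into (Zar_h R) prime_of"
  have valuation_of: "valuation_of (prime_of V) = V" if "V \<in> Zar_h R" for V
    unfolding valuation_of_def using inj_on_prime_of that by (rule the_inv_into_f_f)
  have valuation_of_mem: "valuation_of P \<in> Zar_h R"
    and prime_of_valuation_of: "prime_of (valuation_of P) = P" if "P \<in> Spec Kr_ring" for P
    using that valuation_of unfolding prime_of_image[symmetric] by auto
  have "continuous_map ?X ?Y prime_of"
    unfolding continuous_map_def topspace_Zar_h topspace_Spec
  proof (intro conjI allI impI)
    show "prime_of \<in> Zar_h R \<rightarrow> Spec Kr_ring"
      using prime_of_image by blast
    fix U
    assume "openin ?Y U"
    then obtain S where S: "S \<subseteq> Kr" "U = Spec Kr_ring - {P \<in> Spec Kr_ring. S \<subseteq> P}"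
      unfolding openin_Spec_topology by auto
    \<comment> \<open>An open set of the spectrum is a union of sets given by a single x = f / g
      outside P, and there the condition is that f dominates g.\<close>
    have "openin ?X {V \<in> Zar_h R. x \<notin> prime_of V}" if x: "x \<in> Kr" for x
    proof (cases x)
      case (Fract f g)
      then have "{V \<in> Zar_h R. x \<notin> prime_of V} = {V \<in> Zar_h R. dominated V g f}"
        using Fract_in_prime_of_iff[of _ g f] x by auto
      then show ?thesis
        using openin_dominated by simp
    qed
    then have "openin ?X (\<Union>x\<in>S. {V \<in> Zar_h R. x \<notin> prime_of V})"
      using S(1) by (intro openin_Union) auto
    also have "(\<Union>x\<in>S. {V \<in> Zar_h R. x \<notin> prime_of V}) = {V \<in> Zar_h R. prime_of V \<in> U}"
      unfolding S(2) using prime_of_image by blast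
    finally show "openin ?X {V \<in> Zar_h R. prime_of V \<in> U}" .
  qed
  moreover have "continuous_map ?Y ?X valuation_of"
    unfolding Zar_h_topology_def
  proof (rule continuous_on_generated_topo)
    fix D
    assume "D \<in> Zar_basic ` homogeneous_fractions R"
    then obtain u where u: "u \<in> homogeneous_fractions R" "D = Zar_basic u"
      by blast
    obtain a b \<beta> \<gamma> where ab: "u = Fract a b" "a \<in> R \<beta>" "b \<in> R \<gamma>" "b \<noteq> 0"
      using homogeneous_fractionsE[OF u(1)] by blast
    \<comment> \<open>The preimage of a subbasic set is the open set of the spectrum belonging to
      the single element b / (a + b X).\<close>
    have "valuation_of P \<in> D \<longleftrightarrow> Fract [:b:] [:a, b:] \<notin> P" if P: "P \<in> Spec Kr_ring" for P
      using valuation_of_mem[OF P] Fract_mem_iff_prime_of[OF valuation_of_mem[OF P] ab(2-4)]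
      unfolding u(2) ab(1) prime_of_valuation_of[OF P] by blast
    then have "valuation_of -` D \<inter> topspace ?Y = Spec Kr_ring - {P \<in> Spec Kr_ring. {Fract [:b:] [:a, b:]} \<subseteq> P}"
      unfolding topspace_Spec by blast
    then show "openin ?Y (valuation_of -` D \<inter> topspace ?Y)"
      unfolding openin_Spec_topology using linear_fraction_in_Kr[OF ab(2-4)]
      by (intro exI[of _ "{Fract [:b:] [:a, b:]}"]) simp
  next
    have "\<Union>(Zar_basic ` homogeneous_fractions R) = Zar_h R"
      using topspace_Zar_h unfolding Zar_h_topology_def by simp
    then show "valuation_of ` topspace ?Y \<subseteq> \<Union>(Zar_basic ` homogeneous_fractions R)"
      unfolding topspace_Spec using valuation_of_mem by auto
  qed
  ultimately show ?thesis
    unfolding homeomorphic_space_def homeomorphic_maps_def topspace_Zar_h topspace_Spec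
    using valuation_of prime_of_valuation_of by blast
qed

text \<open>Spectrality is verified on the subbase of the space itself and not transported from the
  spectrum.\<close>

theorem spectral_space_Zar_h: "spectral_space (Zar_h_topology R)"
  unfolding Zar_h_topology_def
proof (rule spectral_space_topology_generated_by)
  let ?\<S> = "Zar_basic ` homogeneous_fractions R"
  have Union: "\<Union>?\<S> = Zar_h R"
    using topspace_Zar_h unfolding Zar_h_topology_def by simp
  {
    fix V V'
    assume "V \<in> \<Union>?\<S>" "V' \<in> \<Union>?\<S>" and iff: "\<And>D. D \<in> ?\<S> \<Longrightarrow> V \<in> D \<longleftrightarrow> V' \<in> D"
    then have V: "V \<in> Zar_h R" "V' \<in> Zar_h R"
      unfolding Union by auto
    have "u \<in> V \<longleftrightarrow> u \<in> V'" if "u \<in> homogeneous_fractions R" for u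
      using iff[OF imageI[OF that]] V by simp
    then show "V = V'"
      by (intro Zar_h_eqI[OF V]) blast
  next
    fix \<A> \<B>
    assume sub: "\<A> \<subseteq> ?\<S>" "\<B> \<subseteq> ?\<S>"
      and fip: "\<And>F G. finite F \<Longrightarrow> F \<subseteq> \<A> \<Longrightarrow> finite G \<Longrightarrow> G \<subseteq> \<B> \<Longrightarrow>
        \<exists>V\<in>\<Union>?\<S>. V \<in> \<Inter>F \<and> V \<notin> \<Union>G"
    \<comment> \<open>Different u may define the same subbasic set; every u that defines a member of
      the family is taken, so that conditions are indexed by elements.\<close>
    define U where "U = {u \<in> homogeneous_fractions R. Zar_basic u \<in> \<A>}"
    define T where "T = {u \<in> homogeneous_fractions R. Zar_basic u \<in> \<B>}"
    have "\<exists>W. valuation_overring W \<and> F \<inter> U \<subseteq> W \<and> W \<inter> (F \<inter> T) = {}" if F: "finite F" for F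
    proof -
      have "\<exists>V\<in>\<Union>?\<S>. V \<in> \<Inter>(Zar_basic ` (F \<inter> U)) \<and> V \<notin> \<Union>(Zar_basic ` (F \<inter> T))"
        by (rule fip) (use F in \<open>auto simp: U_def T_def\<close>)
      then obtain V where V: "V \<in> Zar_h R" "F \<inter> U \<subseteq> V" "V \<inter> (F \<inter> T) = {}"
        unfolding Union by auto
      obtain W where W: "valuation_overring W" "W \<inter> homogeneous_fractions R = V \<inter> homogeneous_fractions R"
        using Zar_h_extension[OF V(1)] .
      have "U \<subseteq> homogeneous_fractions R" "T \<subseteq> homogeneous_fractions R"
        unfolding U_def T_def by auto
      then show ?thesis
        using W V(2,3) by (intro exI[of _ W]) blast
    qed
    then obtain W where W: "valuation_overring W" "U \<subseteq> W" "W \<inter> T = {}"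
      using valuation_overring_compactness[of U T] by blast
    \<comment> \<open>Compactness yields a valuation overring of K. All conditions concern
      homogeneous elements, so its graded core satisfies them as well.\<close>
    note V = graded_core_in_Zar_h[OF W(1)]
    have "graded_core W \<in> D" if D: "D \<in> \<A>" for D
    proof -
      obtain u where u: "u \<in> homogeneous_fractions R" "D = Zar_basic u"
        using sub(1) D by blast
      then have "u \<in> W"
        using W(2) D unfolding U_def by blast
      then show ?thesis
        using u V by blast
    qed
    moreover have "graded_core W \<notin> D" if D: "D \<in> \<B>" for D
    proof -
      obtain u where u: "u \<in> homogeneous_fractions R" "D = Zar_basic u"
        using sub(2) D by blast
      then have "u \<notin> W"
        using W(3) D unfolding T_def by blast
      then show ?thesis
        using u V by blast
    qed
    ultimately show "\<exists>V\<in>\<Union>?\<S>. V \<in> \<Inter>\<A> \<and> V \<notin> \<Union>\<B>"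
      unfolding Union using V(1) by blast
  }
qed

end

theorem corollary3:
  fixes R :: "'g::{comm_monoid_add, cancel_semigroup_add} \<Rightarrow> 'a::idom set"
  assumes nonzero: "\<exists>\<alpha>::'g. \<alpha> \<noteq> 0"
    and torsionless:
      "\<And>(n::nat) (\<alpha>::'g) \<beta>. n \<ge> 1 \<Longrightarrow> (\<Sum>i<n. \<alpha>) = (\<Sum>i<n. \<beta>) \<Longrightarrow> \<alpha> = \<beta>"
    and graded: "graded_domain R"
  shows "Zar_h_topology R homeomorphic_space
           Spec_topology (ring_of_type_algebra\<lparr>carrier := Kr_h R b_operation\<rparr>)
       \<and> spectral_space (Zar_h_topology R)"
proof -
  interpret torsionless_graded_domain R
    using graded torsionless by (intro torsionless_graded_domain.intro torsionless_graded_domain_axioms.intro)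
  show ?thesis
    using homeomorphic_Zar_h_Spec spectral_space_Zar_h by blast
qed

end
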